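(* Let $\kappa$ be of class $\mathcal{G}_2(2,0)$ and $f\in C^2[0,1]$. Let $\varphi$ be the unique solution of $x-\mathcal{K}(x)=f$ and assume that $1$ is not an eigenvalue of $\mathcal{K}'(\varphi)$. Let $\mathcal{X}_n$ be the space of piecewise constant functions with respect to the uniform partition $\{t_j=j/n\}$ and $Q_n:L^\infty[0,1]\to\mathcal{X}_n$ the discrete orthogonal projection (based on the composite Gauss two-point rule). Let $\tilde z_n^M=\mathcal{K}_m(z_n^M)+f$ be the discrete iterated modified projection solution. Then $$\|\tilde z_n^M-\varphi\|_\infty=O\big(\max\{\tilde h^{2},h^{4}\}\big).$$
   Context: Setting. $\mathcal{X}=L^\infty[0,1]$ with sup norm. A kernel $\kappa:[0,1]\times[0,1]\times\mathbb{R}\to\mathbb{R}$ is of class $\mathcal{G}_2(2,0)$ if: (1) $\ell=\partial\kappa/\partial u$ is continuous on $\Psi=[0,1]^2\times\mathbb{R}$; (2) with $\Psi_1=\{0\le t\le s\le1,u\in\mathbb{R}\}$, $\Psi_2=\{0\le s\le t\le1,u\in\mathbb{R}\}$, there are $\ell_i\in C^{2}(\Psi_i)$ with $\ell=\ell_i$ on $\Psi_i$; (3) there are $\kappa_i\in C^{2}(\Psi_i)$ with $\kappa=\kappa_i$ on $\Psi_i$; (4) $\partial^2\kappa/\partial u^2$ is continuous on $\Psi$. $\mathcal{K}(x)(s)=\int_0^1\kappa(s,t,x(t))dt$, assumed twice Fréchet differentiable. Quadrature: Gauss two-point rule with $w_1=w_2=1/2$, $\mu_{1,2}=\tfrac12\mp\tfrac1{2\sqrt3}$.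 For $n,p\in\mathbb{N}$, $m=np$, $h=1/n$, $\tilde h=1/m$, $s_i=i/m$, $\zeta_q^i=s_{i-1}+\mu_q\tilde h$. Nyström operator $\mathcal{K}_m(x)(s)=\tilde h\sum_{i=1}^m\sum_{q=1}^2 w_q\kappa(s,\zeta_q^i,x(\zeta_q^i))$. Projection: $t_j=j/n$; $\mathcal{X}_n$ consists of functions constant on $[t_0,t_1]$ and on each $(t_{j-1},t_j]$, $j\ge2$. For $v\in C[0,1]$, $(Q_nv)(t)=\frac1p\sum_{\nu=1}^p\sum_{q=1}^2w_qv(\zeta_q^{(j-1)p+\nu})$ for $t\in(t_{j-1},t_j]$ (and at $t=0$ with $j=1$); $Q_n$ is extended to a bounded projection on $L^\infty[0,1]$ via Hahn–Banach. Method: $\tilde{\mathcal{K}}_n^M(x)=Q_n\mathcal{K}_m(x)+\mathcal{K}_m(Q_nx)-Q_n\mathcal{K}_m(Q_nx)$. There is $\delta_0>0$ such that for $n$ large enough $z-\tilde{\mathcal{K}}_n^M(z)=f$ has a unique solution $z_n^M$ in $\mathcal{B}(\varphi,\delta_0)=\{\psi:\|\psi-\varphi\|_\infty<\delta_0\}$. Notation: $A=O(B)$ means $|A|\le CB$ with $C$ independent of $n,p$, for all sufficiently large $n$. *)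

theory Defs
  imports "HOL-Analysis.Analysis"
begin

text \<open>Elements of L-infinity[0,1] are represented by functions real => real whose
  values only matter on [0,1]; they must be Lebesgue measurable and bounded there.\<close>

definition sup01 :: "(real \<Rightarrow> real) \<Rightarrow> real" where
  "sup01 x = (SUP t\<in>{0..1}. \<bar>x t\<bar>)"

definition Linf01 :: "(real \<Rightarrow> real) \<Rightarrow> bool" where
  "Linf01 x \<longleftrightarrow> set_borel_measurable lebesgue {0..1} x \<and> bdd_above ((\<lambda>t. \<bar>x t\<bar>) ` {0..1})"

definition frechet01 ::
  "((real \<Rightarrow> real) \<Rightarrow> (real \<Rightarrow> real)) \<Rightarrow> (real \<Rightarrow> real) \<Rightarrow> ((real \<Rightarrow> real) \<Rightarrow> (real \<Rightarrow> real)) \<Rightarrow> bool" where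
  "frechet01 F x L \<longleftrightarrow>
     (\<forall>u. Linf01 u \<longrightarrow> Linf01 (L u)) \<and>
     (\<forall>u v a b. Linf01 u \<and> Linf01 v \<longrightarrow>
        (\<forall>s\<in>{0..1}. L (\<lambda>t. a * u t + b * v t) s = a * L u s + b * L v s)) \<and>
     (\<exists>B. \<forall>u. Linf01 u \<longrightarrow> sup01 (L u) \<le> B * sup01 u) \<and>
     (\<forall>e>0. \<exists>d>0. \<forall>h. Linf01 h \<and> sup01 h < d \<longrightarrow>
        sup01 (\<lambda>s. F (\<lambda>t. x t + h t) s - F x s - L h s) \<le> e * sup01 h)"

definition Psi :: "(real \<times> real \<times> real) set" where
  "Psi = {0..1} \<times> {0..1} \<times> UNIV"

definition Psi1 :: "(real \<times> real \<times> real) set" where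
  "Psi1 = {(s,t,u). 0 \<le> t \<and> t \<le> s \<and> s \<le> 1}"

definition Psi2 :: "(real \<times> real \<times> real) set" where
  "Psi2 = {(s,t,u). 0 \<le> s \<and> s \<le> t \<and> t \<le> 1}"

definition C2_on :: "(real \<times> real \<times> real) set \<Rightarrow> (real \<times> real \<times> real \<Rightarrow> real) \<Rightarrow> bool" where
  "C2_on S g \<longleftrightarrow>
     (\<exists>U G D1 D2. open U \<and> S \<subseteq> U \<and>
        (\<forall>y\<in>U. (G has_derivative blinfun_apply (D1 y)) (at y)) \<and>
        (\<forall>y\<in>U. (D1 has_derivative blinfun_apply (D2 y)) (at y)) \<and>
        continuous_on U D2 \<and>
        (\<forall>y\<in>S. G y = g y))"

definition kernel_G2_2_0 :: "(real \<Rightarrow> real \<Rightarrow> real \<Rightarrow> real) \<Rightarrow> bool" where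
  "kernel_G2_2_0 \<kappa> \<longleftrightarrow>
     (\<exists>ell \<kappa>uu.
        (\<forall>(s,t,u)\<in>Psi. ((\<lambda>v. \<kappa> s t v) has_real_derivative ell s t u) (at u)) \<and>
        continuous_on Psi (\<lambda>(s,t,u). ell s t u) \<and>
        C2_on Psi1 (\<lambda>(s,t,u). ell s t u) \<and> C2_on Psi2 (\<lambda>(s,t,u). ell s t u) \<and>
        C2_on Psi1 (\<lambda>(s,t,u). \<kappa> s t u) \<and> C2_on Psi2 (\<lambda>(s,t,u). \<kappa> s t u) \<and>
        (\<forall>(s,t,u)\<in>Psi. ((\<lambda>v. ell s t v) has_real_derivative \<kappa>uu s t u) (at u)) \<and>
        continuous_on Psi (\<lambda>(s,t,u). \<kappa>uu s t u))"

definition C2_01 :: "(real \<Rightarrow> real) \<Rightarrow> bool" where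
  "C2_01 f \<longleftrightarrow> (\<exists>f1 f2.
     (\<forall>t\<in>{0..1}. (f has_real_derivative f1 t) (at t within {0..1})) \<and>
     (\<forall>t\<in>{0..1}. (f1 has_real_derivative f2 t) (at t within {0..1})) \<and>
     continuous_on {0..1} f2)"

definition Kop :: "(real \<Rightarrow> real \<Rightarrow> real \<Rightarrow> real) \<Rightarrow> (real \<Rightarrow> real) \<Rightarrow> real \<Rightarrow> real" where
  "Kop \<kappa> x s = (LINT t:{0..1}|lebesgue. \<kappa> s t (x t))"

definition gauss_mu :: "nat \<Rightarrow> real" where
  "gauss_mu q = (if q = 1 then 1/2 - 1 / (2 * sqrt 3) else 1/2 + 1 / (2 * sqrt 3))"

definition gauss_w :: "nat \<Rightarrow> real" where
  "gauss_w q = 1/2"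

definition zeta :: "nat \<Rightarrow> nat \<Rightarrow> nat \<Rightarrow> real" where
  "zeta m q i = (real i - 1) / real m + gauss_mu q / real m"

definition Km :: "(real \<Rightarrow> real \<Rightarrow> real \<Rightarrow> real) \<Rightarrow> nat \<Rightarrow> (real \<Rightarrow> real) \<Rightarrow> real \<Rightarrow> real" where
  "Km \<kappa> m x s = (1 / real m) * (\<Sum>i=1..m. \<Sum>q\<in>{1,2}. gauss_w q * \<kappa> s (zeta m q i) (x (zeta m q i)))"

text \<open>Index j of the cell (t_{j-1}, t_j] containing t (and j = 1 for t = 0).\<close>
definition cell :: "nat \<Rightarrow> real \<Rightarrow> nat" where
  "cell n t = (if t \<le> 0 then 1 else nat \<lceil>t * real n\<rceil>)"

definition Qn :: "nat \<Rightarrow> nat \<Rightarrow> (real \<Rightarrow> real) \<Rightarrow> real \<Rightarrow> real" where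
  "Qn n p v t = (1 / real p) *
     (\<Sum>\<nu>=1..p. \<Sum>q\<in>{1,2}. gauss_w q * v (zeta (n * p) q ((cell n t - 1) * p + \<nu>)))"

definition KtilM :: "(real \<Rightarrow> real \<Rightarrow> real \<Rightarrow> real) \<Rightarrow> nat \<Rightarrow> nat \<Rightarrow> (real \<Rightarrow> real) \<Rightarrow> real \<Rightarrow> real" where
  "KtilM \<kappa> n p x s =
     Qn n p (Km \<kappa> (n * p) x) s + Km \<kappa> (n * p) (Qn n p x) s - Qn n p (Km \<kappa> (n * p) (Qn n p x)) s"

end

theory Submission
  imports Defs "HOL-Complex_Analysis.Great_Picard"
begin

text \<open>Write \<open>A = Km\<close>, \<open>Q = Qn\<close>. Applying \<open>Q\<close> to the equation shows that the iterate \<open>y = f + A z\<close> satisfies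
  \<open>Q y = Q z\<close>, hence \<open>z = Z y\<close> with \<open>Z y = Q y + (I - Q) (f + A (Q y))\<close>, and \<open>y\<close> is a fixed point of
  \<open>G y = f + A (Z y)\<close>. Unlike \<open>z\<close>, the iterate is Lipschitz continuous, and differences of values of
  \<open>G\<close> have Lipschitz constants bounded by the sup norm of the difference of the arguments. On such
  functions \<open>L = K'(\<phi>)\<close> is the derivative of \<open>G\<close> up to \<open>O(h)\<close>. As \<open>I - L\<close> is invertible (Riesz theory
  for the compact operator \<open>L\<close>), a simplified Newton iteration yields a locally unique fixed point with
  \<open>\<parallel>y - \<phi>\<parallel> = O(\<parallel>G \<phi> - \<phi>\<parallel>)\<close>.

  For the consistency error put \<open>e = K \<phi> - A \<phi>\<close> and \<open>g = A \<phi> - A (Q \<phi>)\<close>; then \<open>Z \<phi> - \<phi> = - (I - Q) (e + g)\<close>.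
  The kernel is piecewise \<open>C\<^sup>2\<close> with a kink on the diagonal, so \<open>e\<close> is of the order of the squared fine mesh
  width. Since \<open>(I - Q) \<phi>\<close> has mean value zero on each cell, \<open>g\<close> has Lipschitz constant \<open>O(h\<^sup>2)\<close> within a
  cell, so \<open>(I - Q) g = O(h\<^sup>3)\<close>, and integrating against the kernel gains another \<open>h\<close>.\<close>

section \<open>Riesz theory for compact perturbations of the identity\<close>

text \<open>The obstacle is that \<open>Qn\<close> tends to the identity pointwise on continuous
  functions but not in operator norm. The derivative of \<open>G\<close> is therefore not controlled
  in norm by \<open>L\<close>, which rules out the usual perturbation argument for derivatives and
  forces the bookkeeping of Lipschitz constants. The residual \<open>G \<phi> - \<phi>\<close> is
  small in norm but comes without an equally small Lipschitz constant, so the error estimate has to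
  treat it separately. The kernel is smooth only on each side of the diagonal, so smoothness enters
  through finite differences. First differences may cross the diagonal; second and mixed ones are
  taken on one side, and the exceptional set (one subcell, one coarse cell, one strip) is harmless
  because it is short. Kernel bounds are available for arguments of modulus at most
  \<open>R\<close>, one more than a bound of \<phi>, and everything inserted into the kernel is kept
  in this range. All constants are fixed before \<open>n\<close> and \<open>p\<close>, which gives
  uniformity in both.\<close>

definition seq_compact_map :: "('a::real_normed_vector \<Rightarrow> 'a) \<Rightarrow> bool" where
  "seq_compact_map L \<longleftrightarrow> (\<forall>x::nat \<Rightarrow> 'a. bounded (range x) \<longrightarrow>
     (\<exists>l r. strict_mono (r::nat \<Rightarrow> nat) \<and> (\<lambda>k. L (x (r k))) \<longlonglongrightarrow> l))"

text \<open>If no \<open>B\<close> worked, there would be unit vectors \<open>u k\<close> with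
  \<open>u k - L (u k)\<close> tending to 0. Compactness makes a subsequence of
  \<open>L (u k)\<close> converge, hence also \<open>u k\<close> along it, to a unit vector fixed by
  \<open>L\<close>.\<close>

lemma id_minus_compact_bounded_below:
  fixes L :: "'a::real_normed_vector \<Rightarrow> 'a"
  assumes L: "bounded_linear L" and cpt: "seq_compact_map L"
    and inj: "\<And>x. L x = x \<Longrightarrow> x = 0"
  shows "\<exists>B>0. \<forall>x. norm x \<le> B * norm (x - L x)"
proof (rule ccontr)
  interpret L: bounded_linear L by (rule L)
  assume "\<not> ?thesis"
  then have "\<exists>x. norm x > real (Suc k) * norm (x - L x)" for k
    by (meson not_le of_nat_0_less_iff zero_less_Suc)
  then obtain x where x: "\<And>k. norm (x k) > real (Suc k) * norm (x k - L (x k))" by metis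
  define u where "u k = x k /\<^sub>R norm (x k)" for k
  have nx: "norm (x k) > 0" for k
    using x[of k] by (smt (verit) mult_nonneg_nonneg norm_ge_zero of_nat_0_le_iff)
  then have nu: "norm (u k) = 1" for k
    by (simp add: u_def)
  have du: "norm (u k - L (u k)) \<le> 1 / real (Suc k)" for k
  proof -
    have "u k - L (u k) = (x k - L (x k)) /\<^sub>R norm (x k)"
      by (simp add: u_def L.scaleR scaleR_diff_right)
    then have "norm (u k - L (u k)) = norm (x k - L (x k)) / norm (x k)"
      by (simp add: divide_inverse mult.commute)
    moreover have "norm (x k - L (x k)) / norm (x k) \<le> 1 / real (Suc k)"
      using x[of k] nx[of k] by (simp add: field_simps)
    ultimately show ?thesis by simp
  qed
  have "bounded (range u)"
    unfolding bounded_iff using nu by auto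
  then obtain l r where r: "strict_mono (r::nat \<Rightarrow> nat)" and lim: "(\<lambda>k. L (u (r k))) \<longlonglongrightarrow> l"
    using cpt unfolding seq_compact_map_def by blast
  have "(\<lambda>k. 1 / real (Suc k)) \<longlonglongrightarrow> 0"
    using LIMSEQ_inverse_real_of_nat by (simp add: inverse_eq_divide)
  then have "(\<lambda>k. u k - L (u k)) \<longlonglongrightarrow> 0"
    by (rule Lim_null_comparison[rotated]) (use du in simp)
  then have "(\<lambda>k. u (r k) - L (u (r k))) \<longlonglongrightarrow> 0"
    using LIMSEQ_subseq_LIMSEQ[OF _ r] by (simp add: o_def)
  from tendsto_add[OF this lim] have ul: "(\<lambda>k. u (r k)) \<longlonglongrightarrow> l" by simp
  from L.tendsto[OF this] lim have "L l = l"
    using LIMSEQ_unique by blast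
  then have "l = 0" by (rule inj)
  with tendsto_norm[OF ul] show False
    by (simp add: nu LIMSEQ_const_iff)
qed

text \<open>Riesz's lemma with constant 1/2, relative to an ambient subspace \<open>W\<close> as
  needed for a chain of nested ranges. The vector is \<open>a - z\<close> normalised, where
  \<open>z\<close> in \<open>V\<close> almost realises the positive distance from \<open>a\<close>
  to the closed set \<open>V\<close>.\<close>

lemma subspace_almost_orthogonal:
  fixes V :: "'a::real_normed_vector set"
  assumes V: "subspace V" "closed V" and W: "subspace W" "V \<subseteq> W" and a: "a \<in> W" "a \<notin> V"
  obtains x where "x \<in> W" "norm x = 1" "\<And>w. w \<in> V \<Longrightarrow> norm (x - w) \<ge> 1/2"
proof -
  have ne: "V \<noteq> {}" using subspace_0[OF V(1)] by auto
  define d where "d = infdist a V"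
  have d: "d > 0"
    unfolding d_def using V(2) ne a(2) by (metis in_closed_iff_infdist_zero infdist_nonneg less_eq_real_def)
  have "infdist a V < 2 * d" using d by (simp add: d_def)
  then obtain z where z: "z \<in> V" "dist a z < 2 * d"
    using ne unfolding infdist_notempty[OF ne] by (subst (asm) cINF_less_iff) auto
  define x where "x = (a - z) /\<^sub>R norm (a - z)"
  have az: "norm (a - z) > 0" using z a by auto
  show ?thesis
  proof
    show "x \<in> W" unfolding x_def using W a z by (auto intro!: subspace_scale subspace_diff)
    show "norm x = 1" using az by (simp add: x_def)
    fix w assume w: "w \<in> V"
    \<comment> \<open>Rescaled by \<open>norm (a - z)\<close> and shifted by \<open>z\<close>, any
      \<open>w\<close> in \<open>V\<close> competes for the distance from \<open>a\<close>.\<close>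
    have "z + norm (a - z) *\<^sub>R w \<in> V" using V z w by (auto intro!: subspace_add subspace_scale)
    then have "d \<le> norm (a - (z + norm (a - z) *\<^sub>R w))"
      unfolding d_def by (metis dist_norm infdist_le)
    also have "a - (z + norm (a - z) *\<^sub>R w) = norm (a - z) *\<^sub>R (x - w)"
      using az by (simp add: x_def algebra_simps)
    also have "norm \<dots> = norm (a - z) * norm (x - w)" by simp
    also have "\<dots> \<le> 2 * d * norm (x - w)"
      using z by (intro mult_right_mono) (auto simp: dist_norm)
    finally show "norm (x - w) \<ge> 1/2" using d by simp
  qed
qed

text \<open>Fredholm alternative. If \<open>T = I - L\<close> were injective but not onto, the
  ranges of its powers would form a strictly decreasing chain of closed subspaces. Almost orthogonal
  unit vectors chosen along the chain have 1/2-separated images under \<open>L\<close>, against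
  compactness.\<close>

lemma id_minus_compact_surj:
  fixes L :: "'a::banach \<Rightarrow> 'a"
  assumes L: "bounded_linear L" and cpt: "seq_compact_map L"
    and inj: "\<And>x. L x = x \<Longrightarrow> x = 0"
  shows "surj (\<lambda>x. x - L x)"
proof (rule ccontr)
  interpret L: bounded_linear L by (rule L)
  define T where "T x = x - L x" for x
  interpret T: bounded_linear T
    unfolding T_def using bounded_linear_sub[OF bounded_linear_ident L] .
  obtain B where B: "B > 0" "\<And>x. norm x \<le> B * norm (T x)"
    using id_minus_compact_bounded_below[OF assms] unfolding T_def by blast
  assume "\<not> surj (\<lambda>x. x - L x)"
  then obtain y where y: "y \<notin> range T" unfolding T_def by auto
  have Tinj: "T a = T b \<Longrightarrow> a = b" for a b
    using B(2)[of "a - b"] by (simp add: T.diff)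
  define V where "V k = range (T ^^ k)" for k :: nat
  have blin: "bounded_linear (T ^^ k)" for k
    by (induction k) (auto simp: o_def id_def intro!: bounded_linear_ident bounded_linear_compose[OF T.bounded_linear_axioms])
  have below: "norm x \<le> B ^ k * norm ((T ^^ k) x)" for k x
  proof (induction k)
    case (Suc k)
    have "B ^ k * norm ((T ^^ k) x) \<le> B ^ k * (B * norm (T ((T ^^ k) x)))"
      using B by (intro mult_left_mono) auto
    with Suc show ?case by (simp add: algebra_simps)
  qed simp
  have sub: "subspace (V k)" for k
    unfolding V_def by (rule linear_subspace_image) (auto intro!: bounded_linear.linear blin)
  \<comment> \<open>Each power of \<open>T\<close> is bounded below on a complete space, so its
    range is complete.\<close>
  have cl: "closed (V k)" for k
    unfolding V_def
  proof (rule complete_imp_closed, rule complete_isometric_image)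
    show "1 / B ^ k > 0" using B by simp
    show "\<forall>x\<in>UNIV. 1 / B ^ k * norm x \<le> norm ((T ^^ k) x)"
      using below[of _ k] B by (simp add: field_simps)
  qed (auto simp: blin complete_UNIV)
  have mono1: "V (Suc k) \<subseteq> V k" for k
    unfolding V_def by (auto simp: funpow_swap1)
  have mono: "V j \<subseteq> V k" if "k \<le> j" for j k
    using that by (induction rule: dec_induct) (use mono1 in auto)
  \<comment> \<open>Injectivity of \<open>T ^^ k\<close> transports the defect of \<open>y\<close>
    down the chain.\<close>
  have notin: "(T ^^ k) y \<notin> V (Suc k)" for k
  proof
    assume "(T ^^ k) y \<in> V (Suc k)"
    then obtain x where x: "(T ^^ k) y = (T ^^ k) (T x)" unfolding V_def by (auto simp: funpow_swap1)
    have "(T ^^ k) a = (T ^^ k) b \<Longrightarrow> a = b" for a b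
      by (induction k) (use Tinj in auto)
    with x y show False by blast
  qed
  have "\<exists>x. x \<in> V k \<and> norm x = 1 \<and> (\<forall>w\<in>V (Suc k). norm (x - w) \<ge> 1/2)" for k
    by (rule subspace_almost_orthogonal[OF sub cl sub mono1 _ notin[of k], of ])
      (auto simp: V_def)
  then obtain x where x: "\<And>k. x k \<in> V k" "\<And>k. norm (x k) = 1"
      "\<And>k w. w \<in> V (Suc k) \<Longrightarrow> norm (x k - w) \<ge> 1/2"
    by metis
  have TV: "T v \<in> V (Suc k)" if "v \<in> V k" for v k
    using that unfolding V_def by auto
  have sep: "norm (L (x k) - L (x j)) \<ge> 1/2" if "k < j" for k j
  proof -
    \<comment> \<open>\<open>L (x k) - L (x j)\<close> equals \<open>x k\<close> minus this
      vector.\<close>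
    have "T (x k) + x j - T (x j) \<in> V (Suc k)"
      using TV[OF x(1)[of k]] mono[of "Suc k" j] x(1)[of j] mono[of "Suc k" "Suc j"] TV[OF x(1)[of j]] that
      by (intro subspace_diff[OF sub] subspace_add[OF sub]) auto
    from x(3)[OF this] show ?thesis by (simp add: T_def algebra_simps)
  qed
  have "bounded (range x)"
    unfolding bounded_iff using x by auto
  then obtain l r where r: "strict_mono (r::nat \<Rightarrow> nat)" and lim: "(\<lambda>k. L (x (r k))) \<longlonglongrightarrow> l"
    using cpt unfolding seq_compact_map_def by blast
  from lim have "Cauchy (\<lambda>k. L (x (r k)))" by (rule LIMSEQ_imp_Cauchy)
  then obtain M where M: "\<And>m n. m \<ge> M \<Longrightarrow> n \<ge> M \<Longrightarrow> norm (L (x (r m)) - L (x (r n))) < 1/2"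
    unfolding Cauchy_iff by (meson half_gt_zero zero_less_one)
  from M[of M "Suc M"] sep[of "r M" "r (Suc M)"] r show False
    by (simp add: strict_mono_def)
qed

section \<open>Fixed points of approximating maps\<close>

text \<open>\<open>P b x\<close> stands for ``\<open>x\<close> has Lipschitz constant at most \<open>b\<close>'' and \<open>h\<close> for the mesh width: \<open>L\<close> approximates
  the derivative of \<open>G\<close> only on functions with a controlled Lipschitz constant, not in operator norm.\<close>

definition approximates ::
  "(real \<Rightarrow> 'a::real_normed_vector \<Rightarrow> bool) \<Rightarrow> ('a \<Rightarrow> 'a) \<Rightarrow> 'a \<Rightarrow> real \<Rightarrow> real \<Rightarrow> real \<Rightarrow> ('a \<Rightarrow> 'a) \<Rightarrow> bool" where
  "approximates P L \<phi> \<rho> C h G \<longleftrightarrow> P C (G \<phi>) \<and>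
     (\<forall>x y. norm (x - \<phi>) \<le> \<rho> \<and> norm (y - \<phi>) \<le> \<rho> \<longrightarrow>
        norm (G x - G y) \<le> C * norm (x - y) \<and> P (C * norm (x - y)) (G x - G y) \<and>
        (\<forall>b. P b (x - y) \<longrightarrow>
           norm (G x - G y - L (x - y)) \<le> C * ((norm (x - \<phi>) + norm (y - \<phi>) + h) * norm (x - y) + h * b)))"

text \<open>Merges several smallness conditions into one: if \<open>K\<close> dominates each of
  finitely many coefficients, a single \<open>e\<close> serves them all.\<close>

lemma exists_small_pos:
  fixes K r q :: real
  assumes "0 \<le> K" "0 < r" "0 < q"
  shows "\<exists>e>0. e \<le> r \<and> (\<forall>k\<le>K. k * e \<le> q)"
proof (intro exI[of _ "min r (q / (K + 1))"] conjI allI impI)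
  fix k assume k: "k \<le> K"
  have "k * min r (q / (K + 1)) \<le> (K + 1) * min r (q / (K + 1))"
    using assms k by (intro mult_right_mono) auto
  also have "\<dots> \<le> (K + 1) * (q / (K + 1))" using assms by (intro mult_left_mono) auto
  finally show "k * min r (q / (K + 1)) \<le> q" using assms by simp
qed (use assms in auto)

text \<open>The order of quantifiers is the point: \<epsilon>, \<eta> and \<open>C'\<close> are
  chosen before \<open>G\<close> and \<open>h\<close>. Uniqueness and the error bound are proved for
  arbitrary fixed points in the ball; existence comes from iterating on the smaller set
  \<open>A\<close> of elements with controlled \<open>P\<close>.\<close>

theorem perturbed_fixed_point:
  fixes L :: "'a::banach \<Rightarrow> 'a" and P :: "real \<Rightarrow> 'a \<Rightarrow> bool"
  assumes L: "bounded_linear L" and normL: "\<And>x. norm (L x) \<le> C * norm x"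
    and B: "B > 0" "\<And>x. norm x \<le> B * norm (x - L x)" and surj: "surj (\<lambda>x. x - L x)"
    and P_add: "\<And>b c x y. P b x \<Longrightarrow> P c y \<Longrightarrow> P (b + c) (x + y)"
    and P_minus: "\<And>b x. P b x \<Longrightarrow> P b (- x)"
    and P_mono: "\<And>b c x. P b x \<Longrightarrow> b \<le> c \<Longrightarrow> P c x"
    and P_closed: "\<And>b. closed {x. P b x}"
    and P_L: "\<And>x. P (C * norm x) (L x)" and P_phi: "P C \<phi>"
    and C: "C \<ge> 1" and rho: "\<rho> > 0"
  shows "\<exists>\<epsilon>>0. \<epsilon> \<le> \<rho> \<and> (\<exists>\<eta>>0. \<exists>C'. \<forall>G h. 0 \<le> h \<and> h \<le> \<eta> \<and> norm (G \<phi> - \<phi>) \<le> \<eta> \<and>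
           approximates P L \<phi> \<rho> C h G \<longrightarrow>
           (\<exists>y. norm (y - \<phi>) \<le> \<epsilon> \<and> G y = y \<and> norm (y - \<phi>) \<le> C' * norm (G \<phi> - \<phi>) \<and>
                (\<forall>y'. norm (y' - \<phi>) \<le> \<epsilon> \<and> G y' = y' \<longrightarrow> y' = y)))"
proof -
  interpret L: bounded_linear L by (rule L)
  \<comment> \<open>\<open>C1\<close> bounds the growth of differences under one Newton step, and
    \<open>C2\<close> turns their norm into a \<open>P\<close>-bound after that step.
    \<open>M\<close> is the \<open>P\<close>-bound kept by the iterates: \<open>C\<close> for
    \<open>G \<phi>\<close>, \<open>C * \<rho>\<close> for \<open>G y - G \<phi>\<close>, the rest
    for the terms \<open>L y\<close> and \<open>L (F y)\<close>.\<close>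
  define C1 where "C1 = 2 * B * C"
  define C2 where "C2 = 2 * C + C * C1"
  define M where "M = C + C * \<rho> + 2 * C * (norm \<phi> + \<rho>)"
  have pos: "B * C > 0" "C1 > 0" "C2 > 0" "M > 0" "C > 0"
    using B C rho by (auto simp: C1_def C2_def M_def intro!: add_pos_nonneg add_nonneg_nonneg)
  \<comment> \<open>\<open>K\<close> dominates the coefficients of \<epsilon> met below,
    \<open>H\<close> those of \<open>h\<close> and of the residual norm. The bound
    \<open>\<epsilon> / 8\<close> in \<open>q\<close> is for terms that must fit into the ball
    rather than into a contraction factor.\<close>
  define K where "K = 3 * (B * C) + 2 * (B * C * C1) + B * C * C"
  have nn: "B * C * C1 \<ge> 0" "B * C * C \<ge> 0" using pos by auto
  have "K \<ge> 0" using pos B C by (auto simp: K_def intro!: add_nonneg_nonneg)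
  then obtain \<epsilon> where eps: "\<epsilon> > 0" "\<epsilon> \<le> \<rho> / 2" and eps': "\<And>k. k \<le> K \<Longrightarrow> k * \<epsilon> \<le> 1/8"
    using exists_small_pos[of K "\<rho>/2" "1/8"] rho by auto
  have epsK: "B * C * \<epsilon> \<le> 1/8" "2 * (B * C * C1) * \<epsilon> \<le> 1/8" "B * C * C * \<epsilon> \<le> 1/8" "2 * (B * C) * \<epsilon> \<le> 1/8"
    by (rule eps', use nn pos in \<open>simp add: K_def\<close>)+
  define H where "H = B * C + B * C * (M + C) + B + B * C * (C1 + C2) + B * C * C"
  have Hpos: "H \<ge> 0" using pos B C by (auto simp: H_def intro!: add_nonneg_nonneg mult_nonneg_nonneg)
  define q where "q = min (1/8) (\<epsilon> / 8)"
  have q: "q > 0" "q \<le> 1/8" "q \<le> \<epsilon> / 8" using eps by (auto simp: q_def)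
  obtain \<eta> where eta: "\<eta> > 0" "\<eta> \<le> \<rho> / 2" and eta': "\<And>k. k \<le> H \<Longrightarrow> k * \<eta> \<le> q"
    using exists_small_pos[of H "\<rho>/2" q] rho Hpos q by auto
  have le: "B * C \<le> H" "B * C * (M + C) \<le> H" "B \<le> H" "B * C * (C1 + C2) \<le> H" "B * C * C \<le> H"
    using pos B C by (auto simp: H_def intro!: add_nonneg_nonneg mult_nonneg_nonneg)
  define C' where "C' = 2 * B * (C + C * C * \<eta>) + 1"
  have "\<exists>y. norm (y - \<phi>) \<le> \<epsilon> \<and> G y = y \<and> norm (y - \<phi>) \<le> C' * norm (G \<phi> - \<phi>) \<and>
                (\<forall>y'. norm (y' - \<phi>) \<le> \<epsilon> \<and> G y' = y' \<longrightarrow> y' = y)"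
    if h: "0 \<le> h" "h \<le> \<eta>" and e\<eta>: "norm (G \<phi> - \<phi>) \<le> \<eta>" and ap: "approximates P L \<phi> \<rho> C h G" for G h
  proof -
    have PG: "P C (G \<phi>)" using ap unfolding approximates_def by blast
    have Gn: "norm (G x - G y) \<le> C * norm (x - y)" and GP: "P (C * norm (x - y)) (G x - G y)"
      if "norm (x - \<phi>) \<le> \<rho>" "norm (y - \<phi>) \<le> \<rho>" for x y
      using ap that unfolding approximates_def by blast+
    have Glin: "norm (G x - G y - L (x - y)) \<le> C * ((norm (x - \<phi>) + norm (y - \<phi>) + h) * norm (x - y) + h * b)"
      if "norm (x - \<phi>) \<le> \<rho>" "norm (y - \<phi>) \<le> \<rho>" "P b (x - y)" for x y b
      using ap that unfolding approximates_def by blast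
    have hs: "B * C * h \<le> q" "B * C * (M + C) * h \<le> q" "B * C * (C1 + C2) * h \<le> q" "B * C * C * h \<le> q"
      using eta'[OF le(1)] eta'[OF le(2)] eta'[OF le(4)] eta'[OF le(5)] h pos B C
      by (smt (verit) mult_left_mono mult_pos_pos)+
    define e where "e = G \<phi> - \<phi>"
    have Be: "B * norm e \<le> q"
      using eta'[OF le(3)] e\<eta> B by (smt (verit) mult_left_mono e_def)
    have eps\<rho>: "\<epsilon> \<le> \<rho>" using eps rho by simp

    \<comment> \<open>Two fixed points differ by \<open>G y - G y'\<close>, so the difference
      satisfies \<open>P\<close> with a multiple of its own norm, and the linearization
      applies.\<close>
    have uniq: "y = y'" if y: "norm (y - \<phi>) \<le> \<epsilon>" "G y = y" and y': "norm (y' - \<phi>) \<le> \<epsilon>" "G y' = y'" for y y'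
    proof -
      define a where "a = norm (y - y')"
      have "P (C * a) (y - y')" using GP[of y y'] y y' eps\<rho> by (simp add: a_def)
      then have "norm (y - y' - L (y - y')) \<le> C * ((norm (y - \<phi>) + norm (y' - \<phi>) + h) * a + h * (C * a))"
        using Glin[of y y' "C * a"] y y' eps\<rho> by (simp add: a_def)
      also have "\<dots> \<le> C * ((\<epsilon> + \<epsilon> + h) * a + h * (C * a))"
        using y y' C by (intro mult_left_mono add_mono mult_right_mono) (auto simp: a_def)
      finally have "B * norm (y - y' - L (y - y')) \<le> B * (C * ((\<epsilon> + \<epsilon> + h) * a + h * (C * a)))"
        using B by (intro mult_left_mono) auto
      also have "\<dots> = (2 * (B * C) * \<epsilon> + B * C * h + B * C * C * h) * a" by (simp add: algebra_simps)
      also have "\<dots> \<le> (1/2) * a"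
        using epsK hs q by (intro mult_right_mono) (auto simp: a_def)
      finally have "a \<le> (1/2) * a" using B(2)[of "y - y'"] unfolding a_def by linarith
      then show ?thesis by (simp add: a_def)
    qed

    have stab: "norm (y - \<phi>) \<le> C' * norm e" if y: "norm (y - \<phi>) \<le> \<epsilon>" "G y = y" for y
    proof -
      \<comment> \<open>No Lipschitz bound on \<open>e\<close> is available, so it is split off before linearizing.\<close>
      define d1 where "d1 = G y - G \<phi>"
      have d: "y - \<phi> = d1 + e" "\<phi> + d1 = y - e" using y by (auto simp: d1_def e_def)
      have eq: "y - e - \<phi> = (y - \<phi>) - e" by (simp add: algebra_simps)
      have "norm (y - e - \<phi>) \<le> norm (y - \<phi>) + norm e"
        unfolding eq by (rule norm_triangle_ineq4)
      then have r1: "norm (\<phi> + d1 - \<phi>) \<le> \<rho>"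
        using y e\<eta> eps eta d(2) by (simp add: e_def)
      have r0: "norm (\<phi> - \<phi>) \<le> \<rho>" using rho by simp
      have ry: "norm (y - \<phi>) \<le> \<rho>" using y eps\<rho> by simp
      have Pd: "P (C * norm (y - \<phi>)) (\<phi> + d1 - \<phi>)" using GP[OF ry r0] by (simp add: d1_def)
      have nd1: "norm d1 \<le> C * \<epsilon>"
        using Gn[OF ry r0] y C by (smt (verit) d1_def mult_left_mono)
      have 1: "norm (G y - G (\<phi> + d1)) \<le> C * norm e"
        using Gn[OF ry r1] d by simp
      have "norm (G (\<phi> + d1) - G \<phi> - L d1) \<le> C * ((norm d1 + h) * norm d1 + h * (C * norm (y - \<phi>)))"
        using Glin[OF r1 r0 Pd] by simp
      also have "\<dots> \<le> C * ((C * \<epsilon> + h) * norm d1 + h * (C * (norm d1 + norm e)))"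
        using nd1 h C d(1) norm_triangle_ineq[of d1 e]
        by (intro mult_left_mono add_mono mult_right_mono) auto
      finally have 2: "norm (G (\<phi> + d1) - G \<phi> - L d1) \<le> C * ((C * \<epsilon> + h) * norm d1 + h * (C * (norm d1 + norm e)))" .
      have "d1 - L d1 = (G y - G (\<phi> + d1)) + (G (\<phi> + d1) - G \<phi> - L d1)" by (simp add: d1_def)
      then have "norm (d1 - L d1) \<le> norm (G y - G (\<phi> + d1)) + norm (G (\<phi> + d1) - G \<phi> - L d1)"
        by (metis norm_triangle_ineq)
      also have "\<dots> \<le> C * norm e + C * ((C * \<epsilon> + h) * norm d1 + h * (C * (norm d1 + norm e)))"
        using 1 2 by linarith
      finally have "norm d1 \<le> B * (C * norm e + C * ((C * \<epsilon> + h) * norm d1 + h * (C * (norm d1 + norm e))))"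
        using B by (smt (verit) mult_left_mono)
      also have "\<dots> = (B * C * C * \<epsilon> + B * C * h + B * C * C * h) * norm d1 + B * (C + C * C * h) * norm e"
        by (simp add: algebra_simps)
      also have "\<dots> \<le> (1/2) * norm d1 + B * (C + C * C * \<eta>) * norm e"
        using epsK hs q h B C by (intro add_mono mult_right_mono mult_left_mono) auto
      finally have "norm d1 \<le> 2 * B * (C + C * C * \<eta>) * norm e" by simp
      then show ?thesis using norm_triangle_ineq[of d1 e] unfolding d(1) C'_def by (simp add: algebra_simps)
    qed

    define T where "T x = x - L x" for x
    have "\<exists>x. T x = y" for y using surj unfolding T_def surj_def by metis
    then obtain S where S: "\<And>y. T (S y) = y" by metis
    have Snorm: "norm (S y) \<le> B * norm y" for y using B(2)[of "S y"] S[of y] by (simp add: T_def)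
    have Tdiff: "T (x - y) = T x - T y" for x y by (simp add: T_def L.diff)
    have Tinj: "x = y" if "T x = T y" for x y
      using B(2)[of "x - y"] that by (simp add: T_def L.diff algebra_simps)
    have Sdiff: "S x - S y = S (x - y)" for x y
      by (rule Tinj) (simp add: Tdiff S)
    \<comment> \<open>Simplified Newton iteration. A single step need not contract in norm, but after one step
      differences have a Lipschitz constant bounded by their norm, so two steps do.\<close>
    define F where "F y = S (G y - L y)" for y
    define A where "A = {y. norm (y - \<phi>) \<le> \<epsilon> \<and> P M y}"
    \<comment> \<open>Here every summand is a value of \<open>G\<close> or \<open>L\<close>, so a
      \<open>P\<close>-bound can be read off although none is known for values of
      \<open>S\<close>.\<close>
    have F_eq: "F y = G y - L y + L (F y)" for y
      using S[of "G y - L y"] by (simp add: F_def T_def algebra_simps)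
    have Fphi: "F y - \<phi> = S ((G y - G \<phi> - L (y - \<phi>)) + e)" for y
    proof (rule Tinj)
      have "T (F y - \<phi>) = T (F y) - T \<phi>" by (simp add: T_def L.diff)
      also have "\<dots> = (G y - G \<phi> - L (y - \<phi>)) + e"
        using S[of "G y - L y"] by (simp add: F_def T_def L.diff e_def)
      finally show "T (F y - \<phi>) = T (S ((G y - G \<phi> - L (y - \<phi>)) + e))" by (simp add: S)
    qed
    have F_A: "F y \<in> A" if "y \<in> A" for y
    proof -
      have y: "norm (y - \<phi>) \<le> \<epsilon>" "P M y" using that by (auto simp: A_def)
      have ry: "norm (y - \<phi>) \<le> \<rho>" using y eps\<rho> by simp
      have r0: "norm (\<phi> - \<phi>) \<le> \<rho>" using rho by simp
      have Py: "P (M + C) (y - \<phi>)" using P_add[OF y(2) P_minus[OF P_phi]] by simp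
      have "norm (G y - G \<phi> - L (y - \<phi>)) \<le> C * ((norm (y - \<phi>) + h) * norm (y - \<phi>) + h * (M + C))"
        using Glin[OF ry r0 Py] by simp
      also have "\<dots> \<le> C * ((\<epsilon> + h) * \<epsilon> + h * (M + C))"
        using y C h eps by (intro mult_left_mono add_mono mult_mono) auto
      finally have "norm (F y - \<phi>) \<le> B * (C * ((\<epsilon> + h) * \<epsilon> + h * (M + C)) + norm e)"
        unfolding Fphi using Snorm B
        by (smt (verit) mult_left_mono norm_triangle_ineq)
      also have "\<dots> = (B * C * \<epsilon> + B * C * h) * \<epsilon> + B * C * (M + C) * h + B * norm e"
        by (simp add: algebra_simps)
      also have "\<dots> \<le> (1/2) * \<epsilon> + q + q"
        using epsK hs Be q eps by (intro add_mono mult_right_mono) auto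
      finally have n: "norm (F y - \<phi>) \<le> \<epsilon>" using q eps by linarith
      have ny: "norm y \<le> norm \<phi> + \<rho>" "norm (F y) \<le> norm \<phi> + \<rho>"
        using n ry eps\<rho> norm_triangle_sub[of y \<phi>] norm_triangle_sub[of "F y" \<phi>] by linarith+
      have "P (C * norm (y - \<phi>) + C + C * norm y + C * norm (F y)) (G y - G \<phi> + G \<phi> + - L y + L (F y))"
        by (intro P_add P_minus P_L PG GP ry r0)
      moreover have "G y - G \<phi> + G \<phi> + - L y + L (F y) = F y"
        using F_eq[of y] by simp
      moreover have "C * norm (y - \<phi>) + C + C * norm y + C * norm (F y) \<le> C * \<rho> + C + C * (norm \<phi> + \<rho>) + C * (norm \<phi> + \<rho>)"
        using ry ny C by (intro add_mono mult_left_mono) auto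
      ultimately have "P M (F y)"
        using P_mono by (simp add: M_def algebra_simps)
      with n show ?thesis by (simp add: A_def)
    qed
    have contr: "norm (F (F x) - F (F y)) \<le> (1/2) * norm (x - y)" if xy: "x \<in> A" "y \<in> A" for x y
    proof -
      have rA: "norm (u - \<phi>) \<le> \<epsilon>" "norm (u - \<phi>) \<le> \<rho>" if "u \<in> A" for u
        using that eps\<rho> by (auto simp: A_def)
      have FF: "F u - F v = S (G u - G v - L (u - v))" for u v
        by (simp add: F_def Sdiff L.diff algebra_simps)
      define a where "a = norm (x - y)"
      define a' where "a' = norm (F x - F y)"
      have a0: "a \<ge> 0" by (simp add: a_def)
      have "a' \<le> B * (norm (G x - G y) + norm (L (x - y)))"
        unfolding a'_def FF using Snorm B by (smt (verit) mult_left_mono norm_triangle_ineq4)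
      also have "\<dots> \<le> B * (C * a + C * a)"
        using Gn[OF rA(2)[OF xy(1)] rA(2)[OF xy(2)]] normL[of "x - y"] B
        by (intro mult_left_mono add_mono) (auto simp: a_def)
      finally have a': "a' \<le> C1 * a" by (simp add: C1_def algebra_simps)
      have "(G x - G y) + (- L (x - y)) + L (F x - F y) = (G x - L x + L (F x)) - (G y - L y + L (F y))"
        by (simp add: L.diff algebra_simps)
      also have "\<dots> = F x - F y" by (simp only: F_eq[symmetric])
      finally have "(G x - G y) + (- L (x - y)) + L (F x - F y) = F x - F y" .
      moreover have "P (C * a + C * a + C * a') ((G x - G y) + (- L (x - y)) + L (F x - F y))"
        unfolding a_def a'_def by (intro P_add P_minus P_L GP rA xy)
      ultimately have "P (C * a + C * a + C * a') (F x - F y)" by simp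
      moreover have "C * a + C * a + C * a' \<le> C2 * a"
        using mult_left_mono[OF a', of C] C by (simp add: C2_def algebra_simps)
      ultimately have P': "P (C2 * a) (F x - F y)" by (rule P_mono)
      have "norm (F (F x) - F (F y)) \<le> B * norm (G (F x) - G (F y) - L (F x - F y))"
        unfolding FF[of "F x"] using Snorm B by (smt (verit) mult_left_mono)
      also have "\<dots> \<le> B * (C * ((norm (F x - \<phi>) + norm (F y - \<phi>) + h) * a' + h * (C2 * a)))"
        using Glin[OF rA(2)[OF F_A[OF xy(1)]] rA(2)[OF F_A[OF xy(2)]] P'] B
        by (intro mult_left_mono) (auto simp: a'_def)
      also have "\<dots> \<le> B * (C * ((\<epsilon> + \<epsilon> + h) * (C1 * a) + h * (C2 * a)))"
        using B C h eps a' pos a0 rA(1)[OF F_A[OF xy(1)]] rA(1)[OF F_A[OF xy(2)]]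
        by (intro mult_left_mono add_mono mult_mono) (auto simp: a'_def)
      also have "\<dots> = (2 * (B * C * C1) * \<epsilon> + B * C * (C1 + C2) * h) * a" by (simp add: algebra_simps)
      also have "\<dots> \<le> (1/2) * a"
        using epsK hs q a0 by (intro mult_right_mono) auto
      finally show ?thesis by (simp add: a_def)
    qed
    have "A = cball \<phi> \<epsilon> \<inter> {y. P M y}"
      by (auto simp: A_def dist_norm norm_minus_commute)
    then have "complete A" using P_closed by (simp add: complete_eq_closed closed_Int)
    moreover have "P M \<phi>" using P_phi P_mono pos C rho unfolding M_def
      by (smt (verit) mult_nonneg_nonneg norm_ge_zero)
    then have phiA: "\<phi> \<in> A" using eps by (simp add: A_def)
    ultimately have "\<exists>!y\<in>A. (F \<circ> F) y = y"
      by (intro Banach_fix[of A "1/2" "F \<circ> F"]) (use F_A contr in \<open>auto simp: dist_norm\<close>)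
    then obtain y where y: "y \<in> A" "F (F y) = y" and un: "\<And>v. v \<in> A \<Longrightarrow> F (F v) = v \<Longrightarrow> v = y"
      unfolding o_def by blast
    \<comment> \<open>\<open>F y\<close> is another fixed point of \<open>F \<circ> F\<close> in
      \<open>A\<close>; then \<open>F_eq\<close> turns \<open>F y = y\<close> into
      \<open>G y = y\<close>.\<close>
    have "F y = y" using un[of "F y"] F_A[OF y(1)] y(2) by simp
    then have "G y = y" using F_eq[of y] by simp
    moreover have "norm (y - \<phi>) \<le> \<epsilon>" using y by (simp add: A_def)
    ultimately show ?thesis using uniq stab unfolding e_def by blast
  qed
  then have "\<forall>G h. 0 \<le> h \<and> h \<le> \<eta> \<and> norm (G \<phi> - \<phi>) \<le> \<eta> \<and> approximates P L \<phi> \<rho> C h G \<longrightarrow>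
           (\<exists>y. norm (y - \<phi>) \<le> \<epsilon> \<and> G y = y \<and> norm (y - \<phi>) \<le> C' * norm (G \<phi> - \<phi>) \<and>
                (\<forall>y'. norm (y' - \<phi>) \<le> \<epsilon> \<and> G y' = y' \<longrightarrow> y' = y))" by blast
  moreover have "\<epsilon> \<le> \<rho>" using eps rho by simp
  ultimately show ?thesis using eps(1) eta(1) by blast
qed

section \<open>Difference bounds for piecewise twice differentiable kernels\<close>

lemma norm_triple_le: "norm (a, b, c) \<le> \<bar>a\<bar> + \<bar>b\<bar> + \<bar>c\<bar>" for a b c :: real
  using norm_Pair_le[of a "(b, c)"] norm_Pair_le[of b c] by simp

definition lower_prism :: "real \<Rightarrow> (real \<times> real \<times> real) set" where
  "lower_prism R = ({0..1} \<times> {0..1} \<times> {-R..R}) \<inter> {p. fst (snd p) \<le> fst p}"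

definition upper_prism :: "real \<Rightarrow> (real \<times> real \<times> real) set" where
  "upper_prism R = ({0..1} \<times> {0..1} \<times> {-R..R}) \<inter> {p. fst p \<le> fst (snd p)}"

lemma mem_lower_prism: "(s, t, u) \<in> lower_prism R \<longleftrightarrow> 0 \<le> t \<and> t \<le> s \<and> s \<le> 1 \<and> \<bar>u\<bar> \<le> R"
  by (auto simp: lower_prism_def abs_le_iff)

lemma mem_upper_prism: "(s, t, u) \<in> upper_prism R \<longleftrightarrow> 0 \<le> s \<and> s \<le> t \<and> t \<le> 1 \<and> \<bar>u\<bar> \<le> R"
  by (auto simp: upper_prism_def abs_le_iff)

lemma compact_prisms: "compact (lower_prism R)" "compact (upper_prism R)"
  unfolding lower_prism_def upper_prism_def
  by (intro compact_Int_closed compact_Times compact_Icc closed_Collect_le continuous_intros)+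

lemma convex_prisms: "convex (lower_prism R)" "convex (upper_prism R)"
proof -
  have h: "convex {p :: real \<times> real \<times> real. fst (snd p) \<le> fst p}"
       "convex {p :: real \<times> real \<times> real. fst p \<le> fst (snd p)}"
    by (auto simp: convex_def intro!: add_mono mult_left_mono)
  show "convex (lower_prism R)" "convex (upper_prism R)"
    unfolding lower_prism_def upper_prism_def
    by (intro convex_Int convex_Times convex_real_interval h)+
qed

text \<open>For a \<open>C\<^sup>2\<close> function all that is used is a Lipschitz bound, a bound on second differences
  and a bound on mixed differences, with one common constant.\<close>

definition diff_bounds :: "real \<Rightarrow> (real \<times> real \<times> real) set \<Rightarrow> (real \<times> real \<times> real \<Rightarrow> real) \<Rightarrow> bool" where
  "diff_bounds M K g \<longleftrightarrow> M \<ge> 0 \<and>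
     (\<forall>x\<in>K. \<forall>y\<in>K. \<bar>g x - g y\<bar> \<le> M * norm (x - y)) \<and>
     (\<forall>x\<in>K. \<forall>y\<in>K. \<forall>z\<in>K. \<bar>g x + g y - 2 * g z\<bar>
        \<le> M * (norm (x + y - 2 *\<^sub>R z) + (norm (x - z))\<^sup>2 + (norm (y - z))\<^sup>2)) \<and>
     (\<forall>x y v. x \<in> K \<and> y \<in> K \<and> x + v \<in> K \<and> y + v \<in> K \<longrightarrow>
        \<bar>g (x + v) - g x - g (y + v) + g y\<bar> \<le> M * norm v * norm (x - y))"

lemma diff_bounds_mono:
  assumes "diff_bounds M K g" "M \<le> M'"
  shows "diff_bounds M' K g"
  unfolding diff_bounds_def
proof (intro conjI ballI allI impI)
  show "0 \<le> M'" using assms unfolding diff_bounds_def by linarith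
next
  fix x y assume "x \<in> K" "y \<in> K"
  then have "\<bar>g x - g y\<bar> \<le> M * norm (x - y)" using assms unfolding diff_bounds_def by blast
  also have "\<dots> \<le> M' * norm (x - y)" using assms by (intro mult_right_mono) auto
  finally show "\<bar>g x - g y\<bar> \<le> M' * norm (x - y)" .
next
  fix x y z assume "x \<in> K" "y \<in> K" "z \<in> K"
  then have "\<bar>g x + g y - 2 * g z\<bar> \<le> M * (norm (x + y - 2 *\<^sub>R z) + (norm (x - z))\<^sup>2 + (norm (y - z))\<^sup>2)"
    using assms unfolding diff_bounds_def by blast
  also have "\<dots> \<le> M' * (norm (x + y - 2 *\<^sub>R z) + (norm (x - z))\<^sup>2 + (norm (y - z))\<^sup>2)"
    using assms by (intro mult_right_mono) auto
  finally show "\<bar>g x + g y - 2 * g z\<bar> \<le> M' * (norm (x + y - 2 *\<^sub>R z) + (norm (x - z))\<^sup>2 + (norm (y - z))\<^sup>2)" .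
next
  fix x y v assume "x \<in> K \<and> y \<in> K \<and> x + v \<in> K \<and> y + v \<in> K"
  then have "\<bar>g (x + v) - g x - g (y + v) + g y\<bar> \<le> M * norm v * norm (x - y)"
    using assms unfolding diff_bounds_def by blast
  also have "\<dots> \<le> M' * norm v * norm (x - y)" using assms by (intro mult_right_mono) auto
  finally show "\<bar>g (x + v) - g x - g (y + v) + g y\<bar> \<le> M' * norm v * norm (x - y)" .
qed

text \<open>Compactness bounds both derivatives on \<open>K\<close>, and convexity keeps segments
  inside \<open>K\<close> for the mean value inequality. Second differences come from Taylor
  expansion at \<open>z\<close>, mixed ones from the mean value inequality for
  \<open>G (x + \<tau> v) - G (y + \<tau> v)\<close> in \<tau>.\<close>

lemma C2_on_imp_diff_bounds:
  assumes C2: "C2_on S g" and K: "compact K" "convex K" "K \<subseteq> S"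
  shows "\<exists>M. diff_bounds M K g"
proof -
  obtain U G D1 D2 where U: "open U" "S \<subseteq> U"
    and G: "\<And>y. y \<in> U \<Longrightarrow> (G has_derivative blinfun_apply (D1 y)) (at y)"
    and D1: "\<And>y. y \<in> U \<Longrightarrow> (D1 has_derivative blinfun_apply (D2 y)) (at y)"
    and D2: "continuous_on U D2" and eq: "\<And>y. y \<in> S \<Longrightarrow> G y = g y"
    using C2 unfolding C2_on_def by metis
  have KU: "y \<in> U" "g y = G y" if "y \<in> K" for y using that K(3) U(2) eq[of y, symmetric] by blast+
  have cD1: "continuous_on K D1"
    by (rule has_derivative_continuous_on, rule has_derivative_at_withinI, rule D1) (use KU in auto)
  have cD2: "continuous_on K D2" using D2 KU by (auto intro: continuous_on_subset)
  obtain M1 where M1: "\<And>y. y \<in> K \<Longrightarrow> norm (D1 y) \<le> M1"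
    using compact_imp_bounded[OF compact_continuous_image[OF cD1 K(1)]] unfolding bounded_iff by auto
  obtain M2 where M2: "\<And>y. y \<in> K \<Longrightarrow> norm (D2 y) \<le> M2"
    using compact_imp_bounded[OF compact_continuous_image[OF cD2 K(1)]] unfolding bounded_iff by auto
  define M where "M = max 0 (max M1 M2)"
  have M: "M \<ge> 0" "\<And>y. y \<in> K \<Longrightarrow> norm (D1 y) \<le> M" "\<And>y. y \<in> K \<Longrightarrow> norm (D2 y) \<le> M"
    using M1 M2 by (fastforce simp: M_def)+
  have Glip: "norm (G x - G y) \<le> M * norm (x - y)" if "x \<in> K" "y \<in> K" for x y
    using K(2) _ _ that
    by (rule differentiable_bound[where f'="\<lambda>y. blinfun_apply (D1 y)"])
      (use G KU M in \<open>auto simp: norm_blinfun.rep_eq[symmetric] intro: has_derivative_at_withinI\<close>)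
  have Dlip: "norm (D1 x - D1 y) \<le> M * norm (x - y)" if "x \<in> K" "y \<in> K" for x y
    using K(2) _ _ that
    by (rule differentiable_bound[where f'="\<lambda>y. blinfun_apply (D2 y)"])
      (use D1 KU M in \<open>auto simp: norm_blinfun.rep_eq[symmetric] intro: has_derivative_at_withinI\<close>)
  have seg: "closed_segment x y \<subseteq> K" if "x \<in> K" "y \<in> K" for x y
    using K(2) that by (simp add: closed_segment_subset)
  have taylor: "\<bar>G x - G z - D1 z (x - z)\<bar> \<le> M * (norm (x - z))\<^sup>2" if xz: "x \<in> K" "z \<in> K" for x z
  proof -
    have "norm (G x - G z - D1 z (x - z)) \<le> norm (x - z) * (M * norm (x - z))"
    proof (rule differentiable_bound_linearization[where S = "closed_segment z x" and f' = "\<lambda>y. blinfun_apply (D1 y)"])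
      show "z + t *\<^sub>R (x - z) \<in> closed_segment z x" if "t \<in> {0..1}" for t
        using that unfolding in_segment by (intro exI[of _ t]) (auto simp: algebra_simps)
      show "(G has_derivative blinfun_apply (D1 y)) (at y within closed_segment z x)"
        if "y \<in> closed_segment z x" for y
        using that seg[OF xz(2,1)] KU(1) by (blast intro: has_derivative_at_withinI G)
      show "onorm (blinfun_apply (D1 y) - blinfun_apply (D1 z)) \<le> M * norm (x - z)"
        if y: "y \<in> closed_segment z x" for y
      proof -
        have "norm (D1 y - D1 z) \<le> M * norm (y - z)" using Dlip y seg[OF xz(2,1)] xz by blast
        also have "\<dots> \<le> M * norm (x - z)"
          using segment_bound[OF y] M by (intro mult_left_mono) auto
        finally show ?thesis by (simp add: norm_blinfun.rep_eq minus_blinfun.rep_eq fun_diff_def)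
      qed
    qed auto
    then show ?thesis by (simp add: power2_eq_square algebra_simps)
  qed
  have mixed: "\<bar>G (x + v) - G x - G (y + v) + G y\<bar> \<le> M * norm v * norm (x - y)"
    if xy: "x \<in> K" "y \<in> K" "x + v \<in> K" "y + v \<in> K" for x y v
  proof -
    have inK: "x + \<tau> *\<^sub>R v \<in> K" if "\<tau> \<in> {0..1}" "x \<in> K" "x + v \<in> K" for \<tau> :: real and x
    proof -
      have "x + \<tau> *\<^sub>R v \<in> closed_segment x (x + v)"
        using that unfolding in_segment by (intro exI[of _ \<tau>]) (auto simp: algebra_simps)
      then show ?thesis using seg that by blast
    qed
    let ?f = "\<lambda>\<tau>::real. G (x + \<tau> *\<^sub>R v) - G (y + \<tau> *\<^sub>R v)"
    have "norm (?f 1 - ?f 0) \<le> (M * norm v * norm (x - y)) * norm (1 - 0 :: real)"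
    proof (rule differentiable_bound[where S = "{0..1}" and f' = "\<lambda>\<tau> r. r * (D1 (x + \<tau> *\<^sub>R v) - D1 (y + \<tau> *\<^sub>R v)) v"])
      fix \<tau> :: real assume \<tau>: "\<tau> \<in> {0..1}"
      have line: "((\<lambda>\<tau>. G (x + \<tau> *\<^sub>R v)) has_derivative (\<lambda>r. r * D1 (x + \<tau> *\<^sub>R v) v)) (at \<tau> within {0..1})"
        if "x \<in> K" "x + v \<in> K" for x
      proof -
        have "((\<lambda>\<tau>. x + \<tau> *\<^sub>R v) has_derivative (\<lambda>r. r *\<^sub>R v)) (at \<tau> within {0..1})"
          by (auto intro!: derivative_eq_intros)
        from has_derivative_compose[OF this G[OF KU(1)[OF inK[OF \<tau> that]]]]
        show ?thesis by (simp add: blinfun.scaleR_right)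
      qed
      show "(?f has_derivative (\<lambda>r. r * (D1 (x + \<tau> *\<^sub>R v) - D1 (y + \<tau> *\<^sub>R v)) v)) (at \<tau> within {0..1})"
        using has_derivative_diff[OF line[OF xy(1,3)] line[OF xy(2,4)]]
        by (simp add: blinfun.diff_left right_diff_distrib)
      have "norm ((D1 (x + \<tau> *\<^sub>R v) - D1 (y + \<tau> *\<^sub>R v)) v) \<le> norm (D1 (x + \<tau> *\<^sub>R v) - D1 (y + \<tau> *\<^sub>R v)) * norm v"
        by (rule norm_blinfun)
      also have "\<dots> \<le> M * norm (x - y) * norm v"
        using Dlip[OF inK[OF \<tau> xy(1,3)] inK[OF \<tau> xy(2,4)]] by (intro mult_right_mono) auto
      finally have "norm (r * (D1 (x + \<tau> *\<^sub>R v) - D1 (y + \<tau> *\<^sub>R v)) v) \<le> (M * norm v * norm (x - y)) * norm r" for r :: real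
        using mult_left_mono[of _ _ "\<bar>r\<bar>"] by (fastforce simp: abs_mult mult_ac)
      then show "onorm (\<lambda>r. r * (D1 (x + \<tau> *\<^sub>R v) - D1 (y + \<tau> *\<^sub>R v)) v) \<le> M * norm v * norm (x - y)"
        by (rule onorm_le)
    qed auto
    then show ?thesis by (simp add: algebra_simps)
  qed
  have second: "\<bar>G x + G y - 2 * G z\<bar> \<le> M * (norm (x + y - 2 *\<^sub>R z) + (norm (x - z))\<^sup>2 + (norm (y - z))\<^sup>2)"
    if xyz: "x \<in> K" "y \<in> K" "z \<in> K" for x y z
  proof -
    \<comment> \<open>The linear Taylor terms of the two values combine into the derivative applied
      to the second difference of the points.\<close>
    have "x + y - 2 *\<^sub>R z = (x - z) + (y - z)" by (simp add: scaleR_2)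
    then have "D1 z (x + y - 2 *\<^sub>R z) = D1 z (x - z) + D1 z (y - z)"
      by (simp only: blinfun.add_right)
    then have "G x + G y - 2 * G z = (G x - G z - D1 z (x - z)) + (G y - G z - D1 z (y - z)) + D1 z (x + y - 2 *\<^sub>R z)"
      by simp
    moreover have "\<bar>D1 z (x + y - 2 *\<^sub>R z)\<bar> \<le> M * norm (x + y - 2 *\<^sub>R z)"
      using norm_blinfun[of "D1 z" "x + y - 2 *\<^sub>R z"] M(2)[OF xyz(3)]
      by (smt (verit) mult_right_mono norm_ge_zero real_norm_def)
    ultimately show ?thesis
      using taylor[OF xyz(1,3)] taylor[OF xyz(2,3)] unfolding distrib_left by linarith
  qed
  show ?thesis
    unfolding diff_bounds_def using M(1) Glip second mixed KU(2)
    by (intro exI[of _ M]) (auto simp: KU(2))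
qed

text \<open>A segment joining the two prisms meets the diagonal plane in a point of both, and
  lengths add along the segment, so the constant does not grow.\<close>

lemma lipschitz_across_diagonal:
  fixes g :: "real \<times> real \<times> real \<Rightarrow> real"
  assumes l: "\<And>x y. x \<in> lower_prism R \<Longrightarrow> y \<in> lower_prism R \<Longrightarrow> \<bar>g x - g y\<bar> \<le> M * norm (x - y)"
    and u: "\<And>x y. x \<in> upper_prism R \<Longrightarrow> y \<in> upper_prism R \<Longrightarrow> \<bar>g x - g y\<bar> \<le> M * norm (x - y)"
    and x: "x \<in> {0..1} \<times> {0..1} \<times> {-R..R}" and y: "y \<in> {0..1} \<times> {0..1} \<times> {-R..R}"
  shows "\<bar>g x - g y\<bar> \<le> M * norm (x - y)"
proof -
  have cross: "\<bar>g x - g y\<bar> \<le> M * norm (x - y)" if x: "x \<in> lower_prism R" and y: "y \<in> upper_prism R" for x y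
  proof (cases "fst x = fst (snd x)")
    case True
    then have "x \<in> upper_prism R" using x by (auto simp: lower_prism_def upper_prism_def)
    then show ?thesis using u y by blast
  next
    case False
    define d where "d = fst x - fst (snd x)"
    define d' where "d' = fst (snd y) - fst y"
    have d: "d > 0" "d' \<ge> 0" using False x y by (auto simp: d_def d'_def lower_prism_def upper_prism_def)
    \<comment> \<open>The signed distance to the diagonal is affine along the segment, running from
      \<open>d\<close> to \<open>- d'\<close>; \<open>r\<close> is its zero.\<close>
    define r where "r = d / (d + d')"
    have r: "0 \<le> r" "r \<le> 1" "r * (d + d') = d" using d by (auto simp: r_def)
    define w where "w = (1 - r) *\<^sub>R x + r *\<^sub>R y"
    have "convex ({0..1::real} \<times> {0..1::real} \<times> {-R..R})"
      by (intro convex_Times convex_real_interval)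
    then have wb: "w \<in> {0..1} \<times> {0..1} \<times> {-R..R}"
      unfolding w_def using x y r by (intro convexD_alt) (auto simp: lower_prism_def upper_prism_def)
    have "fst w - fst (snd w) = (1 - r) * d - r * d'"
      by (simp add: w_def d_def d'_def algebra_simps)
    also have "\<dots> = 0" using r(3) by (simp add: algebra_simps)
    finally have "w \<in> lower_prism R" "w \<in> upper_prism R"
      using wb by (auto simp: lower_prism_def upper_prism_def)
    then have "\<bar>g x - g w\<bar> \<le> M * norm (x - w)" "\<bar>g w - g y\<bar> \<le> M * norm (w - y)"
      using l u x y by blast+
    moreover have n1: "norm (x - w) = r * norm (x - y)"
    proof -
      have "x - w = r *\<^sub>R (x - y)" by (simp add: w_def algebra_simps)
      then show ?thesis using r by simp
    qed
    moreover have n2: "norm (w - y) = (1 - r) * norm (x - y)"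
    proof -
      have "w - y = (1 - r) *\<^sub>R (x - y)" by (simp add: w_def algebra_simps)
      then show ?thesis using r by simp
    qed
    ultimately have "\<bar>g x - g y\<bar> \<le> M * (r * norm (x - y)) + M * ((1 - r) * norm (x - y))"
      unfolding n1 n2 by linarith
    then show ?thesis by (simp add: algebra_simps)
  qed
  have cover: "v \<in> lower_prism R \<or> v \<in> upper_prism R" if "v \<in> {0..1} \<times> {0..1} \<times> {-R..R}" for v
    using that by (auto simp: lower_prism_def upper_prism_def)
  show ?thesis
    using cover[OF x] cover[OF y] l u cross[of x y] cross[of y x]
    by (metis abs_minus_commute norm_minus_commute)
qed

text \<open>The Lipschitz bounds hold across the diagonal, where \<open>\<kappa>\<close> and
  \<open>ell\<close> are continuous. In \<open>ell_mixed\<close> the side condition keeps the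
  rectangle spanned by \<open>s\<close>, \<open>s'\<close> and \<open>t\<close>, \<open>t'\<close>
  on one side, and \<open>kernel_second\<close> stays in one prism: there twice differentiable
  pieces are available.\<close>

locale kernel_bounds =
  fixes \<kappa> ell :: "real \<Rightarrow> real \<Rightarrow> real \<Rightarrow> real" and R \<Lambda> :: real
  assumes Lam: "\<Lambda> \<ge> 0"
    and kernel_deriv: "\<And>s t u. s \<in> {0..1} \<Longrightarrow> t \<in> {0..1} \<Longrightarrow> (\<kappa> s t has_real_derivative ell s t u) (at u)"
    and kernel_cont: "continuous_on Psi (\<lambda>(s,t,u). \<kappa> s t u)"
    and ell_cont: "continuous_on Psi (\<lambda>(s,t,u). ell s t u)"
    and kernel_lip: "\<And>s t u s' t' u'. s \<in> {0..1} \<Longrightarrow> t \<in> {0..1} \<Longrightarrow> s' \<in> {0..1} \<Longrightarrow> t' \<in> {0..1} \<Longrightarrow>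
       \<bar>u\<bar> \<le> R \<Longrightarrow> \<bar>u'\<bar> \<le> R \<Longrightarrow> \<bar>\<kappa> s t u - \<kappa> s' t' u'\<bar> \<le> \<Lambda> * (\<bar>s - s'\<bar> + \<bar>t - t'\<bar> + \<bar>u - u'\<bar>)"
    and ell_lip: "\<And>s t u s' t' u'. s \<in> {0..1} \<Longrightarrow> t \<in> {0..1} \<Longrightarrow> s' \<in> {0..1} \<Longrightarrow> t' \<in> {0..1} \<Longrightarrow>
       \<bar>u\<bar> \<le> R \<Longrightarrow> \<bar>u'\<bar> \<le> R \<Longrightarrow> \<bar>ell s t u - ell s' t' u'\<bar> \<le> \<Lambda> * (\<bar>s - s'\<bar> + \<bar>t - t'\<bar> + \<bar>u - u'\<bar>)"
    and ell_mixed: "\<And>s t u s' t' u'. s \<in> {0..1} \<Longrightarrow> t \<in> {0..1} \<Longrightarrow> s' \<in> {0..1} \<Longrightarrow> t' \<in> {0..1} \<Longrightarrow>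
       \<bar>u\<bar> \<le> R \<Longrightarrow> \<bar>u'\<bar> \<le> R \<Longrightarrow> max t t' \<le> min s s' \<or> max s s' \<le> min t t' \<Longrightarrow>
       \<bar>ell s t u - ell s' t u - ell s t' u' + ell s' t' u'\<bar> \<le> \<Lambda> * \<bar>s - s'\<bar> * (\<bar>t - t'\<bar> + \<bar>u - u'\<bar>)"
    and kernel_second: "\<And>K s1 t1 u1 s2 t2 u2 s t u. K \<in> {lower_prism R, upper_prism R} \<Longrightarrow>
       (s1, t1, u1) \<in> K \<Longrightarrow> (s2, t2, u2) \<in> K \<Longrightarrow> (s, t, u) \<in> K \<Longrightarrow>
       \<bar>\<kappa> s1 t1 u1 + \<kappa> s2 t2 u2 - 2 * \<kappa> s t u\<bar> \<le> \<Lambda> * (\<bar>s1 + s2 - 2 * s\<bar> + \<bar>t1 + t2 - 2 * t\<bar> + \<bar>u1 + u2 - 2 * u\<bar>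
          + (\<bar>s1 - s\<bar> + \<bar>t1 - t\<bar> + \<bar>u1 - u\<bar>)\<^sup>2 + (\<bar>s2 - s\<bar> + \<bar>t2 - t\<bar> + \<bar>u2 - u\<bar>)\<^sup>2)"

lemma C2_on_imp_continuous_on: "C2_on S g \<Longrightarrow> continuous_on S g"
proof -
  assume "C2_on S g"
  then obtain U G D1 where U: "S \<subseteq> U" "\<And>y. y \<in> U \<Longrightarrow> (G has_derivative blinfun_apply (D1 y)) (at y)"
      "\<And>y. y \<in> S \<Longrightarrow> G y = g y"
    unfolding C2_on_def by metis
  have "continuous_on S G"
    by (rule has_derivative_continuous_on, rule has_derivative_at_withinI, rule U(2)) (use U(1) in blast)
  then show ?thesis by (rule continuous_on_eq) (rule U(3))
qed

text \<open>The domains are unbounded in \<open>u\<close>, so a constant exists only after cutting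
  at \<open>R\<close>; the derivative \<open>ell\<close> is the same for every cut.\<close>

lemma kernel_G2_2_0_imp_bounds:
  assumes "kernel_G2_2_0 \<kappa>"
  shows "\<exists>ell. \<forall>R. \<exists>\<Lambda>. kernel_bounds \<kappa> ell R \<Lambda>"
proof -
  obtain ell where der: "\<forall>(s,t,u)\<in>Psi. ((\<lambda>v. \<kappa> s t v) has_real_derivative ell s t u) (at u)"
    and cont: "continuous_on Psi (\<lambda>(s,t,u). ell s t u)"
    and C2: "C2_on Psi1 (\<lambda>(s,t,u). ell s t u)" "C2_on Psi2 (\<lambda>(s,t,u). ell s t u)"
      "C2_on Psi1 (\<lambda>(s,t,u). \<kappa> s t u)" "C2_on Psi2 (\<lambda>(s,t,u). \<kappa> s t u)"
    using assms unfolding kernel_G2_2_0_def by blast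
  have Psi: "Psi = Psi1 \<union> Psi2" "closed Psi1" "closed Psi2"
  proof -
    show "Psi = Psi1 \<union> Psi2" unfolding Psi_def Psi1_def Psi2_def by auto
    have eq1: "Psi1 = {p. 0 \<le> fst (snd p) \<and> fst (snd p) \<le> fst p \<and> fst p \<le> 1}" unfolding Psi1_def by auto
    show "closed Psi1"
      unfolding eq1 by (intro closed_Collect_conj closed_Collect_le continuous_intros)
    have eq2: "Psi2 = {p. 0 \<le> fst p \<and> fst p \<le> fst (snd p) \<and> fst (snd p) \<le> 1}" unfolding Psi2_def by auto
    show "closed Psi2"
      unfolding eq2 by (intro closed_Collect_conj closed_Collect_le continuous_intros)
  qed
  have kcont: "continuous_on Psi (\<lambda>(s,t,u). \<kappa> s t u)"
    unfolding Psi(1) by (intro continuous_on_closed_Un Psi C2_on_imp_continuous_on C2)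
  have "\<exists>\<Lambda>. kernel_bounds \<kappa> ell R \<Lambda>" for R
  proof -
    let ?k = "\<lambda>(s,t,u). \<kappa> s t u" and ?l = "\<lambda>(s,t,u). ell s t u"
    have sub: "lower_prism R \<subseteq> Psi1" "upper_prism R \<subseteq> Psi2"
      by (auto simp: lower_prism_def upper_prism_def Psi1_def Psi2_def)
    obtain M1 M2 M3 M4 where "diff_bounds M1 (lower_prism R) ?l" "diff_bounds M2 (upper_prism R) ?l"
        "diff_bounds M3 (lower_prism R) ?k" "diff_bounds M4 (upper_prism R) ?k"
      using C2_on_imp_diff_bounds C2 sub compact_prisms convex_prisms by meson
    moreover define \<Lambda> where "\<Lambda> = max (max M1 M2) (max M3 M4)"
    ultimately have bd: "diff_bounds \<Lambda> (lower_prism R) ?l" "diff_bounds \<Lambda> (upper_prism R) ?l"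
        "diff_bounds \<Lambda> (lower_prism R) ?k" "diff_bounds \<Lambda> (upper_prism R) ?k"
      by (auto elim!: diff_bounds_mono)
    have Lam: "\<Lambda> \<ge> 0" using bd unfolding diff_bounds_def by blast
    have lip: "\<bar>g (s,t,u) - g (s',t',u')\<bar> \<le> \<Lambda> * (\<bar>s - s'\<bar> + \<bar>t - t'\<bar> + \<bar>u - u'\<bar>)"
      if "diff_bounds \<Lambda> (lower_prism R) g" "diff_bounds \<Lambda> (upper_prism R) g"
        "s \<in> {0..1}" "t \<in> {0..1}" "s' \<in> {0..1}" "t' \<in> {0..1}" "\<bar>u\<bar> \<le> R" "\<bar>u'\<bar> \<le> R" for g s t u s' t' u'
    proof -
      have "\<bar>g (s,t,u) - g (s',t',u')\<bar> \<le> \<Lambda> * norm ((s,t,u) - (s',t',u'))"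
        by (rule lipschitz_across_diagonal[where R = R])
          (use that in \<open>auto simp: diff_bounds_def abs_le_iff\<close>)
      also have "\<dots> \<le> \<Lambda> * (\<bar>s - s'\<bar> + \<bar>t - t'\<bar> + \<bar>u - u'\<bar>)"
        using norm_triple_le[of "s - s'" "t - t'" "u - u'"] Lam by (intro mult_left_mono) auto
      finally show ?thesis .
    qed
    have "kernel_bounds \<kappa> ell R \<Lambda>"
    proof
      show "0 \<le> \<Lambda>" by (rule Lam)
      show "(\<kappa> s t has_real_derivative ell s t u) (at u)" if "s \<in> {0..1}" "t \<in> {0..1}" for s t u
        using der that unfolding Psi_def by auto
      show "continuous_on Psi ?k" "continuous_on Psi ?l" by fact+
      fix s t u s' t' u' :: real
      assume st: "s \<in> {0..1}" "t \<in> {0..1}" "s' \<in> {0..1}" "t' \<in> {0..1}" and u: "\<bar>u\<bar> \<le> R" "\<bar>u'\<bar> \<le> R"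
      show "\<bar>\<kappa> s t u - \<kappa> s' t' u'\<bar> \<le> \<Lambda> * (\<bar>s - s'\<bar> + \<bar>t - t'\<bar> + \<bar>u - u'\<bar>)"
        using lip[OF bd(3,4) st u] by simp
      show "\<bar>ell s t u - ell s' t' u'\<bar> \<le> \<Lambda> * (\<bar>s - s'\<bar> + \<bar>t - t'\<bar> + \<bar>u - u'\<bar>)"
        using lip[OF bd(1,2) st u] by simp
      assume side: "max t t' \<le> min s s' \<or> max s s' \<le> min t t'"
      \<comment> \<open>The side condition puts all four corners of the rectangle into one
        prism.\<close>
      have "\<exists>K\<in>{lower_prism R, upper_prism R}. (s', t, u) \<in> K \<and> (s', t', u') \<in> K \<and> (s, t, u) \<in> K \<and> (s, t', u') \<in> K"
        using side st u by (auto simp: mem_lower_prism mem_upper_prism)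
      then obtain K where K: "K \<in> {lower_prism R, upper_prism R}" "(s', t, u) \<in> K" "(s', t', u') \<in> K" "(s, t, u) \<in> K" "(s, t', u') \<in> K"
        by blast
      have "diff_bounds \<Lambda> K ?l" using K(1) bd by auto
      then have "(s', t, u) \<in> K \<and> (s', t', u') \<in> K \<and> (s', t, u) + (s - s', 0, 0) \<in> K \<and> (s', t', u') + (s - s', 0, 0) \<in> K \<longrightarrow>
          \<bar>?l ((s', t, u) + (s - s', 0, 0)) - ?l (s', t, u) - ?l ((s', t', u') + (s - s', 0, 0)) + ?l (s', t', u')\<bar>
          \<le> \<Lambda> * norm (s - s', 0::real, 0::real) * norm ((s', t, u) - (s', t', u'))"
        unfolding diff_bounds_def by blast
      then have "\<bar>?l ((s', t, u) + (s - s', 0, 0)) - ?l (s', t, u) - ?l ((s', t', u') + (s - s', 0, 0)) + ?l (s', t', u')\<bar>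
          \<le> \<Lambda> * norm (s - s', 0::real, 0::real) * norm ((s', t, u) - (s', t', u'))"
        using K(2-) by simp
      also have "\<dots> \<le> \<Lambda> * \<bar>s - s'\<bar> * (\<bar>t - t'\<bar> + \<bar>u - u'\<bar>)"
        using norm_triple_le[of 0 "t - t'" "u - u'"] norm_triple_le[of "s - s'" 0 0] Lam
        by (intro mult_mono mult_nonneg_nonneg) auto
      finally show "\<bar>ell s t u - ell s' t u - ell s t' u' + ell s' t' u'\<bar> \<le> \<Lambda> * \<bar>s - s'\<bar> * (\<bar>t - t'\<bar> + \<bar>u - u'\<bar>)"
        by simp
    next
      fix K s1 t1 u1 s2 t2 u2 s t u
      assume K: "K \<in> {lower_prism R, upper_prism R}" "(s1, t1, u1) \<in> K" "(s2, t2, u2) \<in> K" "(s, t, u) \<in> K"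
      have "diff_bounds \<Lambda> K ?k" using K(1) bd by auto
      then have "\<bar>?k (s1, t1, u1) + ?k (s2, t2, u2) - 2 * ?k (s, t, u)\<bar> \<le>
         \<Lambda> * (norm ((s1, t1, u1) + (s2, t2, u2) - 2 *\<^sub>R (s, t, u)) + (norm ((s1, t1, u1) - (s, t, u)))\<^sup>2 + (norm ((s2, t2, u2) - (s, t, u)))\<^sup>2)"
        using K(2-) unfolding diff_bounds_def by blast
      also have "\<dots> \<le> \<Lambda> * ((\<bar>s1 + s2 - 2 * s\<bar> + \<bar>t1 + t2 - 2 * t\<bar> + \<bar>u1 + u2 - 2 * u\<bar>)
          + (\<bar>s1 - s\<bar> + \<bar>t1 - t\<bar> + \<bar>u1 - u\<bar>)\<^sup>2 + (\<bar>s2 - s\<bar> + \<bar>t2 - t\<bar> + \<bar>u2 - u\<bar>)\<^sup>2)"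
        using norm_triple_le Lam by (intro mult_left_mono add_mono power_mono) auto
      finally show "\<bar>\<kappa> s1 t1 u1 + \<kappa> s2 t2 u2 - 2 * \<kappa> s t u\<bar> \<le> \<Lambda> * (\<bar>s1 + s2 - 2 * s\<bar> + \<bar>t1 + t2 - 2 * t\<bar> + \<bar>u1 + u2 - 2 * u\<bar>
          + (\<bar>s1 - s\<bar> + \<bar>t1 - t\<bar> + \<bar>u1 - u\<bar>)\<^sup>2 + (\<bar>s2 - s\<bar> + \<bar>t2 - t\<bar> + \<bar>u2 - u\<bar>)\<^sup>2)"
        by simp
    qed
    then show ?thesis by blast
  qed
  then show ?thesis by blast
qed

section \<open>Composite Gauss quadrature and cell averages\<close>

definition quad :: "nat \<Rightarrow> (real \<Rightarrow> real) \<Rightarrow> real" where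
  "quad m g = (1 / real m) * (\<Sum>i=1..m. \<Sum>q\<in>{1,2}. gauss_w q * g (zeta m q i))"

definition cell_avg :: "nat \<Rightarrow> nat \<Rightarrow> nat \<Rightarrow> (real \<Rightarrow> real) \<Rightarrow> real" where
  "cell_avg n p j g = (1 / real p) *
     (\<Sum>\<nu>=1..p. \<Sum>q\<in>{1,2}. gauss_w q * g (zeta (n * p) q ((j - 1) * p + \<nu>)))"

lemma Km_eq_quad: "Km \<kappa> m x s = quad m (\<lambda>t. \<kappa> s t (x t))"
  by (simp add: Km_def quad_def)

lemma Qn_eq_cell_avg: "Qn n p v t = cell_avg n p (cell n t) v"
  by (simp add: Qn_def cell_avg_def)

lemma gauss_mu_bounds: "0 < gauss_mu q" "gauss_mu q < 1"
proof -
  define r where "r = 1 / (2 * sqrt 3)"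
  have "1 < sqrt 3" by simp
  then have "r < 1/2" "r > 0" unfolding r_def by (auto simp: field_simps)
  then show "0 < gauss_mu q" "gauss_mu q < 1" unfolding gauss_mu_def r_def[symmetric] by auto
qed

lemma zeta_bounds:
  assumes "m > 0"
  shows "(real i - 1) / real m < zeta m q i" "zeta m q i < real i / real m"
  using assms gauss_mu_bounds[of q] by (auto simp: zeta_def field_simps)

lemma zeta_in_unit:
  assumes "i \<in> {1..m}"
  shows "zeta m q i \<in> {0..1}"
proof -
  have m: "m > 0" using assms by auto
  have "0 \<le> (real i - 1) / real m" "real i / real m \<le> 1" using assms by auto
  with zeta_bounds[OF m, where i = i and q = q] show ?thesis by auto
qed

text \<open>The nodes are interior to the cells, so averages see only open cells, on which
  \<open>cell\<close> is constant. Closed cells serve the evaluation points, which may be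
  breakpoints.\<close>

definition open_cell :: "nat \<Rightarrow> nat \<Rightarrow> real set" where
  "open_cell n j = {(real j - 1) / real n <..< real j / real n}"

definition closed_cell :: "nat \<Rightarrow> nat \<Rightarrow> real set" where
  "closed_cell n j = {(real j - 1) / real n .. real j / real n}"

lemma open_cell_subset: "open_cell n j \<subseteq> closed_cell n j"
  by (auto simp: open_cell_def closed_cell_def)

lemma closed_cell_subset:
  assumes "1 \<le> j" "j \<le> n"
  shows "closed_cell n j \<subseteq> {0..1}"
proof -
  have "0 \<le> (real j - 1) / real n" "real j / real n \<le> 1" using assms by auto
  then show ?thesis by (auto simp: closed_cell_def)
qed

lemma closed_cell_dist:
  assumes "n > 0" "t \<in> closed_cell n j" "t' \<in> closed_cell n j"
  shows "\<bar>t - t'\<bar> \<le> 1 / real n"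
  using assms by (auto simp: closed_cell_def diff_divide_distrib)

lemma cell_open_cell:
  assumes n: "n > 0" and j: "1 \<le> j" and t: "t \<in> open_cell n j"
  shows "cell n t = j"
proof -
  have b: "real j - 1 < t * real n" "t * real n < real j"
    using t n by (auto simp: open_cell_def field_simps)
  then have "t > 0" using j n by (smt (verit) mult_nonpos_nonneg of_nat_1 of_nat_le_iff of_nat_0_le_iff)
  moreover have "\<lceil>t * real n\<rceil> = int j" using b by linarith
  ultimately show ?thesis by (simp add: cell_def)
qed

lemma cell_bounds:
  assumes n: "n > 0" and t: "t \<in> {0..1}"
  shows "1 \<le> cell n t" "cell n t \<le> n" "t \<in> closed_cell n (cell n t)"
proof -
  have "1 \<le> cell n t \<and> cell n t \<le> n \<and> t \<in> closed_cell n (cell n t)"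
  proof (cases "t \<le> 0")
    case True
    then show ?thesis using n t by (auto simp: cell_def closed_cell_def)
  next
    case False
    define k where "k = \<lceil>t * real n\<rceil>"
    have tn: "0 < t * real n" "t * real n \<le> real n" using False t n by (auto simp: mult_left_le_one_le)
    then have k: "0 < k" "k \<le> int n" by (simp_all add: k_def ceiling_le_iff)
    have "real_of_int k - 1 < t * real n" "t * real n \<le> real_of_int k" unfolding k_def by linarith+
    then have "t \<in> closed_cell n (nat k)"
      using k n by (auto simp: closed_cell_def field_simps)
    moreover have "cell n t = nat k" using False by (simp add: cell_def k_def)
    ultimately show ?thesis using k by auto
  qed
  then show "1 \<le> cell n t" "cell n t \<le> n" "t \<in> closed_cell n (cell n t)" by auto
qed

lemma measurable_cell: "(\<lambda>t. g (cell k t)) \<in> borel_measurable borel" for g :: "nat \<Rightarrow> real"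
proof -
  have "cell k \<in> measurable borel (count_space UNIV)"
    unfolding cell_def[abs_def] by measurable
  then show ?thesis by (rule measurable_compose) simp
qed

lemma node_in_open_cell:
  assumes "n > 0" "1 \<le> j" "\<nu> \<in> {1..p}"
  shows "zeta (n * p) q ((j - 1) * p + \<nu>) \<in> open_cell n j"
proof -
  have np: "n * p > 0" using assms by auto
  have p: "real p > 0" using assms by auto
  have e: "real ((j - 1) * p + \<nu>) = (real j - 1) * real p + real \<nu>" using assms by (simp add: of_nat_diff)
  have "(real j - 1) / real n = ((real j - 1) * real p) / real (n * p)" using p by simp
  also have "\<dots> \<le> (real ((j - 1) * p + \<nu>) - 1) / real (n * p)"
    unfolding e using assms by (intro divide_right_mono) auto
  finally have 1: "(real j - 1) / real n \<le> (real ((j - 1) * p + \<nu>) - 1) / real (n * p)" .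
  have "real ((j - 1) * p + \<nu>) / real (n * p) \<le> (real j * real p) / real (n * p)"
    unfolding e using assms by (intro divide_right_mono) (auto simp: algebra_simps)
  also have "\<dots> = real j / real n" using p by simp
  finally have 2: "real ((j - 1) * p + \<nu>) / real (n * p) \<le> real j / real n" .
  show ?thesis
    using 1 2 zeta_bounds[OF np, where i = "(j - 1) * p + \<nu>" and q = q] by (auto simp: open_cell_def)
qed

section \<open>Algebra of cell averages, of the quadrature functional and of the projection\<close>

lemma cell_avg_cong:
  assumes "n > 0" "1 \<le> j" "\<And>t. t \<in> open_cell n j \<Longrightarrow> f t = g t"
  shows "cell_avg n p j f = cell_avg n p j g"
  unfolding cell_avg_def
  by (intro arg_cong[where f = "\<lambda>x. _ * x"] sum.cong refl) (use assms node_in_open_cell in auto)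

lemma cell_avg_const: "p > 0 \<Longrightarrow> cell_avg n p j (\<lambda>_. c) = c"
  by (simp add: cell_avg_def gauss_w_def)

lemma cell_avg_add: "cell_avg n p j (\<lambda>t. f t + g t) = cell_avg n p j f + cell_avg n p j g"
  by (simp add: cell_avg_def sum.distrib algebra_simps)

lemma cell_avg_diff: "cell_avg n p j (\<lambda>t. f t - g t) = cell_avg n p j f - cell_avg n p j g"
  by (simp add: cell_avg_def sum.distrib sum_subtractf algebra_simps)

lemma cell_avg_cmult: "cell_avg n p j (\<lambda>t. c * f t) = c * cell_avg n p j f"
proof -
  have "cell_avg n p j (\<lambda>t. c * f t) = (1 / real p) * (c * (\<Sum>\<nu>=1..p. \<Sum>q\<in>{1,2}. gauss_w q * f (zeta (n * p) q ((j - 1) * p + \<nu>))))"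
    unfolding cell_avg_def sum_distrib_left by (simp add: mult_ac)
  then show ?thesis by (simp add: cell_avg_def)
qed

lemma cell_avg_bound:
  assumes "n > 0" "1 \<le> j" "p > 0" and b: "\<And>t. t \<in> open_cell n j \<Longrightarrow> \<bar>g t\<bar> \<le> b"
  shows "\<bar>cell_avg n p j g\<bar> \<le> b"
proof -
  have "\<bar>\<Sum>\<nu>=1..p. \<Sum>q\<in>{1,2}. gauss_w q * g (zeta (n * p) q ((j - 1) * p + \<nu>))\<bar> \<le> (\<Sum>\<nu>=1..p. b)"
  proof (rule order_trans[OF sum_abs], rule sum_mono)
    fix \<nu> assume "\<nu> \<in> {1..p}"
    then have "\<bar>g (zeta (n * p) q ((j - 1) * p + \<nu>))\<bar> \<le> b" for q
      using b node_in_open_cell assms by blast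
    from this[of 1] this[of 2] show "\<bar>\<Sum>q\<in>{1,2}. gauss_w q * g (zeta (n * p) q ((j - 1) * p + \<nu>))\<bar> \<le> b"
      by (simp add: gauss_w_def)
  qed
  also have "\<dots> = real p * b" by simp
  finally show ?thesis using assms(3) by (simp add: cell_avg_def abs_mult field_simps)
qed

text \<open>The fine subcells \<open>(j - 1) * p + 1\<close> to \<open>j * p\<close> make up coarse
  cell \<open>j\<close>. This regrouping lets orthogonality act cell by cell.\<close>

lemma quad_eq_cell_avgs:
  assumes "n > 0" "p > 0"
  shows "quad (n * p) g = (1 / real n) * (\<Sum>j=1..n. cell_avg n p j g)"
proof -
  define F where "F i = (\<Sum>q\<in>{1,2}. gauss_w q * g (zeta (n * p) q i))" for i
  have "(\<Sum>i=1..k*p. F i) = (\<Sum>j=1..k. \<Sum>\<nu>=1..p. F ((j - 1) * p + \<nu>))" for k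
  proof (induction k)
    case (Suc k)
    have "{1..Suc k * p} = {1..k*p} \<union> {k*p+1..k*p+p}" by auto
    then have "(\<Sum>i=1..Suc k * p. F i) = (\<Sum>i=1..k*p. F i) + (\<Sum>i=k*p+1..k*p+p. F i)"
      by (simp only:) (rule sum.union_disjoint, auto)
    also have "(\<Sum>i=k*p+1..k*p+p. F i) = (\<Sum>\<nu>=1..p. F (k * p + \<nu>))"
      using sum.shift_bounds_cl_nat_ivl[of F 1 "k*p" p] by (simp add: add.commute)
    finally show ?case using Suc by simp
  qed simp
  then have "quad (n * p) g = (1 / real (n * p)) * (\<Sum>j=1..n. \<Sum>\<nu>=1..p. F ((j - 1) * p + \<nu>))"
    by (simp add: quad_def F_def)
  also have "\<dots> = (1 / real n) * (\<Sum>j=1..n. cell_avg n p j g)"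
    by (simp add: cell_avg_def F_def sum_distrib_left[symmetric] sum_divide_distrib[symmetric])
  finally show ?thesis .
qed

lemma quad_cong:
  assumes "\<And>t. t \<in> {0..1} \<Longrightarrow> f t = g t"
  shows "quad m f = quad m g"
  unfolding quad_def
  by (intro arg_cong[where f = "\<lambda>x. _ * x"] sum.cong refl) (use assms zeta_in_unit in auto)

lemma Km_cong: "(\<And>t. t \<in> {0..1} \<Longrightarrow> x t = y t) \<Longrightarrow> Km \<kappa> k x s = Km \<kappa> k y s"
  unfolding Km_eq_quad by (rule quad_cong) auto

lemma quad_add: "quad m (\<lambda>t. f t + g t) = quad m f + quad m g"
  by (simp add: quad_def sum.distrib algebra_simps)

lemma quad_diff: "quad m (\<lambda>t. f t - g t) = quad m f - quad m g"
  by (simp add: quad_def sum.distrib sum_subtractf algebra_simps)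

lemma quad_bound:
  assumes "m > 0" and b: "\<And>t. t \<in> {0..1} \<Longrightarrow> \<bar>g t\<bar> \<le> b"
  shows "\<bar>quad m g\<bar> \<le> b"
proof -
  have "\<bar>\<Sum>i=1..m. \<Sum>q\<in>{1,2}. gauss_w q * g (zeta m q i)\<bar> \<le> (\<Sum>i=1..m. b)"
  proof (rule order_trans[OF sum_abs], rule sum_mono)
    fix i assume "i \<in> {1..m}"
    then have "\<bar>g (zeta m q i)\<bar> \<le> b" for q
      using b zeta_in_unit by blast
    from this[of 1] this[of 2] show "\<bar>\<Sum>q\<in>{1,2}. gauss_w q * g (zeta m q i)\<bar> \<le> b"
      by (simp add: gauss_w_def)
  qed
  also have "\<dots> = real m * b" by simp
  finally show ?thesis using assms(1) by (simp add: quad_def abs_mult field_simps)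
qed

text \<open>Discrete orthogonality: \<open>v - Qn v\<close> has vanishing average over every cell, so only the
  oscillation of the weight \<open>a\<close> on the cell matters.\<close>

lemma cell_avg_orthogonal_bound:
  assumes n: "n > 0" and j: "1 \<le> j" and p: "p > 0"
    and a: "\<And>t t'. t \<in> open_cell n j \<Longrightarrow> t' \<in> open_cell n j \<Longrightarrow> \<bar>a t - a t'\<bar> \<le> \<alpha>"
    and v: "\<And>t. t \<in> open_cell n j \<Longrightarrow> \<bar>v t - Qn n p v t\<bar> \<le> \<beta>"
  shows "\<bar>cell_avg n p j (\<lambda>t. a t * (v t - Qn n p v t))\<bar> \<le> \<alpha> * \<beta>"
proof -
  define c where "c = (real j - 1/2) / real n"
  have c: "c \<in> open_cell n j" using n by (simp add: c_def open_cell_def divide_strict_right_mono)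
  have Q: "Qn n p v t = cell_avg n p j v" if "t \<in> open_cell n j" for t
    using cell_open_cell[OF n j that] by (simp add: Qn_eq_cell_avg)
  have "cell_avg n p j (\<lambda>t. v t - Qn n p v t) = cell_avg n p j (\<lambda>t. v t - cell_avg n p j v)"
    by (rule cell_avg_cong) (use n j Q in auto)
  also have "\<dots> = 0" using p by (simp add: cell_avg_diff cell_avg_const)
  finally have zero: "cell_avg n p j (\<lambda>t. v t - Qn n p v t) = 0" .
  have "cell_avg n p j (\<lambda>t. a t * (v t - Qn n p v t))
      = cell_avg n p j (\<lambda>t. (a t - a c) * (v t - Qn n p v t) + a c * (v t - Qn n p v t))"
    by (simp add: algebra_simps)
  also have "\<dots> = cell_avg n p j (\<lambda>t. (a t - a c) * (v t - Qn n p v t))"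
    using zero by (simp add: cell_avg_add cell_avg_cmult)
  also have "\<bar>\<dots>\<bar> \<le> \<alpha> * \<beta>"
  proof (rule cell_avg_bound)
    fix t assume t: "t \<in> open_cell n j"
    show "\<bar>(a t - a c) * (v t - Qn n p v t)\<bar> \<le> \<alpha> * \<beta>"
      unfolding abs_mult using a[OF t c] v[OF t] by (intro mult_mono) auto
  qed (use n j p in auto)
  finally show ?thesis .
qed

lemma Qn_add: "Qn n p (\<lambda>t. f t + g t) t = Qn n p f t + Qn n p g t"
  by (simp add: Qn_eq_cell_avg cell_avg_add)

lemma Qn_diff: "Qn n p (\<lambda>t. f t - g t) t = Qn n p f t - Qn n p g t"
  by (simp add: Qn_eq_cell_avg cell_avg_diff)

lemma Qn_cong:
  assumes n: "n > 0" and t: "t \<in> {0..1}" and eq: "\<And>t. t \<in> {0..1} \<Longrightarrow> f t = g t"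
  shows "Qn n p f t = Qn n p g t"
  unfolding Qn_eq_cell_avg
  using cell_bounds[OF n t] closed_cell_subset[of "cell n t" n] open_cell_subset[of n "cell n t"] n
  by (intro cell_avg_cong) (auto intro!: eq)

lemma Qn_bound:
  assumes n: "n > 0" and p: "p > 0" and t: "t \<in> {0..1}" and b: "\<And>t. t \<in> {0..1} \<Longrightarrow> \<bar>v t\<bar> \<le> b"
  shows "\<bar>Qn n p v t\<bar> \<le> b"
  unfolding Qn_eq_cell_avg
  using cell_bounds[OF n t] closed_cell_subset[of "cell n t" n] open_cell_subset[of n "cell n t"] n p
  by (intro cell_avg_bound) (auto intro!: b)

lemma Qn_Qn:
  assumes n: "n > 0" and p: "p > 0" and t: "t \<in> {0..1}"
  shows "Qn n p (Qn n p v) t = Qn n p v t"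
proof -
  let ?j = "cell n t"
  have j: "1 \<le> ?j" using cell_bounds[OF n t] by simp
  have "cell_avg n p ?j (Qn n p v) = cell_avg n p ?j (\<lambda>_. cell_avg n p ?j v)"
    by (rule cell_avg_cong) (use n j cell_open_cell in \<open>auto simp: Qn_eq_cell_avg\<close>)
  then show ?thesis using p by (simp add: Qn_eq_cell_avg cell_avg_const)
qed

lemma minus_Qn_bound:
  assumes n: "n > 0" and p: "p > 0" and t: "t \<in> {0..1}"
    and b: "\<And>t'. t' \<in> closed_cell n (cell n t) \<Longrightarrow> \<bar>v t - v t'\<bar> \<le> b"
  shows "\<bar>v t - Qn n p v t\<bar> \<le> b"
proof -
  have "v t - Qn n p v t = cell_avg n p (cell n t) (\<lambda>t'. v t - v t')"
    using p by (simp add: Qn_eq_cell_avg cell_avg_diff cell_avg_const)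
  also have "\<bar>\<dots>\<bar> \<le> b"
    using b cell_bounds[OF n t] open_cell_subset[of n "cell n t"] n p by (intro cell_avg_bound) auto
  finally show ?thesis .
qed

lemma minus_Qn_bound_lipschitz:
  assumes n: "n > 0" and p: "p > 0" and t: "t \<in> {0..1}" and "b \<ge> 0"
    and b: "\<And>t t'. t \<in> {0..1} \<Longrightarrow> t' \<in> {0..1} \<Longrightarrow> \<bar>v t - v t'\<bar> \<le> b * \<bar>t - t'\<bar>"
  shows "\<bar>v t - Qn n p v t\<bar> \<le> b / real n"
proof (rule minus_Qn_bound[OF n p t])
  fix t' assume t': "t' \<in> closed_cell n (cell n t)"
  note c = cell_bounds[OF n t]
  have "\<bar>v t - v t'\<bar> \<le> b * \<bar>t - t'\<bar>" using b t t' closed_cell_subset[OF c(1,2)] by auto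
  also have "\<dots> \<le> b * (1 / real n)"
    using closed_cell_dist[OF n c(3) t'] assms(4) by (intro mult_left_mono) auto
  finally show "\<bar>v t - v t'\<bar> \<le> b / real n" by simp
qed

section \<open>Errors of the composite Gauss rule for Lipschitz and for kinked integrands\<close>

lemma gauss_error_lipschitz:
  fixes g :: "real \<Rightarrow> real"
  assumes w: "w \<ge> 0" and cont: "continuous_on {a..a+w} g" and b: "b \<ge> 0"
    and lip: "\<And>t t'. t \<in> {a..a+w} \<Longrightarrow> t' \<in> {a..a+w} \<Longrightarrow> \<bar>g t - g t'\<bar> \<le> b * \<bar>t - t'\<bar>"
    and z: "z1 \<in> {a..a+w}" "z2 \<in> {a..a+w}"
  shows "\<bar>integral {a..a+w} g - w * (g z1 + g z2) / 2\<bar> \<le> b * w\<^sup>2"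
proof -
  define k where "k = (g z1 + g z2) / 2"
  have int: "g integrable_on {a..a+w}" using cont by (rule integrable_continuous_interval)
  have "integral {a..a+w} (\<lambda>t. g t - k) = integral {a..a+w} g - w * k"
    using int w by (subst integral_diff) auto
  moreover have "norm (integral {a..a+w} (\<lambda>t. g t - k)) \<le> (b * w) * (a + w - a)"
  proof (rule integral_bound)
    fix t assume t: "t \<in> {a..a+w}"
    have "\<bar>g t - g z1\<bar> \<le> b * w" "\<bar>g t - g z2\<bar> \<le> b * w"
      using lip[OF t z(1)] lip[OF t z(2)] t z b
      by (smt (verit) atLeastAtMost_iff mult_left_mono)+
    then show "norm (g t - k) \<le> b * w" unfolding k_def by (simp add: abs_le_iff field_simps)
  qed (use w cont in \<open>auto intro!: continuous_intros\<close>)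
  ultimately show ?thesis by (simp add: k_def power2_eq_square algebra_simps)
qed

lemma integral_reflect_interval:
  fixes g :: "real \<Rightarrow> real"
  assumes cont: "continuous_on {a..b} g"
  shows "((\<lambda>t. g (a + b - t)) has_integral integral {a..b} g) {a..b}"
proof -
  have "(g has_integral integral {a..b} g) (cbox a b)"
    using integrable_continuous_interval[OF cont] by (simp add: integrable_integral)
  from has_integral_affinity[OF this, of "-1" "a + b"] show ?thesis
    by (simp add: image_affinity_atLeastAtMost_diff image_affinity_cbox split: if_splits)
qed

text \<open>Since the nodes are symmetric about \<open>c\<close>, reflection writes both the
  integral and the node sum through \<open>g (c + y) + g (c - y)\<close>. Each is compared with
  \<open>2 * g c\<close>, and each comparison costs \<open>K * w ^ 3\<close>.\<close>

lemma gauss_error_second: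
  fixes g :: "real \<Rightarrow> real"
  assumes w: "w \<ge> 0" and cont: "continuous_on {c-w..c+w} g" and K: "K \<ge> 0"
    and sec: "\<And>y. 0 \<le> y \<Longrightarrow> y \<le> w \<Longrightarrow> \<bar>g (c + y) + g (c - y) - 2 * g c\<bar> \<le> K * y\<^sup>2"
    and x: "0 \<le> x" "x \<le> w"
  shows "\<bar>integral {c-w..c+w} g - 2 * w * (g (c - x) + g (c + x)) / 2\<bar> \<le> 2 * K * w ^ 3"
proof -
  have sec': "\<bar>g (c + y) + g (c - y) - 2 * g c\<bar> \<le> K * w\<^sup>2" if "0 \<le> y" "y \<le> w" for y
    using sec[OF that] that K by (smt (verit) mult_left_mono power_mono)
  have int: "g integrable_on {c-w..c+w}" using cont by (rule integrable_continuous_interval)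
  have refl: "((\<lambda>t. g (2 * c - t)) has_integral integral {c-w..c+w} g) {c-w..c+w}"
    using integral_reflect_interval[OF cont] by (simp add: algebra_simps)
  have cont': "continuous_on {c-w..c+w} (\<lambda>t. g (2 * c - t))"
    by (rule continuous_on_compose2[OF cont]) (auto intro!: continuous_intros)
  have "2 * integral {c-w..c+w} g = integral {c-w..c+w} (\<lambda>t. g t + g (2 * c - t))"
    using integral_add[OF int, of "\<lambda>t. g (2 * c - t)"] refl by (simp add: has_integral_iff)
  moreover have "integral {c-w..c+w} (\<lambda>t. g t + g (2 * c - t) - 2 * g c)
     = integral {c-w..c+w} (\<lambda>t. g t + g (2 * c - t)) - 2 * w * (2 * g c)"
    using int refl w by (subst integral_diff) (auto simp: has_integral_iff intro!: integrable_add)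
  moreover have "norm (integral {c-w..c+w} (\<lambda>t. g t + g (2 * c - t) - 2 * g c)) \<le> (K * w\<^sup>2) * (c + w - (c - w))"
  proof (rule integral_bound)
    fix t assume t: "t \<in> {c-w..c+w}"
    show "norm (g t + g (2 * c - t) - 2 * g c) \<le> K * w\<^sup>2"
    proof (cases "t \<ge> c")
      case True
      then show ?thesis using sec'[of "t - c"] t by simp
    next
      case False
      then show ?thesis using sec'[of "c - t"] t by (simp add: add.commute)
    qed
  qed (use w cont cont' in \<open>auto intro!: continuous_intros\<close>)
  moreover have "\<bar>2 * w * (g (c + x) + g (c - x) - 2 * g c)\<bar> \<le> 2 * w * (K * w\<^sup>2)"
    unfolding abs_mult using sec'[OF x] w by (intro mult_mono) auto
  ultimately have "2 * (integral {c-w..c+w} g - 2 * w * (g (c - x) + g (c + x)) / 2)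
      = integral {c-w..c+w} (\<lambda>t. g t + g (2 * c - t) - 2 * g c) - 2 * w * (g (c + x) + g (c - x) - 2 * g c)"
    and "\<bar>integral {c-w..c+w} (\<lambda>t. g t + g (2 * c - t) - 2 * g c)\<bar> \<le> 2 * K * w ^ 3"
    and "\<bar>2 * w * (g (c + x) + g (c - x) - 2 * g c)\<bar> \<le> 2 * K * w ^ 3"
    by (simp_all add: algebra_simps power2_eq_square power3_eq_cube)
  moreover have "\<bar>X\<bar> \<le> B" if "2 * X = D - Y" "\<bar>D\<bar> \<le> B" "\<bar>Y\<bar> \<le> B" for X Y D B :: real
    using that by linarith
  ultimately show ?thesis by blast
qed

lemma integral_unit_cells:
  fixes g :: "real \<Rightarrow> real"
  assumes m: "m > 0" and cont: "continuous_on {0..1} g"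
  shows "integral {0..1} g = (\<Sum>i=1..m. integral {(real i - 1) / real m .. real i / real m} g)"
proof -
  have "integral {0..real k / real m} g = (\<Sum>i=1..k. integral {(real i - 1) / real m .. real i / real m} g)"
    if "k \<le> m" for k
    using that
  proof (induction k)
    case (Suc k)
    have le: "real (Suc k) / real m \<le> 1" using Suc.prems m by simp
    have "continuous_on {0..real (Suc k) / real m} g"
      using cont le by (auto intro: continuous_on_subset)
    then have "g integrable_on {0..real (Suc k) / real m}" by (rule integrable_continuous_interval)
    then have "integral {0..real k / real m} g + integral {real k / real m..real (Suc k) / real m} g
        = integral {0..real (Suc k) / real m} g"
      by (intro Henstock_Kurzweil_Integration.integral_combine) (auto intro!: divide_right_mono)
    then show ?case using Suc by simp
  qed simp
  from this[of m] show ?thesis using m by simp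
qed

lemma quad_error_sum:
  assumes m: "m > 0" and cont: "continuous_on {0..1} g"
    and E: "\<And>i. i \<in> {1..m} \<Longrightarrow>
      \<bar>integral {(real i - 1) / real m .. real i / real m} g - (1 / real m) * (g (zeta m 1 i) + g (zeta m 2 i)) / 2\<bar> \<le> E i"
  shows "\<bar>integral {0..1} g - quad m g\<bar> \<le> (\<Sum>i=1..m. E i)"
proof -
  have "quad m g = (\<Sum>i=1..m. (1 / real m) * (g (zeta m 1 i) + g (zeta m 2 i)) / 2)"
    unfolding quad_def sum_distrib_left by (intro sum.cong refl) (simp add: gauss_w_def field_simps)
  then have "integral {0..1} g - quad m g = (\<Sum>i=1..m. integral {(real i - 1) / real m .. real i / real m} g
      - (1 / real m) * (g (zeta m 1 i) + g (zeta m 2 i)) / 2)"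
    by (simp add: integral_unit_cells[OF m cont] sum_subtractf)
  also have "\<bar>\<dots>\<bar> \<le> (\<Sum>i=1..m. E i)"
    using E by (auto intro!: order_trans[OF sum_abs] sum_mono)
  finally show ?thesis .
qed

lemma subcell_error_lipschitz:
  assumes m: "m > 0" and i: "i \<in> {1..m}" and cont: "continuous_on {0..1} g" and b: "b \<ge> 0"
    and lip: "\<And>t t'. t \<in> {0..1} \<Longrightarrow> t' \<in> {0..1} \<Longrightarrow> \<bar>g t - g t'\<bar> \<le> b * \<bar>t - t'\<bar>"
  shows "\<bar>integral {(real i - 1) / real m .. real i / real m} g - (1 / real m) * (g (zeta m 1 i) + g (zeta m 2 i)) / 2\<bar>
    \<le> b * (1 / real m)\<^sup>2"
proof -
  have eq: "(real i - 1) / real m + 1 / real m = real i / real m" by (simp add: diff_divide_distrib)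
  have "0 \<le> (real i - 1) / real m" "real i / real m \<le> 1" using i m by auto
  then have sub: "{(real i - 1) / real m .. real i / real m} \<subseteq> {0..1}" by auto
  have "zeta m q i \<in> {(real i - 1) / real m .. real i / real m}" for q
    using zeta_bounds[OF m, where i = i and q = q] by auto
  then show ?thesis
    using gauss_error_lipschitz[of "1 / real m" "(real i - 1) / real m" g b "zeta m 1 i" "zeta m 2 i"]
      continuous_on_subset[OF cont sub] b lip sub unfolding eq by auto
qed

lemma quad_error_lipschitz:
  assumes m: "m > 0" and cont: "continuous_on {0..1} g" and b: "b \<ge> 0"
    and lip: "\<And>t t'. t \<in> {0..1} \<Longrightarrow> t' \<in> {0..1} \<Longrightarrow> \<bar>g t - g t'\<bar> \<le> b * \<bar>t - t'\<bar>"
  shows "\<bar>integral {0..1} g - quad m g\<bar> \<le> b / real m"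
proof -
  have "\<bar>integral {0..1} g - quad m g\<bar> \<le> (\<Sum>i=1..m. b * (1 / real m)\<^sup>2)"
    by (rule quad_error_sum[OF m cont]) (rule subcell_error_lipschitz[OF m _ cont b lip])
  also have "\<dots> = b / real m" using m by (simp add: power2_eq_square)
  finally show ?thesis .
qed

text \<open>The kink \<open>s\<close> is interior to at most one subcell. There the Lipschitz bound
  is paid once, with a squared mesh width; the remaining subcells cost order
  \<open>K * (1 / real m) ^ 3\<close> each, and there are at most \<open>m\<close> of them.\<close>

lemma quad_error_kink:
  assumes m: "m > 0" and cont: "continuous_on {0..1} g" and b: "b \<ge> 0" and K: "K \<ge> 0"
    and lip: "\<And>t t'. t \<in> {0..1} \<Longrightarrow> t' \<in> {0..1} \<Longrightarrow> \<bar>g t - g t'\<bar> \<le> b * \<bar>t - t'\<bar>"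
    and sec: "\<And>c y. 0 \<le> y \<Longrightarrow> 0 \<le> c - y \<Longrightarrow> c + y \<le> 1 \<Longrightarrow> c + y \<le> s \<or> s \<le> c - y \<Longrightarrow>
       \<bar>g (c + y) + g (c - y) - 2 * g c\<bar> \<le> K * y\<^sup>2"
  shows "\<bar>integral {0..1} g - quad m g\<bar> \<le> (b + K) * (1 / real m)\<^sup>2"
proof -
  \<comment> \<open>For \<open>s > 0\<close> this is the subcell with \<open>s\<close> in its
    half-open interval, closed on the right; an index outside \<open>1..m\<close> singles out no
    subcell.\<close>
  define i0 where "i0 = nat \<lceil>s * real m\<rceil>"
  define E where "E i = K * (1 / real m) ^ 3 + (if i = i0 then b * (1 / real m)\<^sup>2 else 0)" for i
  have "\<bar>integral {0..1} g - quad m g\<bar> \<le> (\<Sum>i=1..m. E i)"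
  proof (rule quad_error_sum[OF m cont])
    fix i assume i: "i \<in> {1..m}"
    show "\<bar>integral {(real i - 1) / real m .. real i / real m} g - (1 / real m) * (g (zeta m 1 i) + g (zeta m 2 i)) / 2\<bar> \<le> E i"
    proof (cases "i = i0")
      case True
      have "0 \<le> K * (1 / real m) ^ 3" using K by simp
      then show ?thesis
        using subcell_error_lipschitz[OF m i cont b lip] True by (simp add: E_def)
    next
      case False
      \<comment> \<open>Midpoint, half width, and distance of the two nodes from the
        midpoint.\<close>
      define c where "c = (real i - 1/2) / real m"
      define w where "w = 1 / (2 * real m)"
      define x where "x = 1 / (2 * sqrt 3) / real m"
      have "1 \<le> sqrt 3" by simp
      then have x: "0 \<le> x" "x \<le> w" using m by (auto simp: x_def w_def frac_le)
      have cw: "c - w = (real i - 1) / real m" "c + w = real i / real m" "2 * w = 1 / real m" "w \<ge> 0"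
        using m by (auto simp: c_def w_def field_simps)
      have z: "zeta m 1 i = c - x" "zeta m 2 i = c + x"
        using m by (simp_all add: zeta_def gauss_mu_def c_def x_def field_simps)
      have c01: "0 \<le> c - w" "c + w \<le> 1" using i m unfolding cw by auto
      have side: "c + w \<le> s \<or> s \<le> c - w"
      proof (rule ccontr)
        assume "\<not> ?thesis"
        then have "s < real i / real m" "(real i - 1) / real m < s" unfolding cw by auto
        then have "s * real m < real i" "real i - 1 < s * real m" using m by (auto simp: field_simps)
        then have "\<lceil>s * real m\<rceil> = int i" by linarith
        then show False using False by (simp add: i0_def)
      qed
      have "\<bar>integral {c-w..c+w} g - 2 * w * (g (c - x) + g (c + x)) / 2\<bar> \<le> 2 * K * w ^ 3"
      proof (rule gauss_error_second)
        show "continuous_on {c-w..c+w} g" using c01 by (intro continuous_on_subset[OF cont]) auto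
        show "\<bar>g (c + y) + g (c - y) - 2 * g c\<bar> \<le> K * y\<^sup>2" if "0 \<le> y" "y \<le> w" for y
          using sec[of y c] that side c01 by linarith
      qed (use cw x K in auto)
      also have "2 * K * w ^ 3 \<le> K * (1 / real m) ^ 3"
        using K m by (simp add: w_def power3_eq_cube field_simps)
      finally show ?thesis using False unfolding cw z E_def by simp
    qed
  qed
  also have "\<dots> = real m * (K * (1 / real m) ^ 3) + (\<Sum>i=1..m. if i = i0 then b * (1 / real m)\<^sup>2 else 0)"
    by (simp add: E_def sum.distrib)
  also have "(\<Sum>i=1..m. if i = i0 then b * (1 / real m)\<^sup>2 else 0) \<le> b * (1 / real m)\<^sup>2"
    using b by (simp add: sum.delta)
  also have "real m * (K * (1 / real m) ^ 3) = K * (1 / real m)\<^sup>2"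
    using m by (simp add: power3_eq_cube power2_eq_square)
  finally show ?thesis by (simp add: algebra_simps)
qed

section \<open>Discretization estimates\<close>

lemma real_mean_value_bound:
  fixes g :: "real \<Rightarrow> real"
  assumes "\<And>w. w \<in> closed_segment v u \<Longrightarrow> (g has_real_derivative g' w) (at w)"
    and "\<And>w. w \<in> closed_segment v u \<Longrightarrow> \<bar>g' w\<bar> \<le> B"
  shows "\<bar>g u - g v\<bar> \<le> B * \<bar>u - v\<bar>"
  using field_differentiable_bound[of "closed_segment v u" g g' B u v] assms
  by (auto intro: has_field_derivative_at_within)

lemma closed_segment_abs_le:
  fixes u v w R :: real
  assumes "w \<in> closed_segment v u"
  shows "\<bar>u\<bar> \<le> R \<Longrightarrow> \<bar>v\<bar> \<le> R \<Longrightarrow> \<bar>w\<bar> \<le> R" "\<bar>w - v\<bar> \<le> \<bar>u - v\<bar>" "\<bar>w - v'\<bar> \<le> \<bar>u - v'\<bar> + \<bar>v - v'\<bar>"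
  using assms by (auto simp: closed_segment_eq_real_ivl split: if_splits)

section \<open>Mean value estimates for the kernel and their consequences for the Nystrom
  operator\<close>

context kernel_bounds
begin

lemma kernel_lip_u:
  "s \<in> {0..1} \<Longrightarrow> t \<in> {0..1} \<Longrightarrow> \<bar>u\<bar> \<le> R \<Longrightarrow> \<bar>u'\<bar> \<le> R \<Longrightarrow> \<bar>\<kappa> s t u - \<kappa> s t u'\<bar> \<le> \<Lambda> * \<bar>u - u'\<bar>"
  using kernel_lip[of s t s t u u'] by simp

lemma kernel_mixed:
  assumes s: "s \<in> {0..1}" "s' \<in> {0..1}" "t \<in> {0..1}" and u: "\<bar>u\<bar> \<le> R" "\<bar>v\<bar> \<le> R"
  shows "\<bar>(\<kappa> s t u - \<kappa> s' t u) - (\<kappa> s t v - \<kappa> s' t v)\<bar> \<le> \<Lambda> * \<bar>s - s'\<bar> * \<bar>u - v\<bar>"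
proof (rule real_mean_value_bound[where g' = "\<lambda>w. ell s t w - ell s' t w"])
  fix w assume w: "w \<in> closed_segment v u"
  show "((\<lambda>u. \<kappa> s t u - \<kappa> s' t u) has_real_derivative ell s t w - ell s' t w) (at w)"
    by (intro derivative_intros kernel_deriv s)
  show "\<bar>ell s t w - ell s' t w\<bar> \<le> \<Lambda> * \<bar>s - s'\<bar>"
    using ell_lip[of s t s' t w w] s closed_segment_abs_le(1)[OF w u] by simp
qed

text \<open>The linearization point \<open>v\<close> is separate from \<open>u\<close> and
  \<open>u'\<close>: it will be \<phi>, so that one linear operator serves all pairs. The proof is a
  mean value bound for \<open>\<kappa> s t u - ell s t v * u\<close>.\<close>

lemma kernel_linearization:
  assumes s: "s \<in> {0..1}" "t \<in> {0..1}" and u: "\<bar>u\<bar> \<le> R" "\<bar>u'\<bar> \<le> R" "\<bar>v\<bar> \<le> R"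
  shows "\<bar>\<kappa> s t u - \<kappa> s t u' - ell s t v * (u - u')\<bar> \<le> \<Lambda> * (\<bar>u - v\<bar> + \<bar>u' - v\<bar>) * \<bar>u - u'\<bar>"
proof -
  have "\<bar>(\<kappa> s t u - ell s t v * u) - (\<kappa> s t u' - ell s t v * u')\<bar> \<le> \<Lambda> * (\<bar>u - v\<bar> + \<bar>u' - v\<bar>) * \<bar>u - u'\<bar>"
  proof (rule real_mean_value_bound[where g' = "\<lambda>w. ell s t w - ell s t v"])
    fix w assume w: "w \<in> closed_segment u' u"
    show "((\<lambda>u. \<kappa> s t u - ell s t v * u) has_real_derivative ell s t w - ell s t v) (at w)"
      by (rule derivative_eq_intros kernel_deriv s refl)+ simp
    have "\<bar>ell s t w - ell s t v\<bar> \<le> \<Lambda> * \<bar>w - v\<bar>"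
      using ell_lip[of s t s t w v] s u closed_segment_abs_le(1)[OF w u(1,2)] by simp
    also have "\<dots> \<le> \<Lambda> * (\<bar>u - v\<bar> + \<bar>u' - v\<bar>)"
      using closed_segment_abs_le(3)[OF w] Lam by (intro mult_left_mono) auto
    finally show "\<bar>ell s t w - ell s t v\<bar> \<le> \<Lambda> * (\<bar>u - v\<bar> + \<bar>u' - v\<bar>)" .
  qed
  then show ?thesis by (simp add: algebra_simps)
qed

text \<open>If \<open>t\<close> lies strictly between \<open>s\<close> and \<open>s'\<close>, the
  increment is split at the diagonal point \<open>s = t\<close>. Both halves are one-sided, and
  their lengths add up to \<open>\<bar>s - s'\<bar>\<close>.\<close>

lemma ell_mixed_u:
  assumes s: "s \<in> {0..1}" "s' \<in> {0..1}" "t \<in> {0..1}" and u: "\<bar>u\<bar> \<le> R" "\<bar>v\<bar> \<le> R"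
  shows "\<bar>(ell s t u - ell s' t u) - (ell s t v - ell s' t v)\<bar> \<le> \<Lambda> * \<bar>s - s'\<bar> * \<bar>u - v\<bar>"
proof (cases "t \<le> min s s' \<or> max s s' \<le> t")
  case True
  then show ?thesis using ell_mixed[of s t s' t u v] s u by (simp add: algebra_simps)
next
  case False
  have d: "max t t \<le> min s t \<or> max s t \<le> min t t" "max t t \<le> min t s' \<or> max t s' \<le> min t t" by auto
  have "\<bar>ell s t u - ell t t u - ell s t v + ell t t v\<bar> \<le> \<Lambda> * \<bar>s - t\<bar> * \<bar>u - v\<bar>"
    using ell_mixed[OF s(1) s(3) s(3) s(3) u d(1)] by simp
  moreover have "\<bar>ell t t u - ell s' t u - ell t t v + ell s' t v\<bar> \<le> \<Lambda> * \<bar>t - s'\<bar> * \<bar>u - v\<bar>"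
    using ell_mixed[OF s(3) s(3) s(2) s(3) u d(2)] by simp
  ultimately have "\<bar>(ell s t u - ell s' t u) - (ell s t v - ell s' t v)\<bar> \<le> \<Lambda> * \<bar>s - t\<bar> * \<bar>u - v\<bar> + \<Lambda> * \<bar>t - s'\<bar> * \<bar>u - v\<bar>"
    by linarith
  also have "\<dots> = \<Lambda> * (\<bar>s - t\<bar> + \<bar>t - s'\<bar>) * \<bar>u - v\<bar>" by (simp add: algebra_simps)
  also have "\<bar>s - t\<bar> + \<bar>t - s'\<bar> = \<bar>s - s'\<bar>" using False by auto
  finally show ?thesis .
qed

text \<open>By \<open>ell_mixed_u\<close> the \<open>u\<close>-derivative of the kernel difference
  is Lipschitz in \<open>u\<close> with a constant proportional to
  \<open>\<bar>s - s'\<bar>\<close>; hence a remainder quadratic in \<open>u - v\<close> that keeps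
  this factor.\<close>

lemma kernel_mixed_linearization:
  assumes s: "s \<in> {0..1}" "s' \<in> {0..1}" "t \<in> {0..1}" and u: "\<bar>u\<bar> \<le> R" "\<bar>v\<bar> \<le> R"
  shows "\<bar>(\<kappa> s t u - \<kappa> s' t u) - (\<kappa> s t v - \<kappa> s' t v) - (ell s t v - ell s' t v) * (u - v)\<bar>
    \<le> \<Lambda> * \<bar>s - s'\<bar> * \<bar>u - v\<bar>\<^sup>2"
proof -
  define a where "a = ell s t v - ell s' t v"
  have "\<bar>(\<kappa> s t u - \<kappa> s' t u - a * u) - (\<kappa> s t v - \<kappa> s' t v - a * v)\<bar> \<le> \<Lambda> * \<bar>s - s'\<bar> * \<bar>u - v\<bar> * \<bar>u - v\<bar>"
  proof (rule real_mean_value_bound[where g' = "\<lambda>w. ell s t w - ell s' t w - a"])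
    fix w assume w: "w \<in> closed_segment v u"
    show "((\<lambda>u. \<kappa> s t u - \<kappa> s' t u - a * u) has_real_derivative ell s t w - ell s' t w - a) (at w)"
      by (rule derivative_eq_intros kernel_deriv s refl)+ simp
    have "\<bar>ell s t w - ell s' t w - a\<bar> \<le> \<Lambda> * \<bar>s - s'\<bar> * \<bar>w - v\<bar>"
      unfolding a_def by (rule ell_mixed_u[OF s closed_segment_abs_le(1)[OF w u] u(2)])
    also have "\<dots> \<le> \<Lambda> * \<bar>s - s'\<bar> * \<bar>u - v\<bar>"
      using closed_segment_abs_le(2)[OF w] Lam by (intro mult_left_mono) auto
    finally show "\<bar>ell s t w - ell s' t w - a\<bar> \<le> \<Lambda> * \<bar>s - s'\<bar> * \<bar>u - v\<bar>" .
  qed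
  then show ?thesis unfolding a_def by (simp add: algebra_simps power2_eq_square)
qed

lemma Km_lip:
  assumes "m > 0" "s \<in> {0..1}" "s' \<in> {0..1}" and x: "\<And>t. t \<in> {0..1} \<Longrightarrow> \<bar>x t\<bar> \<le> R"
  shows "\<bar>Km \<kappa> m x s - Km \<kappa> m x s'\<bar> \<le> \<Lambda> * \<bar>s - s'\<bar>"
  unfolding Km_eq_quad quad_diff[symmetric]
  using assms(1) by (rule quad_bound) (use assms kernel_lip[of s _ s' _ "x _" "x _"] in fastforce)

lemma Km_diff_bound:
  assumes "m > 0" "s \<in> {0..1}" and x: "\<And>t. t \<in> {0..1} \<Longrightarrow> \<bar>x t\<bar> \<le> R" "\<And>t. t \<in> {0..1} \<Longrightarrow> \<bar>y t\<bar> \<le> R"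
    and a: "\<And>t. t \<in> {0..1} \<Longrightarrow> \<bar>x t - y t\<bar> \<le> a"
  shows "\<bar>Km \<kappa> m x s - Km \<kappa> m y s\<bar> \<le> \<Lambda> * a"
  unfolding Km_eq_quad quad_diff[symmetric]
  using assms(1)
proof (rule quad_bound)
  fix t :: real assume t: "t \<in> {0..1}"
  have "\<bar>\<kappa> s t (x t) - \<kappa> s t (y t)\<bar> \<le> \<Lambda> * \<bar>x t - y t\<bar>" using kernel_lip_u assms t by blast
  also have "\<dots> \<le> \<Lambda> * a" using a[OF t] Lam by (intro mult_left_mono) auto
  finally show "\<bar>\<kappa> s t (x t) - \<kappa> s t (y t)\<bar> \<le> \<Lambda> * a" .
qed

lemma Km_diff_lip:
  assumes "m > 0" "s \<in> {0..1}" "s' \<in> {0..1}"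
    and x: "\<And>t. t \<in> {0..1} \<Longrightarrow> \<bar>x t\<bar> \<le> R" "\<And>t. t \<in> {0..1} \<Longrightarrow> \<bar>y t\<bar> \<le> R"
    and a: "\<And>t. t \<in> {0..1} \<Longrightarrow> \<bar>x t - y t\<bar> \<le> a"
  shows "\<bar>(Km \<kappa> m x s - Km \<kappa> m y s) - (Km \<kappa> m x s' - Km \<kappa> m y s')\<bar> \<le> \<Lambda> * a * \<bar>s - s'\<bar>"
  unfolding Km_eq_quad quad_diff[symmetric]
  using assms(1)
proof (rule quad_bound)
  fix t :: real assume t: "t \<in> {0..1}"
  have "\<bar>(\<kappa> s t (x t) - \<kappa> s' t (x t)) - (\<kappa> s t (y t) - \<kappa> s' t (y t))\<bar> \<le> \<Lambda> * \<bar>s - s'\<bar> * \<bar>x t - y t\<bar>"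
    using kernel_mixed assms t by blast
  also have "\<dots> \<le> \<Lambda> * \<bar>s - s'\<bar> * a" using a[OF t] Lam by (intro mult_left_mono) auto
  finally show "\<bar>\<kappa> s t (x t) - \<kappa> s t (y t) - (\<kappa> s' t (x t) - \<kappa> s' t (y t))\<bar> \<le> \<Lambda> * a * \<bar>s - s'\<bar>"
    by (simp add: algebra_simps)
qed

lemma continuous_on_kernel:
  assumes "continuous_on S a" "continuous_on S b" "continuous_on S c" "a ` S \<subseteq> {0..1}" "b ` S \<subseteq> {0..1}"
  shows "continuous_on S (\<lambda>x. \<kappa> (a x) (b x) (c x))" "continuous_on S (\<lambda>x. ell (a x) (b x) (c x))"
proof -
  have c: "continuous_on S (\<lambda>x. (a x, b x, c x))" using assms by (intro continuous_intros)
  have sub: "(\<lambda>x. (a x, b x, c x)) ` S \<subseteq> Psi" using assms by (auto simp: Psi_def)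
  show "continuous_on S (\<lambda>x. \<kappa> (a x) (b x) (c x))"
    using continuous_on_compose2[OF kernel_cont c sub] by simp
  show "continuous_on S (\<lambda>x. ell (a x) (b x) (c x))"
    using continuous_on_compose2[OF ell_cont c sub] by simp
qed

end

text \<open>Nearest-point projection onto the unit interval. Composition with it extends functions
  by constants without increasing sup norm or Lipschitz constant.\<close>

definition clamp01 :: "real \<Rightarrow> real" where
  "clamp01 t = max 0 (min 1 t)"

lemma clamp01_in [simp]: "clamp01 t \<in> {0..1}" "0 \<le> clamp01 t" "clamp01 t \<le> 1"
  and clamp01_id: "t \<in> {0..1} \<Longrightarrow> clamp01 t = t"
  and clamp01_dist: "\<bar>clamp01 s - clamp01 t\<bar> \<le> \<bar>s - t\<bar>"
  by (auto simp: clamp01_def)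

text \<open>\<phi> is carried as its extension by constants to the line, recorded by
  \<open>phi_clamp\<close>, so that it lives in a Banach space. The bound \<open>R - 1\<close>
  leaves room for perturbations of size 1, and \<open>phi_second\<close> stands in for a bound on a
  second derivative.\<close>

locale nystrom = kernel_bounds \<kappa> ell R \<Lambda>
  for \<kappa> ell :: "real \<Rightarrow> real \<Rightarrow> real \<Rightarrow> real" and R \<Lambda> :: real +
  fixes f :: "real \<Rightarrow> real" and \<phi> :: "real \<Rightarrow>\<^sub>C real"
  assumes Lam1: "\<Lambda> \<ge> 1"
    and ell_bound: "\<And>s t u. s \<in> {0..1} \<Longrightarrow> t \<in> {0..1} \<Longrightarrow> \<bar>u\<bar> \<le> R \<Longrightarrow> \<bar>ell s t u\<bar> \<le> \<Lambda>"
    and phi_bound: "\<And>t. \<bar>\<phi> t\<bar> \<le> R - 1"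
    and phi_clamp: "\<And>t. \<phi> (clamp01 t) = \<phi> t"
    and phi_lip: "\<And>t t'. \<bar>\<phi> t - \<phi> t'\<bar> \<le> \<Lambda> * \<bar>t - t'\<bar>"
    and phi_second: "\<And>c y. 0 \<le> y \<Longrightarrow> 0 \<le> c - y \<Longrightarrow> c + y \<le> 1 \<Longrightarrow> \<bar>\<phi> (c + y) + \<phi> (c - y) - 2 * \<phi> c\<bar> \<le> \<Lambda> * y\<^sup>2"
    and f_lip: "\<And>t t'. t \<in> {0..1} \<Longrightarrow> t' \<in> {0..1} \<Longrightarrow> \<bar>f t - f t'\<bar> \<le> \<Lambda> * \<bar>t - t'\<bar>"
    and phi_eq: "\<And>s. s \<in> {0..1} \<Longrightarrow> \<phi> s = f s + integral {0..1} (\<lambda>t. \<kappa> s t (\<phi> t))"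
begin

lemma phi_R: "\<bar>\<phi> t\<bar> \<le> R"
  using phi_bound[of t] by linarith

text \<open>Lipschitz constant plus second-difference constant of
  \<open>\<kappa> s t (\<phi> t)\<close> as a function of \<open>t\<close>.\<close>

definition quad_const :: real where
  "quad_const = \<Lambda> * (1 + \<Lambda>) + \<Lambda> * (\<Lambda> + 2 * (1 + \<Lambda>)\<^sup>2)"

lemma quad_const_nonneg: "quad_const \<ge> 0"
  using Lam1 by (simp add: quad_const_def)

text \<open>In the notation of \<open>Gop_consistent\<close>, the summands account for the
  quadrature error \<open>e1\<close>, the quadratic remainder, the \<open>D1\<close> term and the
  \<open>D2\<close> term.\<close>

definition consist_const :: real where
  "consist_const = quad_const + \<Lambda> * (8 * quad_const\<^sup>2 + 50 * \<Lambda> ^ 6) + 2 * \<Lambda> * quad_const + 10 * \<Lambda> ^ 5"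

text \<open>By the integral equation \<open>\<phi> - f\<close> is the exact integral, and for fixed
  \<open>s\<close> the integrand can have a kink only at \<open>t = s\<close>.\<close>

lemma quad_error_phi:
  assumes m: "m > 0" and s: "s \<in> {0..1}"
  shows "\<bar>(\<phi> s - f s) - Km \<kappa> m \<phi> s\<bar> \<le> quad_const * (1 / real m)\<^sup>2"
proof -
  let ?g = "\<lambda>t. \<kappa> s t (\<phi> t)"
  have "\<bar>integral {0..1} ?g - quad m ?g\<bar> \<le> (\<Lambda> * (1 + \<Lambda>) + \<Lambda> * (\<Lambda> + 2 * (1 + \<Lambda>)\<^sup>2)) * (1 / real m)\<^sup>2"
  proof (rule quad_error_kink[OF m, where s = s])
    show "continuous_on {0..1} ?g"
      by (rule continuous_on_kernel(1)) (use s in \<open>auto intro!: continuous_intros\<close>)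
    show "0 \<le> \<Lambda> * (1 + \<Lambda>)" "0 \<le> \<Lambda> * (\<Lambda> + 2 * (1 + \<Lambda>)\<^sup>2)" using Lam1 by auto
    fix t t' :: real assume t: "t \<in> {0..1}" "t' \<in> {0..1}"
    have "\<bar>?g t - ?g t'\<bar> \<le> \<Lambda> * (\<bar>t - t'\<bar> + \<bar>\<phi> t - \<phi> t'\<bar>)"
      using kernel_lip[OF s t(1) s t(2) phi_R phi_R] by simp
    also have "\<dots> \<le> \<Lambda> * (\<bar>t - t'\<bar> + \<Lambda> * \<bar>t - t'\<bar>)"
      using phi_lip[of t t'] Lam by (intro mult_left_mono) auto
    finally show "\<bar>?g t - ?g t'\<bar> \<le> \<Lambda> * (1 + \<Lambda>) * \<bar>t - t'\<bar>" by (simp add: algebra_simps)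
  next
    fix c y :: real assume y: "0 \<le> y" "0 \<le> c - y" "c + y \<le> 1" "c + y \<le> s \<or> s \<le> c - y"
    define K where "K = (if c + y \<le> s then lower_prism R else upper_prism R)"
    have K: "K \<in> {lower_prism R, upper_prism R}" "(s, c + y, \<phi> (c + y)) \<in> K" "(s, c - y, \<phi> (c - y)) \<in> K" "(s, c, \<phi> c) \<in> K"
      using y s phi_R by (auto simp: K_def mem_lower_prism mem_upper_prism)
    have p: "\<bar>\<phi> (c + y) - \<phi> c\<bar> \<le> \<Lambda> * y" "\<bar>\<phi> (c - y) - \<phi> c\<bar> \<le> \<Lambda> * y"
      using phi_lip[of "c + y" c] phi_lip[of "c - y" c] y by auto
    have "\<bar>?g (c + y) + ?g (c - y) - 2 * ?g c\<bar> \<le>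
       \<Lambda> * (\<bar>\<phi> (c + y) + \<phi> (c - y) - 2 * \<phi> c\<bar> + (y + \<bar>\<phi> (c + y) - \<phi> c\<bar>)\<^sup>2 + (y + \<bar>\<phi> (c - y) - \<phi> c\<bar>)\<^sup>2)"
      using kernel_second[OF K] y by simp
    also have "\<dots> \<le> \<Lambda> * (\<Lambda> * y\<^sup>2 + (y + \<Lambda> * y)\<^sup>2 + (y + \<Lambda> * y)\<^sup>2)"
      using phi_second[OF y(1-3)] p y Lam by (intro mult_left_mono add_mono power_mono) auto
    also have "\<dots> = \<Lambda> * (\<Lambda> + 2 * (1 + \<Lambda>)\<^sup>2) * y\<^sup>2" by (simp add: power2_eq_square algebra_simps)
    finally show "\<bar>?g (c + y) + ?g (c - y) - 2 * ?g c\<bar> \<le> \<Lambda> * (\<Lambda> + 2 * (1 + \<Lambda>)\<^sup>2) * y\<^sup>2" .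
  qed
  then show ?thesis using phi_eq[OF s] by (simp add: Km_eq_quad quad_const_def)
qed

definition lin_op :: "(real \<Rightarrow> real) \<Rightarrow> real \<Rightarrow> real" where
  "lin_op v s = integral {0..1} (\<lambda>t. ell s t (\<phi> t) * v t)"

end

text \<open>The threshold makes \<open>3 * \<Lambda> / real n\<close> at most 1/2, so that
  \<open>Zop y\<close> is within 1 of \<phi>, and thus bounded by \<open>R\<close>, whenever
  \<open>y\<close> is within 1/2 of \<phi>.\<close>

locale nystrom_disc = nystrom +
  fixes n p :: nat
  assumes p: "p > 0" and n_large: "real n \<ge> 6 * \<Lambda>"
begin

lemma n: "n > 0"
  using n_large Lam1 by (cases n) auto

lemma m: "n * p > 0" using n p by simp

lemma Lam_n: "\<Lambda> / real n \<le> 1/6"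
  using n_large n by (simp add: field_simps)

text \<open>A solution \<open>z\<close> of the modified projection equation and its iterate \<open>y = f + Km z\<close> determine each
  other: \<open>z = Zop y\<close>, and \<open>y\<close> is a fixed point of \<open>Gop\<close>.\<close>

definition Zop :: "(real \<Rightarrow> real) \<Rightarrow> real \<Rightarrow> real" where
  "Zop y t = Qn n p y t + ((f t + Km \<kappa> (n * p) (Qn n p y) t) - Qn n p (\<lambda>t. f t + Km \<kappa> (n * p) (Qn n p y) t) t)"

definition Gop :: "(real \<Rightarrow> real) \<Rightarrow> real \<Rightarrow> real" where
  "Gop y s = f s + Km \<kappa> (n * p) (Zop y) s"

definition near :: "real \<Rightarrow> (real \<Rightarrow> real) \<Rightarrow> bool" where
  "near e y \<longleftrightarrow> e \<le> 1/2 \<and> (\<forall>t\<in>{0..1}. \<bar>y t - \<phi> t\<bar> \<le> e)"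

lemma near_R: "near e y \<Longrightarrow> t \<in> {0..1} \<Longrightarrow> \<bar>y t\<bar> \<le> R"
  using phi_bound[of t] unfolding near_def by (smt (verit) field_sum_of_halves)

lemma Qn_near_R: "near e y \<Longrightarrow> t \<in> {0..1} \<Longrightarrow> \<bar>Qn n p y t\<bar> \<le> R"
  using Qn_bound[OF n p] near_R by blast

text \<open>Splitting \<phi> as \<open>Qn \<phi> + (\<phi> - Qn \<phi>)\<close>, the projected parts
  give \<open>Qn (y - \<phi>)\<close>, while the oscillating parts give the defect of \<phi> in the
  equation with \<open>Qn y\<close>.\<close>

lemma Zop_minus_phi:
  "Zop y t - \<phi> t = Qn n p (\<lambda>t. y t - \<phi> t) t
     - ((\<phi> t - f t - Km \<kappa> (n * p) (Qn n p y) t) - Qn n p (\<lambda>t. \<phi> t - f t - Km \<kappa> (n * p) (Qn n p y) t) t)"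
  by (simp add: Zop_def Qn_add Qn_diff)

lemma Zop_near:
  assumes y: "near e y" and t: "t \<in> {0..1}"
  shows "\<bar>Zop y t - \<phi> t\<bar> \<le> e + 3 * \<Lambda> / real n" "\<bar>Zop y t\<bar> \<le> R"
proof -
  have 1: "\<bar>Qn n p (\<lambda>t. y t - \<phi> t) t\<bar> \<le> e"
    by (rule Qn_bound[OF n p t]) (use y in \<open>auto simp: near_def\<close>)
  let ?w = "\<lambda>t. \<phi> t - f t - Km \<kappa> (n * p) (Qn n p y) t"
  \<comment> \<open>One \<open>\<Lambda>\<close> each for the Lipschitz constants of \<phi>,
    \<open>f\<close> and the Nystrom term.\<close>
  have "\<bar>?w t - Qn n p ?w t\<bar> \<le> (3 * \<Lambda>) / real n"
  proof (rule minus_Qn_bound_lipschitz[OF n p t])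
    fix t t' :: real assume t: "t \<in> {0..1}" "t' \<in> {0..1}"
    have "\<bar>Km \<kappa> (n * p) (Qn n p y) t - Km \<kappa> (n * p) (Qn n p y) t'\<bar> \<le> \<Lambda> * \<bar>t - t'\<bar>"
      by (rule Km_lip[OF m t]) (rule Qn_near_R[OF y])
    then show "\<bar>?w t - ?w t'\<bar> \<le> 3 * \<Lambda> * \<bar>t - t'\<bar>"
      using phi_lip[of t t'] f_lip[OF t] by linarith
  qed (use Lam in auto)
  with 1 show 2: "\<bar>Zop y t - \<phi> t\<bar> \<le> e + 3 * \<Lambda> / real n"
    unfolding Zop_minus_phi by linarith
  then show "\<bar>Zop y t\<bar> \<le> R" using Lam_n phi_bound[of t] y unfolding near_def by linarith
qed

text \<open>The difference is \<open>Qn (y - y')\<close> plus \<open>I - Qn\<close> applied to a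
  Nystrom difference of Lipschitz constant \<open>\<Lambda> * a\<close>, which gains
  \<open>1 / real n\<close>. For the factor 2, \<open>\<Lambda> / real n \<le> 1\<close> is
  enough.\<close>

lemma Zop_diff:
  assumes y: "near e y" "near e' y'" and a: "\<And>t. t \<in> {0..1} \<Longrightarrow> \<bar>y t - y' t\<bar> \<le> a" and t: "t \<in> {0..1}"
  shows "\<bar>Zop y t - Zop y' t - Qn n p (\<lambda>t. y t - y' t) t\<bar> \<le> \<Lambda> * a / real n" (is ?A)
    and "\<bar>Zop y t - Zop y' t\<bar> \<le> 2 * a" (is ?B)
proof -
  have a0: "a \<ge> 0" using a[OF t] by linarith
  let ?w = "\<lambda>t. Km \<kappa> (n * p) (Qn n p y) t - Km \<kappa> (n * p) (Qn n p y') t"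
  have qa: "\<bar>Qn n p y t - Qn n p y' t\<bar> \<le> a" if "t \<in> {0..1}" for t
    unfolding Qn_diff[symmetric] by (rule Qn_bound[OF n p that a])
  have "\<bar>?w t - Qn n p ?w t\<bar> \<le> (\<Lambda> * a) / real n"
    by (rule minus_Qn_bound_lipschitz[OF n p t])
      (use Km_diff_lip[OF m _ _ Qn_near_R[OF y(1)] Qn_near_R[OF y(2)] qa] Lam a0 in auto)
  moreover have "Zop y t - Zop y' t - Qn n p (\<lambda>t. y t - y' t) t = ?w t - Qn n p ?w t"
    by (simp add: Zop_def Qn_add Qn_diff)
  ultimately show A: ?A by simp
  have "\<bar>Qn n p (\<lambda>t. y t - y' t) t\<bar> \<le> a" using qa[OF t] by (simp add: Qn_diff)
  moreover have "\<Lambda> * a / real n \<le> 1 * a"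
    using mult_right_mono[OF order_trans[OF Lam_n, of 1] a0] by simp
  ultimately show ?B using A by linarith
qed

lemma Gop_diff:
  assumes y: "near e y" "near e' y'" and a: "\<And>t. t \<in> {0..1} \<Longrightarrow> \<bar>y t - y' t\<bar> \<le> a"
  shows "s \<in> {0..1} \<Longrightarrow> \<bar>Gop y s - Gop y' s\<bar> \<le> 2 * \<Lambda> * a"
    and "s \<in> {0..1} \<Longrightarrow> s' \<in> {0..1} \<Longrightarrow> \<bar>(Gop y s - Gop y' s) - (Gop y s' - Gop y' s')\<bar> \<le> 2 * \<Lambda> * a * \<bar>s - s'\<bar>"
  using Km_diff_bound[OF m _ Zop_near(2)[OF y(1)] Zop_near(2)[OF y(2)] Zop_diff(2)[OF y a], of s]
    Km_diff_lip[OF m _ _ Zop_near(2)[OF y(1)] Zop_near(2)[OF y(2)] Zop_diff(2)[OF y a], of s s']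
  by (auto simp: Gop_def algebra_simps)

lemma Gop_lip:
  assumes y: "near e y" and s: "s \<in> {0..1}" "s' \<in> {0..1}"
  shows "\<bar>Gop y s - Gop y s'\<bar> \<le> 2 * \<Lambda> * \<bar>s - s'\<bar>"
proof -
  have "\<bar>Km \<kappa> (n * p) (Zop y) s - Km \<kappa> (n * p) (Zop y) s'\<bar> \<le> \<Lambda> * \<bar>s - s'\<bar>"
    by (rule Km_lip[OF m s]) (rule Zop_near(2)[OF y])
  then show ?thesis using f_lip[OF s] unfolding Gop_def by linarith
qed

text \<open>Three errors add up: linearizing the kernel at \<phi>, replacing
  \<open>Zop y - Zop y'\<close> by \<open>y - y'\<close>, and quadrature. The slope bound
  \<open>b\<close> enters through the last two, since \<open>I - Qn\<close> and the quadrature error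
  are small only on functions of controlled slope.\<close>

lemma Gop_linearization:
  assumes y: "near e y" "near e' y'" and a: "\<And>t. t \<in> {0..1} \<Longrightarrow> \<bar>y t - y' t\<bar> \<le> a"
    and b: "\<And>t t'. t \<in> {0..1} \<Longrightarrow> t' \<in> {0..1} \<Longrightarrow> \<bar>(y t - y' t) - (y t' - y' t')\<bar> \<le> b * \<bar>t - t'\<bar>"
    and b0: "b \<ge> 0" and s: "s \<in> {0..1}"
  shows "\<bar>Gop y s - Gop y' s - lin_op (\<lambda>t. y t - y' t) s\<bar>
    \<le> 20 * \<Lambda>\<^sup>2 * ((e + e' + 1 / real n) * a + 1 / real n * b)"
proof -
  define h where "h = 1 / real n"
  have h: "h > 0" using n by (simp add: h_def)
  define d where "d t = y t - y' t" for t
  define E where "E t = ell s t (\<phi> t)" for t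
  have a0: "a \<ge> 0" using a[of 0] by simp
  have e0: "e \<ge> 0" "e' \<ge> 0" using y unfolding near_def by (smt (verit) atLeastAtMost_iff)+
  have Eb: "\<bar>E t\<bar> \<le> \<Lambda>" if "t \<in> {0..1}" for t using ell_bound[OF s that phi_R] by (simp add: E_def)
  have El: "\<bar>E t - E t'\<bar> \<le> \<Lambda> * (1 + \<Lambda>) * \<bar>t - t'\<bar>" if "t \<in> {0..1}" "t' \<in> {0..1}" for t t'
  proof -
    have "\<bar>E t - E t'\<bar> \<le> \<Lambda> * (\<bar>t - t'\<bar> + \<bar>\<phi> t - \<phi> t'\<bar>)"
      using ell_lip[OF s that(1) s that(2) phi_R phi_R] by (simp add: E_def)
    also have "\<dots> \<le> \<Lambda> * (\<bar>t - t'\<bar> + \<Lambda> * \<bar>t - t'\<bar>)"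
      using phi_lip[of t t'] Lam by (intro mult_left_mono) auto
    finally show ?thesis by (simp add: algebra_simps)
  qed
  have 1: "\<bar>quad (n * p) (\<lambda>t. \<kappa> s t (Zop y t) - \<kappa> s t (Zop y' t) - E t * (Zop y t - Zop y' t))\<bar>
      \<le> \<Lambda> * (e + e' + 6 * \<Lambda> * h) * (2 * a)"
    using m
  proof (rule quad_bound)
    fix t :: real assume t: "t \<in> {0..1}"
    have "\<bar>\<kappa> s t (Zop y t) - \<kappa> s t (Zop y' t) - E t * (Zop y t - Zop y' t)\<bar>
        \<le> \<Lambda> * (\<bar>Zop y t - \<phi> t\<bar> + \<bar>Zop y' t - \<phi> t\<bar>) * \<bar>Zop y t - Zop y' t\<bar>"
      unfolding E_def using kernel_linearization[OF s t Zop_near(2)[OF y(1) t] Zop_near(2)[OF y(2) t] phi_R] .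
    also have "\<dots> \<le> \<Lambda> * (e + e' + 6 * \<Lambda> * h) * (2 * a)"
      using Zop_near(1)[OF y(1) t] Zop_near(1)[OF y(2) t] Zop_diff(2)[OF y a t] Lam e0 h
      by (intro mult_mono mult_nonneg_nonneg) (auto simp: h_def)
    finally show "\<bar>\<kappa> s t (Zop y t) - \<kappa> s t (Zop y' t) - E t * (Zop y t - Zop y' t)\<bar> \<le> \<Lambda> * (e + e' + 6 * \<Lambda> * h) * (2 * a)" .
  qed
  have 2: "\<bar>quad (n * p) (\<lambda>t. E t * (Zop y t - Zop y' t - d t))\<bar> \<le> \<Lambda> * ((\<Lambda> * a + b) * h)"
    using m
  proof (rule quad_bound)
    fix t :: real assume t: "t \<in> {0..1}"
    have "\<bar>d t - Qn n p d t\<bar> \<le> b / real n"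
      by (rule minus_Qn_bound_lipschitz[OF n p t b0]) (use b in \<open>auto simp: d_def\<close>)
    then have "\<bar>Zop y t - Zop y' t - d t\<bar> \<le> (\<Lambda> * a + b) * h"
      using Zop_diff(1)[OF y a t] unfolding d_def[symmetric] h_def by (simp add: field_simps add_divide_distrib)
    then show "\<bar>E t * (Zop y t - Zop y' t - d t)\<bar> \<le> \<Lambda> * ((\<Lambda> * a + b) * h)"
      unfolding abs_mult using Eb[OF t] Lam by (intro mult_mono) auto
  qed
  have dc: "continuous_on {0..1} d"
    by (rule lipschitz_on_continuous_on[where L = b], rule lipschitz_onI)
      (use b b0 in \<open>auto simp: d_def dist_real_def\<close>)
  have "\<bar>integral {0..1} (\<lambda>t. E t * d t) - quad (n * p) (\<lambda>t. E t * d t)\<bar> \<le> (\<Lambda> * (1 + \<Lambda>) * a + \<Lambda> * b) / real (n * p)"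
  proof (rule quad_error_lipschitz[OF m])
    show "continuous_on {0..1} (\<lambda>t. E t * d t)"
      unfolding E_def
      by (intro continuous_intros dc continuous_on_kernel(2)) (use s in auto)
    show "0 \<le> \<Lambda> * (1 + \<Lambda>) * a + \<Lambda> * b" using Lam a0 b0 by auto
    fix t t' :: real assume t: "t \<in> {0..1}" "t' \<in> {0..1}"
    have "E t * d t - E t' * d t' = (E t - E t') * d t + E t' * (d t - d t')" by (simp add: algebra_simps)
    also have "\<bar>\<dots>\<bar> \<le> \<bar>E t - E t'\<bar> * \<bar>d t\<bar> + \<bar>E t'\<bar> * \<bar>d t - d t'\<bar>"
      by (metis abs_mult abs_triangle_ineq)
    also have "\<dots> \<le> (\<Lambda> * (1 + \<Lambda>) * \<bar>t - t'\<bar>) * a + \<Lambda> * (b * \<bar>t - t'\<bar>)"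
      using El[OF t] Eb[OF t(2)] a[OF t(1)] b[OF t] Lam by (intro add_mono mult_mono) (auto simp: d_def)
    finally show "\<bar>E t * d t - E t' * d t'\<bar> \<le> (\<Lambda> * (1 + \<Lambda>) * a + \<Lambda> * b) * \<bar>t - t'\<bar>" by (simp add: algebra_simps)
  qed
  \<comment> \<open>The coarse mesh width dominates the fine one, which makes the bound independent
    of \<open>p\<close>.\<close>
  also have "\<dots> \<le> (\<Lambda> * (1 + \<Lambda>) * a + \<Lambda> * b) / real n"
    using n p Lam a0 b0 by (intro divide_left_mono) auto
  finally have 3: "\<bar>integral {0..1} (\<lambda>t. E t * d t) - quad (n * p) (\<lambda>t. E t * d t)\<bar> \<le> (\<Lambda> * (1 + \<Lambda>) * a + \<Lambda> * b) * h"
    by (simp add: h_def)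
  have "Gop y s - Gop y' s = quad (n * p) (\<lambda>t. \<kappa> s t (Zop y t) - \<kappa> s t (Zop y' t))"
    by (simp add: Gop_def Km_eq_quad quad_diff)
  also have "\<dots> = quad (n * p) (\<lambda>t. (\<kappa> s t (Zop y t) - \<kappa> s t (Zop y' t) - E t * (Zop y t - Zop y' t))
      + E t * (Zop y t - Zop y' t - d t) + E t * d t)"
    by (simp add: algebra_simps)
  also have "\<dots> = quad (n * p) (\<lambda>t. \<kappa> s t (Zop y t) - \<kappa> s t (Zop y' t) - E t * (Zop y t - Zop y' t))
      + quad (n * p) (\<lambda>t. E t * (Zop y t - Zop y' t - d t)) + quad (n * p) (\<lambda>t. E t * d t)"
    by (simp only: quad_add)
  finally have "\<bar>Gop y s - Gop y' s - lin_op d s\<bar>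
      \<le> \<Lambda> * (e + e' + 6 * \<Lambda> * h) * (2 * a) + \<Lambda> * ((\<Lambda> * a + b) * h) + (\<Lambda> * (1 + \<Lambda>) * a + \<Lambda> * b) * h"
    using 1 2 3 unfolding lin_op_def E_def[symmetric] by linarith
  \<comment> \<open>The coefficient of \<open>h * a\<close> collects
    \<open>12 * \<Lambda>\<^sup>2\<close> from linearization, \<open>\<Lambda>\<^sup>2\<close> from
    the replacement and \<open>\<Lambda> + \<Lambda>\<^sup>2\<close> from quadrature.\<close>
  also have "\<dots> = 2 * \<Lambda> * ((e + e') * a) + (\<Lambda> + 14 * \<Lambda>\<^sup>2) * (h * a) + 2 * \<Lambda> * (h * b)"
    by (simp add: power2_eq_square algebra_simps)
  also have "\<dots> \<le> 20 * \<Lambda>\<^sup>2 * ((e + e') * a) + 20 * \<Lambda>\<^sup>2 * (h * a) + 20 * \<Lambda>\<^sup>2 * (h * b)"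
  proof -
    have "\<Lambda> \<le> \<Lambda>\<^sup>2" using Lam1 by (simp add: power2_eq_square)
    then show ?thesis using Lam1 e0 a0 b0 h by (intro add_mono mult_right_mono) auto
  qed
  finally have "\<bar>Gop y s - Gop y' s - lin_op d s\<bar> \<le> 20 * \<Lambda>\<^sup>2 * ((e + e' + h) * a + h * b)"
    by (simp add: algebra_simps)
  then show ?thesis unfolding d_def[abs_def] h_def .
qed

section \<open>Consistency error of the fixed point map at \<phi>\<close>

definition projdiff :: "real \<Rightarrow> real" where
  "projdiff s = Km \<kappa> (n * p) \<phi> s - Km \<kappa> (n * p) (Qn n p \<phi>) s"

lemma near_phi: "near 0 \<phi>"
  by (simp add: near_def)

lemma phi_minus_Qn: "t \<in> {0..1} \<Longrightarrow> \<bar>\<phi> t - Qn n p \<phi> t\<bar> \<le> \<Lambda> / real n"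
  by (rule minus_Qn_bound_lipschitz[OF n p]) (use Lam phi_lip in auto)

text \<open>The factor \<open>1 / n\<^sup>2\<close> is the superconvergence gain: one power of \<open>1 / n\<close> comes from
  \<open>\<phi> - Qn \<phi>\<close>, the other from orthogonality on all cells except the one containing \<open>s\<close> and \<open>s'\<close>,
  where \<open>\<partial>\<kappa>\<^sub>u/\<partial>s\<close> may jump.\<close>

lemma projdiff_cell_lip:
  assumes j: "1 \<le> j" "j \<le> n" and s: "s \<in> closed_cell n j" "s' \<in> closed_cell n j"
  shows "\<bar>projdiff s - projdiff s'\<bar> \<le> 5 * \<Lambda> ^ 3 * \<bar>s - s'\<bar> / (real n)\<^sup>2"
proof -
  define r where "r = \<bar>s - s'\<bar>"
  have r0: "r \<ge> 0" by (simp add: r_def)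
  have s01: "s \<in> {0..1}" "s' \<in> {0..1}" using s closed_cell_subset[OF j] by auto
  let ?\<psi> = "Qn n p \<phi>"
  \<comment> \<open>The \<open>u\<close>-derivative at \<phi> of the kernel difference between
    \<open>s\<close> and \<open>s'\<close>. The increment of \<open>projdiff\<close> is the
    quadrature of \<open>a * (\<phi> - Qn \<phi>)\<close> up to \<open>rem\<close>.\<close>
  define a where "a t = ell s t (\<phi> t) - ell s' t (\<phi> t)" for t
  define rem where "rem t = (\<kappa> s t (?\<psi> t) - \<kappa> s' t (?\<psi> t)) - (\<kappa> s t (\<phi> t) - \<kappa> s' t (\<phi> t)) - a t * (?\<psi> t - \<phi> t)" for t
  have remb: "\<bar>quad (n * p) rem\<bar> \<le> \<Lambda> * r * (\<Lambda> / real n)\<^sup>2"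
    using m
  proof (rule quad_bound)
    fix t :: real assume t: "t \<in> {0..1}"
    have "\<bar>rem t\<bar> \<le> \<Lambda> * r * \<bar>?\<psi> t - \<phi> t\<bar>\<^sup>2"
      unfolding rem_def a_def r_def
      by (rule kernel_mixed_linearization[OF s01 t Qn_near_R[OF near_phi t] phi_R])
    also have "\<dots> \<le> \<Lambda> * r * (\<Lambda> / real n)\<^sup>2"
      using phi_minus_Qn[OF t] Lam r0 by (intro mult_left_mono power_mono) auto
    finally show "\<bar>rem t\<bar> \<le> \<Lambda> * r * (\<Lambda> / real n)\<^sup>2" .
  qed
  \<comment> \<open>Bound for the oscillation of \<open>a\<close> on cell \<open>i\<close>. Cell
    \<open>j\<close>, containing \<open>s\<close> and \<open>s'\<close>, gets no factor
    \<open>1 / real n\<close>, but it is one cell out of \<open>n\<close>, so averaging supplies the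
    factor.\<close>
  define \<alpha> where "\<alpha> i = \<Lambda> * r * ((1 + \<Lambda>) / real n) + (if i = j then 2 * \<Lambda> * r else 0)" for i
  have main: "\<bar>quad (n * p) (\<lambda>t. a t * (\<phi> t - ?\<psi> t))\<bar> \<le> (1 / real n) * (\<Sum>i=1..n. \<alpha> i * (\<Lambda> / real n))"
  proof -
    have "\<bar>cell_avg n p i (\<lambda>t. a t * (\<phi> t - ?\<psi> t))\<bar> \<le> \<alpha> i * (\<Lambda> / real n)" if i: "i \<in> {1..n}" for i
    proof (rule cell_avg_orthogonal_bound[OF n _ p])
      show "1 \<le> i" using i by simp
      have sub: "open_cell n i \<subseteq> {0..1}"
        using open_cell_subset[of n i] closed_cell_subset[of i n] i by auto
      show "\<bar>\<phi> t - ?\<psi> t\<bar> \<le> \<Lambda> / real n" if "t \<in> open_cell n i" for t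
        using phi_minus_Qn sub that by auto
      fix t t' assume t: "t \<in> open_cell n i" "t' \<in> open_cell n i"
      have t01: "t \<in> {0..1}" "t' \<in> {0..1}" using t sub by auto
      show "\<bar>a t - a t'\<bar> \<le> \<alpha> i"
      proof (cases "i = j")
        case True
        have "\<bar>a t\<bar> \<le> \<Lambda> * r" "\<bar>a t'\<bar> \<le> \<Lambda> * r"
          using ell_lip[OF s01(1) t01(1) s01(2) t01(1) phi_R phi_R, of t t] ell_lip[OF s01(1) t01(2) s01(2) t01(2) phi_R phi_R, of t' t']
          by (auto simp: a_def r_def)
        moreover have "0 \<le> \<Lambda> * r * ((1 + \<Lambda>) / real n)" using Lam r0 by auto
        ultimately show ?thesis using True by (simp add: \<alpha>_def)
      next
        case False
        \<comment> \<open>Cells \<open>i\<close> and \<open>j\<close> are ordered one after the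
          other, so the rectangle does not cross the diagonal.\<close>
        have "max t t' \<le> min s s' \<or> max s s' \<le> min t t'"
        proof (cases "i < j")
          case True
          then have "real i \<le> real j - 1" by linarith
          then have "real i / real n \<le> (real j - 1) / real n" by (simp add: divide_right_mono)
          then show ?thesis using t s by (auto simp: open_cell_def closed_cell_def)
        next
          case nless: False
          then have "real j \<le> real i - 1" using False by linarith
          then have "real j / real n \<le> (real i - 1) / real n" by (simp add: divide_right_mono)
          then show ?thesis using t s by (auto simp: open_cell_def closed_cell_def)
        qed
        then have "\<bar>a t - a t'\<bar> \<le> \<Lambda> * r * (\<bar>t - t'\<bar> + \<bar>\<phi> t - \<phi> t'\<bar>)"
          using ell_mixed[OF s01(1) t01(1) s01(2) t01(2) phi_R phi_R, of t t'] by (simp add: a_def r_def algebra_simps)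
        also have "\<dots> \<le> \<Lambda> * r * (1 / real n + \<Lambda> * (1 / real n))"
        proof (intro mult_left_mono add_mono)
          show tt: "\<bar>t - t'\<bar> \<le> 1 / real n"
            using closed_cell_dist[OF n] t open_cell_subset[of n i] by blast
          have "\<bar>\<phi> t - \<phi> t'\<bar> \<le> \<Lambda> * \<bar>t - t'\<bar>" by (rule phi_lip)
          also have "\<dots> \<le> \<Lambda> * (1 / real n)" using tt Lam by (intro mult_left_mono) auto
          finally show "\<bar>\<phi> t - \<phi> t'\<bar> \<le> \<Lambda> * (1 / real n)" .
        qed (use Lam r0 in auto)
        finally show ?thesis using False by (simp add: \<alpha>_def add_divide_distrib)
      qed
    qed
    then have "\<bar>\<Sum>i=1..n. cell_avg n p i (\<lambda>t. a t * (\<phi> t - ?\<psi> t))\<bar> \<le> (\<Sum>i=1..n. \<alpha> i * (\<Lambda> / real n))"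
      by (rule order_trans[OF sum_abs sum_mono])
    then show ?thesis
      unfolding quad_eq_cell_avgs[OF n p] abs_mult by (intro mult_mono) auto
  qed
  have "(\<Sum>i=1..n. \<alpha> i) = \<Lambda> * r * (1 + \<Lambda>) + 2 * \<Lambda> * r"
    using j n by (simp add: \<alpha>_def sum.distrib sum.delta)
  then have "(1 / real n) * (\<Sum>i=1..n. \<alpha> i * (\<Lambda> / real n)) = (\<Lambda> * r * (1 + \<Lambda>) + 2 * \<Lambda> * r) * \<Lambda> / (real n)\<^sup>2"
    unfolding sum_distrib_right[symmetric] by (simp add: power2_eq_square)
  with main have main': "\<bar>quad (n * p) (\<lambda>t. a t * (\<phi> t - ?\<psi> t))\<bar> \<le> (\<Lambda> * r * (1 + \<Lambda>) + 2 * \<Lambda> * r) * \<Lambda> / (real n)\<^sup>2" by simp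
  have "projdiff s - projdiff s' = quad (n * p) (\<lambda>t. a t * (\<phi> t - ?\<psi> t) - rem t)"
    unfolding projdiff_def Km_eq_quad quad_diff[symmetric]
    by (rule arg_cong[where f = "quad (n * p)"]) (auto simp: rem_def algebra_simps)
  then have "\<bar>projdiff s - projdiff s'\<bar> \<le> \<bar>quad (n * p) (\<lambda>t. a t * (\<phi> t - ?\<psi> t))\<bar> + \<bar>quad (n * p) rem\<bar>"
    unfolding quad_diff by linarith
  also have "\<dots> \<le> (\<Lambda> * r * (1 + \<Lambda>) + 2 * \<Lambda> * r) * \<Lambda> / (real n)\<^sup>2 + \<Lambda> * r * (\<Lambda> / real n)\<^sup>2"
    using main' remb by linarith
  also have "\<dots> = ((3 * \<Lambda>\<^sup>2 + 2 * \<Lambda> ^ 3) * r) / (real n)\<^sup>2"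
    by (simp add: power2_eq_square power3_eq_cube add_divide_distrib[symmetric] algebra_simps)
  also have "\<dots> \<le> (5 * \<Lambda> ^ 3 * r) / (real n)\<^sup>2"
  proof -
    have "\<Lambda>\<^sup>2 \<le> \<Lambda> ^ 3" using Lam1 by (simp add: power_increasing)
    then show ?thesis using r0 by (intro divide_right_mono mult_right_mono) auto
  qed
  finally show ?thesis by (simp add: r_def)
qed

lemma projdiff_minus_Qn:
  assumes t: "t \<in> {0..1}"
  shows "\<bar>projdiff t - Qn n p projdiff t\<bar> \<le> 5 * \<Lambda> ^ 3 / real n ^ 3"
proof (rule minus_Qn_bound[OF n p t])
  fix t' assume t': "t' \<in> closed_cell n (cell n t)"
  note c = cell_bounds[OF n t]
  have "\<bar>projdiff t - projdiff t'\<bar> \<le> 5 * \<Lambda> ^ 3 * \<bar>t - t'\<bar> / (real n)\<^sup>2"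
    by (rule projdiff_cell_lip[OF c t'])
  also have "\<dots> \<le> 5 * \<Lambda> ^ 3 * (1 / real n) / (real n)\<^sup>2"
    using closed_cell_dist[OF n c(3) t'] Lam by (intro divide_right_mono mult_left_mono) auto
  finally show "\<bar>projdiff t - projdiff t'\<bar> \<le> 5 * \<Lambda> ^ 3 / real n ^ 3"
    by (simp add: power2_eq_square power3_eq_cube)
qed

text \<open>\<open>Gop \<phi> - \<phi>\<close> is \<open>- e1\<close> plus a Nystrom difference
  between \<open>Zop \<phi>\<close> and \<phi>. Linearized, the latter has an \<open>e1\<close>
  part, already of the right order, and a \<open>projdiff\<close> part of order
  \<open>h ^ 3\<close>, which orthogonality raises to the fourth power.\<close>

lemma Gop_consistent:
  assumes s: "s \<in> {0..1}"
  shows "\<bar>Gop \<phi> s - \<phi> s\<bar> \<le> consist_const * max ((1 / real (n * p))\<^sup>2) ((1 / real n) ^ 4)"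
proof -
  define \<mu> where "\<mu> = max ((1 / real (n * p))\<^sup>2) ((1 / real n) ^ 4)"
  define hm where "hm = 1 / real (n * p)"
  define h where "h = 1 / real n"
  have h: "0 < h" "h \<le> 1" and hm: "0 < hm" "hm \<le> 1" using n p m by (auto simp: h_def hm_def simp flip: of_nat_mult)
  have \<mu>: "hm\<^sup>2 \<le> \<mu>" "h ^ 4 \<le> \<mu>" "0 \<le> \<mu>" by (auto simp: \<mu>_def hm_def h_def le_max_iff_disj)
  define e1 where "e1 s = (\<phi> s - f s) - Km \<kappa> (n * p) \<phi> s" for s
  have e1: "\<bar>e1 t\<bar> \<le> quad_const * hm\<^sup>2" if "t \<in> {0..1}" for t
    using quad_error_phi[OF m that] by (simp add: e1_def hm_def)
  define D1 where "D1 t = e1 t - Qn n p e1 t" for t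
  define D2 where "D2 t = projdiff t - Qn n p projdiff t" for t
  have D1: "\<bar>D1 t\<bar> \<le> 2 * quad_const * hm\<^sup>2" if "t \<in> {0..1}" for t
  proof -
    have "\<bar>Qn n p e1 t\<bar> \<le> quad_const * hm\<^sup>2" by (rule Qn_bound[OF n p that]) (rule e1)
    then show ?thesis using e1[OF that] unfolding D1_def by linarith
  qed
  have D2: "\<bar>D2 t\<bar> \<le> 5 * \<Lambda> ^ 3 * h ^ 3" if "t \<in> {0..1}" for t
    using projdiff_minus_Qn[OF that] by (simp add: D2_def h_def power_divide)
  have Z: "Zop \<phi> t - \<phi> t = - D1 t - D2 t" for t
  proof -
    have w: "\<phi> t - f t - Km \<kappa> (n * p) (Qn n p \<phi>) t = e1 t + projdiff t" for t
      by (simp add: e1_def projdiff_def)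
    have z: "Qn n p (\<lambda>t. 0) t = 0" using p by (simp add: Qn_eq_cell_avg cell_avg_const)
    show ?thesis unfolding Zop_minus_phi w by (simp add: Qn_add z D1_def D2_def)
  qed
  define \<delta> where "\<delta> = 2 * quad_const * hm\<^sup>2 + 5 * \<Lambda> ^ 3 * h ^ 3"
  have Zb: "\<bar>Zop \<phi> t - \<phi> t\<bar> \<le> \<delta>" if "t \<in> {0..1}" for t
    using D1[OF that] D2[OF that] unfolding Z \<delta>_def by linarith
  define E where "E t = ell s t (\<phi> t)" for t
  have Eb: "\<bar>E t\<bar> \<le> \<Lambda>" if "t \<in> {0..1}" for t using ell_bound[OF s that phi_R] by (simp add: E_def)
  have "\<bar>quad (n * p) (\<lambda>t. \<kappa> s t (Zop \<phi> t) - \<kappa> s t (\<phi> t) - E t * (Zop \<phi> t - \<phi> t))\<bar> \<le> \<Lambda> * \<delta>\<^sup>2"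
    using m
  proof (rule quad_bound)
    fix t :: real assume t: "t \<in> {0..1}"
    have "\<bar>\<kappa> s t (Zop \<phi> t) - \<kappa> s t (\<phi> t) - E t * (Zop \<phi> t - \<phi> t)\<bar> \<le> \<Lambda> * \<bar>Zop \<phi> t - \<phi> t\<bar> * \<bar>Zop \<phi> t - \<phi> t\<bar>"
      using kernel_linearization[OF s t Zop_near(2)[OF near_phi t] phi_R phi_R, of t t] by (simp add: E_def)
    also have "\<dots> \<le> \<Lambda> * \<delta> * \<delta>" using Zb[OF t] Lam by (intro mult_mono) auto
    finally show "\<bar>\<kappa> s t (Zop \<phi> t) - \<kappa> s t (\<phi> t) - E t * (Zop \<phi> t - \<phi> t)\<bar> \<le> \<Lambda> * \<delta>\<^sup>2"
      by (simp add: power2_eq_square mult.assoc)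
  qed
  also have "\<Lambda> * \<delta>\<^sup>2 \<le> \<Lambda> * ((8 * quad_const\<^sup>2 + 50 * \<Lambda> ^ 6) * \<mu>)"
  proof (rule mult_left_mono[OF _ Lam])
    \<comment> \<open>As \<open>hm\<close> and \<open>h\<close> are at most 1, the squares
      \<open>hm ^ 4\<close> and \<open>h ^ 6\<close> are absorbed by \<open>hm\<^sup>2\<close> and
      \<open>h ^ 4\<close>.\<close>
    have "\<delta>\<^sup>2 \<le> 2 * (2 * quad_const * hm\<^sup>2)\<^sup>2 + 2 * (5 * \<Lambda> ^ 3 * h ^ 3)\<^sup>2"
      unfolding \<delta>_def using sum_squares_bound[of "2 * quad_const * hm\<^sup>2" "5 * \<Lambda> ^ 3 * h ^ 3"]
      by (simp add: power2_sum)
    also have "\<dots> = 8 * quad_const\<^sup>2 * (hm\<^sup>2 * hm\<^sup>2) + 50 * \<Lambda> ^ 6 * (h ^ 4 * h\<^sup>2)"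
      by (simp add: numeral_eq_Suc algebra_simps)
    also have "\<dots> \<le> 8 * quad_const\<^sup>2 * \<mu> + 50 * \<Lambda> ^ 6 * \<mu>"
    proof (intro add_mono mult_left_mono)
      have "hm\<^sup>2 * hm\<^sup>2 \<le> hm\<^sup>2 * 1" using hm by (intro mult_left_mono) (auto simp: power_le_one)
      then show "hm\<^sup>2 * hm\<^sup>2 \<le> \<mu>" using \<mu> by simp
      have "h ^ 4 * h\<^sup>2 \<le> h ^ 4 * 1" using h by (intro mult_left_mono) (auto simp: power_le_one)
      then show "h ^ 4 * h\<^sup>2 \<le> \<mu>" using \<mu> by simp
    qed auto
    finally show "\<delta>\<^sup>2 \<le> (8 * quad_const\<^sup>2 + 50 * \<Lambda> ^ 6) * \<mu>" by (simp add: algebra_simps)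
  qed
  finally have 1: "\<bar>quad (n * p) (\<lambda>t. \<kappa> s t (Zop \<phi> t) - \<kappa> s t (\<phi> t) - E t * (Zop \<phi> t - \<phi> t))\<bar>
      \<le> \<Lambda> * ((8 * quad_const\<^sup>2 + 50 * \<Lambda> ^ 6) * \<mu>)" .
  have "\<bar>quad (n * p) (\<lambda>t. E t * D1 t)\<bar> \<le> \<Lambda> * (2 * quad_const * hm\<^sup>2)"
    using m
  proof (rule quad_bound)
    fix t :: real assume t: "t \<in> {0..1}"
    show "\<bar>E t * D1 t\<bar> \<le> \<Lambda> * (2 * quad_const * hm\<^sup>2)"
      unfolding abs_mult using Eb[OF t] D1[OF t] Lam by (intro mult_mono) auto
  qed
  also have "\<dots> \<le> \<Lambda> * (2 * quad_const * \<mu>)"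
    using \<mu> Lam quad_const_nonneg by (intro mult_left_mono) auto
  finally have 2: "\<bar>quad (n * p) (\<lambda>t. E t * D1 t)\<bar> \<le> \<Lambda> * (2 * quad_const * \<mu>)" .
  \<comment> \<open>\<open>D2\<close> averages to zero on each coarse cell, so \<open>E\<close>
    counts only through its oscillation of order \<open>h\<close>.\<close>
  have "\<bar>quad (n * p) (\<lambda>t. E t * D2 t)\<bar> \<le> (1 / real n) * (\<Sum>i=1..n. (\<Lambda> * (1 + \<Lambda>) * h) * (5 * \<Lambda> ^ 3 * h ^ 3))"
  proof -
    have "\<bar>cell_avg n p i (\<lambda>t. E t * D2 t)\<bar> \<le> (\<Lambda> * (1 + \<Lambda>) * h) * (5 * \<Lambda> ^ 3 * h ^ 3)" if i: "i \<in> {1..n}" for i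
      unfolding D2_def
    proof (rule cell_avg_orthogonal_bound[OF n _ p])
      show "1 \<le> i" using i by simp
      have sub: "open_cell n i \<subseteq> {0..1}"
        using open_cell_subset[of n i] closed_cell_subset[of i n] i by auto
      show "\<bar>projdiff t - Qn n p projdiff t\<bar> \<le> 5 * \<Lambda> ^ 3 * h ^ 3" if "t \<in> open_cell n i" for t
        using D2 sub that by (auto simp: D2_def)
      fix t t' assume t: "t \<in> open_cell n i" "t' \<in> open_cell n i"
      have t01: "t \<in> {0..1}" "t' \<in> {0..1}" using t sub by auto
      have tt: "\<bar>t - t'\<bar> \<le> h"
        using closed_cell_dist[OF n] t open_cell_subset[of n i] unfolding h_def by blast
      have "\<bar>E t - E t'\<bar> \<le> \<Lambda> * (\<bar>t - t'\<bar> + \<bar>\<phi> t - \<phi> t'\<bar>)"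
        using ell_lip[OF s t01(1) s t01(2) phi_R phi_R] by (simp add: E_def)
      also have "\<dots> \<le> \<Lambda> * (\<bar>t - t'\<bar> + \<Lambda> * \<bar>t - t'\<bar>)"
        using phi_lip[of t t'] Lam by (intro mult_left_mono) auto
      also have "\<dots> \<le> \<Lambda> * (h + \<Lambda> * h)"
        using tt Lam by (intro mult_left_mono add_mono) auto
      finally show "\<bar>E t - E t'\<bar> \<le> \<Lambda> * (1 + \<Lambda>) * h" by (simp add: algebra_simps)
    qed
    then have "\<bar>\<Sum>i=1..n. cell_avg n p i (\<lambda>t. E t * D2 t)\<bar> \<le> (\<Sum>i=1..n. (\<Lambda> * (1 + \<Lambda>) * h) * (5 * \<Lambda> ^ 3 * h ^ 3))"
      by (rule order_trans[OF sum_abs sum_mono])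
    then show ?thesis
      unfolding quad_eq_cell_avgs[OF n p] abs_mult by (intro mult_mono) auto
  qed
  also have "\<dots> = (5 * \<Lambda> ^ 4 + 5 * \<Lambda> ^ 5) * h ^ 4"
    using n by (simp add: power_add[symmetric] algebra_simps numeral_eq_Suc)
  also have "\<dots> \<le> 10 * \<Lambda> ^ 5 * \<mu>"
  proof -
    have "\<Lambda> ^ 4 \<le> \<Lambda> ^ 5" using Lam1 by (simp add: power_increasing)
    then show ?thesis using \<mu> Lam h by (intro mult_mono) auto
  qed
  finally have 3: "\<bar>quad (n * p) (\<lambda>t. E t * D2 t)\<bar> \<le> 10 * \<Lambda> ^ 5 * \<mu>" .
  have "Gop \<phi> s - \<phi> s + e1 s = quad (n * p) (\<lambda>t. \<kappa> s t (Zop \<phi> t) - \<kappa> s t (\<phi> t))"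
    by (simp add: Gop_def e1_def Km_eq_quad quad_diff)
  also have "\<dots> = quad (n * p) (\<lambda>t. (\<kappa> s t (Zop \<phi> t) - \<kappa> s t (\<phi> t) - E t * (Zop \<phi> t - \<phi> t)) - E t * D1 t - E t * D2 t)"
    unfolding Z by (simp add: algebra_simps)
  also have "\<dots> = quad (n * p) (\<lambda>t. \<kappa> s t (Zop \<phi> t) - \<kappa> s t (\<phi> t) - E t * (Zop \<phi> t - \<phi> t))
      - quad (n * p) (\<lambda>t. E t * D1 t) - quad (n * p) (\<lambda>t. E t * D2 t)"
    by (simp only: quad_diff)
  finally have "\<bar>Gop \<phi> s - \<phi> s\<bar> \<le> quad_const * hm\<^sup>2 + \<Lambda> * ((8 * quad_const\<^sup>2 + 50 * \<Lambda> ^ 6) * \<mu>)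
      + \<Lambda> * (2 * quad_const * \<mu>) + 10 * \<Lambda> ^ 5 * \<mu>"
    using 1 2 3 e1[OF s] by linarith
  also have "quad_const * hm\<^sup>2 \<le> quad_const * \<mu>"
    using \<mu> quad_const_nonneg by (intro mult_left_mono) auto
  finally show ?thesis unfolding \<mu>_def[symmetric] consist_const_def by (simp add: algebra_simps)
qed

end

section \<open>The operators on bounded continuous functions\<close>

instance bcontfun :: (metric_space, banach) banach ..

text \<open>Models continuous functions on the unit interval inside the Banach space of bounded
  continuous functions on the line. The value is meaningful for \<open>g\<close> continuous on
  \<open>{0..1}\<close>.\<close>

definition ext01 :: "(real \<Rightarrow> real) \<Rightarrow> real \<Rightarrow>\<^sub>C real" where
  "ext01 g = Bcontfun (\<lambda>s. g (clamp01 s))"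

lemma continuous_on_clamp01: "continuous_on S clamp01"
  unfolding clamp01_def by (intro continuous_intros)

lemma ext01_apply:
  assumes g: "continuous_on {0..1} g"
  shows "ext01 g s = g (clamp01 s)"
proof -
  have "continuous_on UNIV (\<lambda>s. g (clamp01 s))"
    by (rule continuous_on_compose2[OF g continuous_on_clamp01]) auto
  moreover have "bounded (range (\<lambda>s. g (clamp01 s)))"
    using compact_imp_bounded[OF compact_continuous_image[OF g]]
    by (rule bounded_subset) auto
  ultimately have "(\<lambda>s. g (clamp01 s)) \<in> bcontfun" by (simp add: bcontfun_def)
  then show ?thesis by (simp add: ext01_def Bcontfun_inverse)
qed

text \<open>The instance of the predicate \<open>P\<close> of
  \<open>perturbed_fixed_point\<close>.\<close>

definition lip_const :: "real \<Rightarrow> (real \<Rightarrow>\<^sub>C real) \<Rightarrow> bool" where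
  "lip_const b x \<longleftrightarrow> (\<forall>s t. \<bar>x s - x t\<bar> \<le> b * \<bar>s - t\<bar>)"

lemma lip_const_add: "lip_const b x \<Longrightarrow> lip_const c y \<Longrightarrow> lip_const (b + c) (x + y)"
  unfolding lip_const_def
proof (intro allI)
  fix s t
  assume "\<forall>s t. \<bar>x s - x t\<bar> \<le> b * \<bar>s - t\<bar>" "\<forall>s t. \<bar>y s - y t\<bar> \<le> c * \<bar>s - t\<bar>"
  then have "\<bar>x s - x t\<bar> \<le> b * \<bar>s - t\<bar>" "\<bar>y s - y t\<bar> \<le> c * \<bar>s - t\<bar>" by blast+
  then show "\<bar>(x + y) s - (x + y) t\<bar> \<le> (b + c) * \<bar>s - t\<bar>" by (simp add: distrib_right)
qed

lemma lip_const_minus: "lip_const b x \<Longrightarrow> lip_const b (- x)"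
  by (simp add: lip_const_def abs_minus_commute)

lemma lip_const_mono: "lip_const b x \<Longrightarrow> b \<le> c \<Longrightarrow> lip_const c x"
  unfolding lip_const_def by (meson abs_ge_zero mult_right_mono order_trans)

lemma lip_const_nonneg: "lip_const b x \<Longrightarrow> b \<ge> 0"
  unfolding lip_const_def by (metis abs_ge_zero abs_one diff_zero mult.right_neutral order_trans)

lemma bounded_linear_eval_bcontfun: "bounded_linear (\<lambda>x::real \<Rightarrow>\<^sub>C real. x s)"
proof (rule bounded_linear_intro[where K = 1])
  show "norm (x s) \<le> norm x * 1" for x :: "real \<Rightarrow>\<^sub>C real" using norm_bounded[of x s] by simp
qed auto

lemma closed_lip_const: "closed {x. lip_const b x}"
proof -
  have "continuous_on UNIV (\<lambda>x::real \<Rightarrow>\<^sub>C real. x s)" for s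
    by (rule linear_continuous_on[OF bounded_linear_eval_bcontfun])
  then show ?thesis unfolding lip_const_def
    by (intro closed_Collect_all closed_Collect_le continuous_intros)
qed

lemma lip_constI_ext01:
  fixes x :: "real \<Rightarrow>\<^sub>C real"
  assumes x: "\<And>s. x s = g (clamp01 s)"
    and g: "\<And>s t. s \<in> {0..1} \<Longrightarrow> t \<in> {0..1} \<Longrightarrow> \<bar>g s - g t\<bar> \<le> b * \<bar>s - t\<bar>" and b: "b \<ge> 0"
  shows "lip_const b x"
  unfolding lip_const_def
proof (intro allI)
  fix s t
  have "\<bar>x s - x t\<bar> \<le> b * \<bar>clamp01 s - clamp01 t\<bar>" unfolding x by (rule g) auto
  also have "\<dots> \<le> b * \<bar>s - t\<bar>" using b clamp01_dist by (intro mult_left_mono) auto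
  finally show "\<bar>x s - x t\<bar> \<le> b * \<bar>s - t\<bar>" .
qed

lemma lipschitz_imp_continuous_on_unit:
  fixes g :: "real \<Rightarrow> real"
  assumes "\<And>s t. s \<in> {0..1} \<Longrightarrow> t \<in> {0..1} \<Longrightarrow> \<bar>g s - g t\<bar> \<le> b * \<bar>s - t\<bar>"
  shows "continuous_on {0..1} g"
proof -
  have b: "b \<ge> 0" using assms[of 0 1] by simp
  show ?thesis
    by (rule lipschitz_on_continuous_on[where L = b], rule lipschitz_onI)
      (use assms b in \<open>auto simp: dist_real_def\<close>)
qed

text \<open>Arzela-Ascoli on the unit interval. Invariance under \<open>clamp01\<close> turns
  uniform convergence there into convergence in the norm over the whole line.\<close>

lemma seq_compact_map_lipschitz:
  fixes L :: "(real \<Rightarrow>\<^sub>C real) \<Rightarrow> real \<Rightarrow>\<^sub>C real"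
  assumes C: "C \<ge> 0" and norm: "\<And>v. norm (L v) \<le> C * norm v" and lip: "\<And>v. lip_const (C * norm v) (L v)"
    and clamp: "\<And>v s. L v (clamp01 s) = L v s"
  shows "seq_compact_map L"
  unfolding seq_compact_map_def
proof (intro allI impI)
  fix x :: "nat \<Rightarrow> real \<Rightarrow>\<^sub>C real" assume "bounded (range x)"
  then obtain B where B: "\<And>k. norm (x k) \<le> B" unfolding bounded_iff by auto
  define M where "M = C * B + 1"
  have nx: "C * norm (x k) \<le> M" for k
    using mult_left_mono[OF B C, of k] by (simp add: M_def)
  have "0 \<le> B" using B[of 0] norm_ge_zero order_trans by blast
  then have M: "M > 0" using C by (simp add: M_def add_nonneg_pos)
  obtain g r where g: "continuous_on {0..1} g" "strict_mono (r::nat \<Rightarrow> nat)"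
      "\<And>e. 0 < e \<Longrightarrow> \<exists>N. \<forall>k t. k \<ge> N \<and> t \<in> {0..1} \<longrightarrow> norm (L (x (r k)) t - g t) < e"
  proof (rule Arzela_Ascoli[of "{0..1::real}" "\<lambda>k. apply_bcontfun (L (x k))" M])
    show "norm (L (x k) t) \<le> M" for k t
      using norm_bounded[of "L (x k)" t] norm[of "x k"] nx[of k] by linarith
    fix t e :: real assume "0 < e"
    show "\<exists>d>0. \<forall>k y. y \<in> {0..1} \<and> norm (t - y) < d \<longrightarrow> norm (L (x k) t - L (x k) y) < e"
    proof (intro exI[of _ "e / M"] conjI allI impI)
      show "e / M > 0" using M \<open>0 < e\<close> by simp
      fix k y assume y: "y \<in> {0..1} \<and> norm (t - y) < e / M"
      have "\<bar>L (x k) t - L (x k) y\<bar> \<le> M * \<bar>t - y\<bar>"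
        using lip_const_mono[OF lip nx] unfolding lip_const_def by blast
      also have "\<dots> < e" using y M by (simp add: field_simps)
      finally show "norm (L (x k) t - L (x k) y) < e" by simp
    qed
  qed auto
  have "(\<lambda>k. L (x (r k))) \<longlonglongrightarrow> ext01 g"
  proof (rule LIMSEQ_I)
    fix e :: real assume e: "0 < e"
    then obtain N where N: "\<And>k t. k \<ge> N \<Longrightarrow> t \<in> {0..1} \<Longrightarrow> norm (L (x (r k)) t - g t) < e / 2"
      using g(3)[of "e / 2"] by auto
    have "norm (L (x (r k)) - ext01 g) \<le> e / 2" if "k \<ge> N" for k
    proof (rule norm_bound)
      fix s
      show "norm ((L (x (r k)) - ext01 g) s) \<le> e / 2"
        using N[OF that, of "clamp01 s"] clamp[of "x (r k)" s] by (simp add: ext01_apply[OF g(1)])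
    qed
    then show "\<exists>N. \<forall>k\<ge>N. norm (L (x (r k)) - ext01 g) < e" using e by (intro exI[of _ N]) fastforce
  qed
  then show "\<exists>l r. strict_mono (r::nat \<Rightarrow> nat) \<and> (\<lambda>k. L (x (r k))) \<longlonglongrightarrow> l" using g(2) by blast
qed

section \<open>The linearized integral operator on continuous functions\<close>

context nystrom
begin

lemma lin_op_integrand_cont:
  assumes "s \<in> {0..1}" "continuous_on {0..1} v"
  shows "continuous_on {0..1} (\<lambda>t. ell s t (\<phi> t) * v t)"
  by (intro continuous_intros assms continuous_on_kernel(2)) (use assms in auto)

lemma lin_op_bound:
  fixes v :: "real \<Rightarrow>\<^sub>C real"
  assumes s: "s \<in> {0..1}"
  shows "\<bar>lin_op v s\<bar> \<le> \<Lambda> * norm v"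
proof -
  have "norm (integral {0..1} (\<lambda>t. ell s t (\<phi> t) * v t)) \<le> (\<Lambda> * norm v) * (1 - 0)"
  proof (rule integral_bound)
    fix t :: real assume t: "t \<in> {0..1}"
    show "norm (ell s t (\<phi> t) * v t) \<le> \<Lambda> * norm v"
      unfolding norm_mult using ell_bound[OF s t phi_R, of t] norm_bounded[of v t] Lam
      by (intro mult_mono) auto
  qed (use s in \<open>auto intro!: lin_op_integrand_cont\<close>)
  then show ?thesis by (simp add: lin_op_def)
qed

lemma lin_op_lip:
  fixes v :: "real \<Rightarrow>\<^sub>C real"
  assumes s: "s \<in> {0..1}" "s' \<in> {0..1}"
  shows "\<bar>lin_op v s - lin_op v s'\<bar> \<le> \<Lambda> * norm v * \<bar>s - s'\<bar>"
proof -
  note c = lin_op_integrand_cont[OF s(1), of v] lin_op_integrand_cont[OF s(2), of v]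
  have "lin_op v s - lin_op v s' = integral {0..1} (\<lambda>t. ell s t (\<phi> t) * v t - ell s' t (\<phi> t) * v t)"
    unfolding lin_op_def using c by (intro integral_diff[symmetric] integrable_continuous_interval) auto
  also have "norm \<dots> \<le> (\<Lambda> * \<bar>s - s'\<bar> * norm v) * (1 - 0)"
  proof (rule integral_bound)
    fix t :: real assume t: "t \<in> {0..1}"
    have "\<bar>ell s t (\<phi> t) - ell s' t (\<phi> t)\<bar> \<le> \<Lambda> * \<bar>s - s'\<bar>"
      using ell_lip[OF s(1) t s(2) t phi_R phi_R, of t t] by simp
    then have "\<bar>ell s t (\<phi> t) - ell s' t (\<phi> t)\<bar> * \<bar>v t\<bar> \<le> \<Lambda> * \<bar>s - s'\<bar> * norm v"
      using norm_bounded[of v t] Lam by (intro mult_mono) auto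
    then show "norm (ell s t (\<phi> t) * v t - ell s' t (\<phi> t) * v t) \<le> \<Lambda> * \<bar>s - s'\<bar> * norm v"
      by (simp add: left_diff_distrib[symmetric] abs_mult)
  qed (use c in \<open>auto intro!: continuous_intros\<close>)
  finally show ?thesis by (simp add: algebra_simps)
qed

definition Lop :: "(real \<Rightarrow>\<^sub>C real) \<Rightarrow> real \<Rightarrow>\<^sub>C real" where
  "Lop v = ext01 (lin_op v)"

lemma Lop_apply: "Lop v s = lin_op v (clamp01 s)"
  unfolding Lop_def by (rule ext01_apply, rule lipschitz_imp_continuous_on_unit, rule lin_op_lip)

lemma norm_Lop: "norm (Lop v) \<le> \<Lambda> * norm v"
  by (rule norm_bound) (simp add: Lop_apply lin_op_bound)

lemma bounded_linear_Lop: "bounded_linear Lop"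
proof (rule bounded_linear_intro[where K = \<Lambda>])
  have int: "(\<lambda>t. ell (clamp01 s) t (\<phi> t) * v t) integrable_on {0..1}" for s and v :: "real \<Rightarrow>\<^sub>C real"
    by (intro integrable_continuous_interval lin_op_integrand_cont) auto
  show "Lop (x + y) = Lop x + Lop y" for x y
    by (rule bcontfun_eqI) (simp add: Lop_apply lin_op_def distrib_left integral_add int)
  show "Lop (r *\<^sub>R x) = r *\<^sub>R Lop x" for r x
    by (rule bcontfun_eqI) (simp add: Lop_apply lin_op_def mult.left_commute)
  show "norm (Lop x) \<le> norm x * \<Lambda>" for x using norm_Lop[of x] by (simp add: mult.commute)
qed

lemma lip_const_Lop: "lip_const (\<Lambda> * norm v) (Lop v)"
  by (rule lip_constI_ext01[OF Lop_apply lin_op_lip]) (use Lam in auto)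

lemma seq_compact_Lop: "seq_compact_map Lop"
  by (rule seq_compact_map_lipschitz[OF Lam norm_Lop lip_const_Lop])
    (simp add: Lop_apply clamp01_id)

end

section \<open>The discrete maps on continuous functions\<close>

context nystrom_disc
begin

definition Gext :: "(real \<Rightarrow>\<^sub>C real) \<Rightarrow> real \<Rightarrow>\<^sub>C real" where
  "Gext y = ext01 (Gop y)"

lemma near_norm:
  fixes y :: "real \<Rightarrow>\<^sub>C real"
  shows "norm (y - \<phi>) \<le> e \<Longrightarrow> e \<le> 1/2 \<Longrightarrow> near e y"
  unfolding near_def
proof (intro conjI ballI)
  assume e: "norm (y - \<phi>) \<le> e" "e \<le> 1/2"
  then show "e \<le> 1/2" by simp
  show "\<bar>y t - \<phi> t\<bar> \<le> e" for t using norm_bounded[of "y - \<phi>" t] e by simp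
qed

text \<open>Nearness to \<phi> enters because \<open>ext01\<close> needs a continuous argument, and
  the Lipschitz bound of \<open>Gop y\<close> supplies it.\<close>

lemma Gext_apply:
  fixes y :: "real \<Rightarrow>\<^sub>C real"
  shows "near e y \<Longrightarrow> Gext y s = Gop y (clamp01 s)"
  unfolding Gext_def by (rule ext01_apply, rule lipschitz_imp_continuous_on_unit, rule Gop_lip)

lemma Gext_approximates: "approximates lip_const Lop \<phi> (1/2) (20 * \<Lambda>\<^sup>2) (1 / real n) Gext"
proof -
  define C where "C = 20 * \<Lambda>\<^sup>2"
  have "\<Lambda> * 1 \<le> \<Lambda> * \<Lambda>" using Lam1 by (intro mult_left_mono) auto
  then have C: "2 * \<Lambda> \<le> C" "C \<ge> 0" using Lam1 unfolding C_def power2_eq_square by linarith+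
  have "lip_const (2 * \<Lambda>) (Gext \<phi>)"
    by (rule lip_constI_ext01[OF Gext_apply[OF near_phi] Gop_lip[OF near_phi]]) (use Lam in auto)
  then have 1: "lip_const C (Gext \<phi>)" by (rule lip_const_mono) (rule C)
  have 2: "norm (Gext x - Gext y) \<le> C * norm (x - y) \<and> lip_const (C * norm (x - y)) (Gext x - Gext y) \<and>
      (\<forall>b. lip_const b (x - y) \<longrightarrow> norm (Gext x - Gext y - Lop (x - y))
         \<le> C * ((norm (x - \<phi>) + norm (y - \<phi>) + 1 / real n) * norm (x - y) + 1 / real n * b))"
    if "norm (x - \<phi>) \<le> 1/2" "norm (y - \<phi>) \<le> 1/2" for x y
  proof -
    have nx: "near (norm (x - \<phi>)) x" and ny: "near (norm (y - \<phi>)) y" using that by (auto intro: near_norm)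
    have a: "\<bar>x t - y t\<bar> \<le> norm (x - y)" for t using norm_bounded[of "x - y" t] by simp
    have app: "(Gext x - Gext y) s = Gop x (clamp01 s) - Gop y (clamp01 s)" for s
      using Gext_apply[OF nx] Gext_apply[OF ny] by simp
    have CC: "2 * \<Lambda> * norm (x - y) \<le> C * norm (x - y)" using C by (intro mult_right_mono) auto
    have "norm (Gext x - Gext y) \<le> 2 * \<Lambda> * norm (x - y)"
      by (rule norm_bound) (simp only: app real_norm_def, rule Gop_diff(1)[OF nx ny a], simp)
    moreover have "lip_const (2 * \<Lambda> * norm (x - y)) (Gext x - Gext y)"
      by (rule lip_constI_ext01[OF app]) (use Gop_diff(2)[OF nx ny a] Lam in auto)
    moreover have "norm (Gext x - Gext y - Lop (x - y))
         \<le> C * ((norm (x - \<phi>) + norm (y - \<phi>) + 1 / real n) * norm (x - y) + 1 / real n * b)"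
      if b: "lip_const b (x - y)" for b
    proof (rule norm_bound)
      fix s
      have "lin_op (x - y) = lin_op (\<lambda>t. x t - y t)" by (simp add: minus_bcontfun.rep_eq[abs_def])
      then have eq: "(Gext x - Gext y - Lop (x - y)) s
          = Gop x (clamp01 s) - Gop y (clamp01 s) - lin_op (\<lambda>t. x t - y t) (clamp01 s)"
        using app[of s] by (simp add: Lop_apply)
      show "norm ((Gext x - Gext y - Lop (x - y)) s)
          \<le> C * ((norm (x - \<phi>) + norm (y - \<phi>) + 1 / real n) * norm (x - y) + 1 / real n * b)"
        unfolding eq C_def real_norm_def
        by (rule Gop_linearization[OF nx ny a])
          (use b lip_const_nonneg[OF b] in \<open>auto simp: lip_const_def\<close>)
    qed
    ultimately show ?thesis using CC lip_const_mono by (meson order_trans)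
  qed
  from 1 2 show ?thesis unfolding approximates_def C_def[symmetric] by blast
qed

lemma Gext_consistent:
  "norm (Gext \<phi> - \<phi>) \<le> consist_const * max ((1 / real (n * p))\<^sup>2) ((1 / real n) ^ 4)"
proof (rule norm_bound)
  fix s
  have "(Gext \<phi> - \<phi>) s = Gop \<phi> (clamp01 s) - \<phi> (clamp01 s)"
    by (simp add: Gext_apply[OF near_phi] phi_clamp)
  then show "norm ((Gext \<phi> - \<phi>) s) \<le> consist_const * max ((1 / real (n * p))\<^sup>2) ((1 / real n) ^ 4)"
    using Gop_consistent[of "clamp01 s"] by simp
qed

lemma Zop_cong:
  assumes eq: "\<And>t. t \<in> {0..1} \<Longrightarrow> x t = y t" and t: "t \<in> {0..1}"
  shows "Zop x t = Zop y t"
proof -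
  have q: "Qn n p x t = Qn n p y t" if "t \<in> {0..1}" for t
    by (rule Qn_cong[OF n that eq])
  have k: "Km \<kappa> (n * p) (Qn n p x) = Km \<kappa> (n * p) (Qn n p y)"
    by (rule ext) (rule Km_cong[OF q])
  show ?thesis unfolding Zop_def k q[OF t] ..
qed

lemma Qn_Zop:
  assumes t: "t \<in> {0..1}"
  shows "Qn n p (Zop y) t = Qn n p y t"
proof -
  have "Qn n p (Zop y) t = Qn n p (\<lambda>t. Qn n p y t + ((f t + Km \<kappa> (n * p) (Qn n p y) t) - Qn n p (\<lambda>t. f t + Km \<kappa> (n * p) (Qn n p y) t) t)) t"
    by (simp add: Zop_def[abs_def])
  then show ?thesis by (simp add: Qn_add Qn_diff Qn_Qn[OF n p t])
qed

text \<open>With \<open>Qn (Zop y) = Qn y\<close> and, from the fixed point equation,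
  \<open>Qn (Km (Zop y)) = Qn (y - f)\<close>, the definition of \<open>Zop y\<close> becomes the
  modified projection equation.\<close>

lemma Zop_solves:
  assumes y: "\<And>s. s \<in> {0..1} \<Longrightarrow> y s = Gop y s" and s: "s \<in> {0..1}"
  shows "Zop y s - KtilM \<kappa> n p (Zop y) s = f s"
proof -
  have k: "Km \<kappa> (n * p) (Qn n p (Zop y)) = Km \<kappa> (n * p) (Qn n p y)"
    by (rule ext) (rule Km_cong[OF Qn_Zop])
  have "Qn n p (Km \<kappa> (n * p) (Zop y)) s = Qn n p (\<lambda>t. y t - f t) s"
    by (rule Qn_cong[OF n s]) (use y in \<open>simp add: Gop_def\<close>)
  then show ?thesis unfolding KtilM_def k by (simp add: Zop_def Qn_add Qn_diff)
qed

text \<open>Applying \<open>Qn\<close> to the equation cancels the two terms with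
  \<open>Qn z\<close> and leaves \<open>Qn z = Qn (f + Km z)\<close>.\<close>

lemma solution_eq_Zop:
  assumes z: "\<And>s. s \<in> {0..1} \<Longrightarrow> z s - KtilM \<kappa> n p z s = f s" and t: "t \<in> {0..1}"
  shows "Zop (\<lambda>s. f s + Km \<kappa> (n * p) z s) t = z t"
proof -
  let ?y = "\<lambda>s. f s + Km \<kappa> (n * p) z s"
  have Q: "Qn n p ?y t = Qn n p z t" if t: "t \<in> {0..1}" for t
  proof -
    have "Qn n p z t = Qn n p (\<lambda>s. f s + (Qn n p (Km \<kappa> (n * p) z) s + Km \<kappa> (n * p) (Qn n p z) s
        - Qn n p (Km \<kappa> (n * p) (Qn n p z)) s)) t"
      by (rule Qn_cong[OF n t]) (use z in \<open>fastforce simp: KtilM_def algebra_simps\<close>)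
    then show ?thesis by (simp add: Qn_add Qn_diff Qn_Qn[OF n p t])
  qed
  have k: "Km \<kappa> (n * p) (Qn n p ?y) = Km \<kappa> (n * p) (Qn n p z)"
    by (rule ext) (rule Km_cong[OF Q])
  show ?thesis
    using z[OF t] unfolding Zop_def k by (simp add: KtilM_def Qn_add)
qed

end

section \<open>Solutions of the discrete equations\<close>

lemma sup01_le: "(\<And>t. t \<in> {0..1} \<Longrightarrow> \<bar>x t\<bar> \<le> b) \<Longrightarrow> sup01 x \<le> b"
  unfolding sup01_def by (rule cSUP_least) auto

lemma sup01_upper:
  assumes "\<And>t. t \<in> {0..1} \<Longrightarrow> \<bar>x t\<bar> \<le> b" "t \<in> {0..1}"
  shows "\<bar>x t\<bar> \<le> sup01 x"
  unfolding sup01_def by (rule cSUP_upper[OF assms(2)]) (use assms(1) in \<open>auto intro!: bdd_aboveI2[where M = b]\<close>)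

lemma sup01_cong: "(\<And>t. t \<in> {0..1} \<Longrightarrow> x t = y t) \<Longrightarrow> sup01 x = sup01 y"
  unfolding sup01_def by (rule SUP_cong) auto

lemma Linf01_imp_bounded:
  assumes "Linf01 x"
  shows "\<exists>b\<ge>0. \<forall>t\<in>{0..1}. \<bar>x t\<bar> \<le> b"
proof -
  obtain b where "\<forall>t\<in>{0..1}. \<bar>x t\<bar> \<le> b"
    using assms unfolding Linf01_def bdd_above_def by auto
  then show ?thesis by (intro exI[of _ "\<bar>b\<bar>"]) force
qed

lemma Linf01_continuous:
  assumes x: "continuous_on {0..1} x"
  shows "Linf01 x"
proof -
  have "set_borel_measurable lebesgue {0..1} x"
    unfolding set_borel_measurable_def
    by (rule measurable_completion) (use borel_measurable_continuous_on_indicator[OF _ x] in simp)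
  moreover have "bdd_above ((\<lambda>t. \<bar>x t\<bar>) ` {0..1})"
    by (rule bounded_imp_bdd_above, rule compact_imp_bounded, rule compact_continuous_image)
      (use x in \<open>auto intro!: continuous_intros\<close>)
  ultimately show ?thesis by (simp add: Linf01_def)
qed

lemma integral_norm_bound_unit:
  fixes g :: "real \<Rightarrow> real"
  assumes "g integrable_on {0..1}" "\<And>t. t \<in> {0..1} \<Longrightarrow> \<bar>g t\<bar> \<le> B"
  shows "\<bar>integral {0..1} g\<bar> \<le> B"
  using integral_norm_bound_integral[of g "{0..1}" "\<lambda>_. B"] assms by auto

context kernel_bounds
begin

lemma kernel_set_integrable:
  assumes s: "s \<in> {0..1}" and x: "Linf01 x" and xR: "\<And>t. t \<in> {0..1} \<Longrightarrow> \<bar>x t\<bar> \<le> R"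
  shows "set_integrable lebesgue {0..1} (\<lambda>t. \<kappa> s t (x t))"
proof -
  \<comment> \<open>Clamping \<open>t\<close> makes \<open>F\<close> continuous on the whole plane,
    so composing it with the merely measurable \<open>x\<close> stays measurable.\<close>
  define F where "F q = \<kappa> s (clamp01 (fst q)) (snd q)" for q :: "real \<times> real"
  have "continuous_on UNIV F"
    unfolding F_def
    by (intro continuous_on_kernel(1) continuous_intros continuous_on_compose2[OF continuous_on_clamp01[of UNIV]])
      (use s in auto)
  then have F: "F \<in> borel_measurable borel" by (rule borel_measurable_continuous_onI)
  define X where "X t = indicat_real {0..1} t *\<^sub>R x t" for t
  have X: "X \<in> borel_measurable lebesgue"
    using x unfolding Linf01_def set_borel_measurable_def X_def[abs_def] by blast
  have id: "(\<lambda>t::real. t) \<in> borel_measurable lebesgue"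
    by (rule measurable_completion) simp
  have g: "(\<lambda>t. F (t, X t)) \<in> borel_measurable lebesgue"
    by (rule measurable_compose[OF borel_measurable_Pair[OF id X] F])
  have "integrable lebesgue (\<lambda>t. indicat_real {0..1} t *\<^sub>R F (t, X t))"
  proof (rule integrableI_bounded_set_indicator[OF _ g, where B = "\<bar>\<kappa> s 0 0\<bar> + \<Lambda> * (1 + R)"])
    have "\<bar>F (t, X t)\<bar> \<le> \<bar>\<kappa> s 0 0\<bar> + \<Lambda> * (1 + R)" if t: "t \<in> {0..1}" for t
    proof -
      have R: "R \<ge> 0" using xR[OF t] by linarith
      have "\<bar>\<kappa> s t (x t) - \<kappa> s 0 0\<bar> \<le> \<Lambda> * (\<bar>t\<bar> + \<bar>x t\<bar>)"
        using kernel_lip[of s t s 0 "x t" 0] s t xR[OF t] R by simp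
      also have "\<dots> \<le> \<Lambda> * (1 + R)" using t xR[OF t] Lam by (intro mult_left_mono) auto
      finally show ?thesis using t by (simp add: F_def X_def clamp01_id)
    qed
    then show "AE t in lebesgue. t \<in> {0..1} \<longrightarrow> norm (F (t, X t)) \<le> \<bar>\<kappa> s 0 0\<bar> + \<Lambda> * (1 + R)" by simp
  qed auto
  moreover have "indicat_real {0..1} t *\<^sub>R F (t, X t) = indicat_real {0..1} t *\<^sub>R \<kappa> s t (x t)" for t
    by (cases "t \<in> {0..1}") (simp_all add: F_def X_def clamp01_id)
  ultimately show ?thesis unfolding set_integrable_def by (simp only:)
qed

lemma Kop_eq_integral:
  assumes s: "s \<in> {0..1}" and x: "Linf01 x" and xR: "\<And>t. t \<in> {0..1} \<Longrightarrow> \<bar>x t\<bar> \<le> R"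
  shows "Kop \<kappa> x s = integral {0..1} (\<lambda>t. \<kappa> s t (x t))" "(\<lambda>t. \<kappa> s t (x t)) integrable_on {0..1}"
  unfolding Kop_def using set_lebesgue_integral_eq_integral[OF kernel_set_integrable[OF assms]] by auto

lemma Kop_lip:
  assumes s: "s \<in> {0..1}" "s' \<in> {0..1}" and x: "Linf01 x" and xR: "\<And>t. t \<in> {0..1} \<Longrightarrow> \<bar>x t\<bar> \<le> R"
  shows "\<bar>Kop \<kappa> x s - Kop \<kappa> x s'\<bar> \<le> \<Lambda> * \<bar>s - s'\<bar>"
proof -
  note i = Kop_eq_integral[OF s(1) x xR] Kop_eq_integral[OF s(2) x xR]
  have "Kop \<kappa> x s - Kop \<kappa> x s' = integral {0..1} (\<lambda>t. \<kappa> s t (x t) - \<kappa> s' t (x t))"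
    using i by (simp add: integral_diff)
  also have "\<bar>\<dots>\<bar> \<le> \<Lambda> * \<bar>s - s'\<bar>"
  proof (rule integral_norm_bound_unit)
    show "(\<lambda>t. \<kappa> s t (x t) - \<kappa> s' t (x t)) integrable_on {0..1}" using i by (intro integrable_diff)
    fix t :: real assume t: "t \<in> {0..1}"
    show "\<bar>\<kappa> s t (x t) - \<kappa> s' t (x t)\<bar> \<le> \<Lambda> * \<bar>s - s'\<bar>"
      using kernel_lip[of s t s' t "x t" "x t"] s t xR[OF t] by simp
  qed
  finally show ?thesis .
qed

text \<open>The second difference of the kernel in its first argument is of order
  \<open>y\<^sup>2\<close> unless \<open>t\<close> lies between \<open>c - y\<close> and
  \<open>c + y\<close>. On that strip of length \<open>2 * y\<close> the Lipschitz bound gives order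
  \<open>y\<close>; the constants add up as \<open>2 + 4 = 6\<close>. Through the integral equation
  \<phi> inherits its second-difference bound from this and from \<open>f\<close>.\<close>

lemma Kop_second:
  assumes x: "continuous_on {0..1} x" and xR: "\<And>t. t \<in> {0..1} \<Longrightarrow> \<bar>x t\<bar> \<le> R"
    and y: "0 \<le> y" "0 \<le> c - y" "c + y \<le> 1"
  shows "\<bar>Kop \<kappa> x (c + y) + Kop \<kappa> x (c - y) - 2 * Kop \<kappa> x c\<bar> \<le> 6 * \<Lambda> * y\<^sup>2"
proof -
  have L: "Linf01 x" using x by (rule Linf01_continuous)
  have c: "c + y \<in> {0..1}" "c - y \<in> {0..1}" "c \<in> {0..1}" using y by auto
  define D where "D t = \<kappa> (c + y) t (x t) + \<kappa> (c - y) t (x t) - 2 * \<kappa> c t (x t)" for t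
  note i = Kop_eq_integral[OF c(1) L xR] Kop_eq_integral[OF c(2) L xR] Kop_eq_integral[OF c(3) L xR]
  have eq: "Kop \<kappa> x (c + y) + Kop \<kappa> x (c - y) - 2 * Kop \<kappa> x c = integral {0..1} D"
    unfolding D_def using i by (simp add: integral_diff integral_add integrable_add)
  have Dc: "continuous_on {0..1} D"
    unfolding D_def by (intro continuous_intros continuous_on_kernel(1) x) (use c in auto)
  have D1: "\<bar>D t\<bar> \<le> 2 * \<Lambda> * y\<^sup>2" if t: "t \<in> {0..1}" "t \<le> c - y \<or> c + y \<le> t" for t
  proof -
    define K where "K = (if t \<le> c - y then lower_prism R else upper_prism R)"
    have "\<bar>D t\<bar> \<le> \<Lambda> * (\<bar>(c + y) + (c - y) - 2 * c\<bar> + \<bar>t + t - 2 * t\<bar> + \<bar>x t + x t - 2 * x t\<bar>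
          + (\<bar>(c + y) - c\<bar> + \<bar>t - t\<bar> + \<bar>x t - x t\<bar>)\<^sup>2 + (\<bar>(c - y) - c\<bar> + \<bar>t - t\<bar> + \<bar>x t - x t\<bar>)\<^sup>2)"
      unfolding D_def
      by (rule kernel_second[where K = K])
        (use t y xR[OF t(1)] in \<open>auto simp: K_def mem_lower_prism mem_upper_prism\<close>)
    then show ?thesis by simp
  qed
  have D2: "\<bar>D t\<bar> \<le> 2 * \<Lambda> * y" if t: "t \<in> {0..1}" for t
    using kernel_lip[of "c + y" t c t "x t" "x t"] kernel_lip[of "c - y" t c t "x t" "x t"] c t xR[OF t] y
    by (simp add: D_def)
  have int: "D integrable_on {a..b}" if "0 \<le> a" "b \<le> 1" for a b
    using that by (intro integrable_continuous_interval continuous_on_subset[OF Dc]) auto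
  have bd: "\<bar>integral {a..b} D\<bar> \<le> B * (b - a)"
    if "0 \<le> a" "a \<le> b" "b \<le> 1" "\<And>t. t \<in> {a..b} \<Longrightarrow> \<bar>D t\<bar> \<le> B" for a b B
    using integral_bound[of a b D B] that continuous_on_subset[OF Dc, of "{a..b}"] by auto
  have "integral {0..1} D = integral {0..c-y} D + integral {c-y..c+y} D + integral {c+y..1} D"
    using Henstock_Kurzweil_Integration.integral_combine[of 0 "c - y" "c + y" D]
      Henstock_Kurzweil_Integration.integral_combine[of 0 "c + y" 1 D] int y by auto
  moreover have "\<bar>integral {0..c-y} D\<bar> \<le> 2 * \<Lambda> * y\<^sup>2 * (c - y - 0)"
    by (rule bd) (use y D1 in auto)
  moreover have "\<bar>integral {c+y..1} D\<bar> \<le> 2 * \<Lambda> * y\<^sup>2 * (1 - (c + y))"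
    by (rule bd) (use y D1 in auto)
  moreover have "\<bar>integral {c-y..c+y} D\<bar> \<le> 2 * \<Lambda> * y * (c + y - (c - y))"
    by (rule bd) (use y D2 in auto)
  moreover have "2 * \<Lambda> * y\<^sup>2 * (c - y - 0) + 2 * \<Lambda> * y\<^sup>2 * (1 - (c + y)) \<le> 2 * \<Lambda> * y\<^sup>2 * 1"
    unfolding distrib_left[symmetric] using Lam y by (intro mult_left_mono) auto
  ultimately have "\<bar>integral {0..1} D\<bar> \<le> 2 * \<Lambda> * y\<^sup>2 * 1 + 2 * \<Lambda> * y * (c + y - (c - y))"
    by linarith
  then show ?thesis unfolding eq by (simp add: power2_eq_square)
qed

lemma kernel_bounds_mono:
  assumes "\<Lambda> \<le> \<Lambda>'"
  shows "kernel_bounds \<kappa> ell R \<Lambda>'"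
proof
  show "0 \<le> \<Lambda>'" using assms Lam by simp
  have up: "a \<le> \<Lambda>' * b" if "a \<le> \<Lambda> * b" "0 \<le> b" for a b
    using that assms by (meson mult_right_mono order_trans)
  show "(\<kappa> s t has_real_derivative ell s t u) (at u)" if "s \<in> {0..1}" "t \<in> {0..1}" for s t u
    using kernel_deriv that .
  show "continuous_on Psi (\<lambda>(s, t, u). \<kappa> s t u)" "continuous_on Psi (\<lambda>(s, t, u). ell s t u)"
    by (rule kernel_cont ell_cont)+
  fix s t u s' t' u' :: real
  assume st: "s \<in> {0..1}" "t \<in> {0..1}" "s' \<in> {0..1}" "t' \<in> {0..1}" "\<bar>u\<bar> \<le> R" "\<bar>u'\<bar> \<le> R"
  show "\<bar>\<kappa> s t u - \<kappa> s' t' u'\<bar> \<le> \<Lambda>' * (\<bar>s - s'\<bar> + \<bar>t - t'\<bar> + \<bar>u - u'\<bar>)"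
    by (rule up[OF kernel_lip[OF st]]) auto
  show "\<bar>ell s t u - ell s' t' u'\<bar> \<le> \<Lambda>' * (\<bar>s - s'\<bar> + \<bar>t - t'\<bar> + \<bar>u - u'\<bar>)"
    by (rule up[OF ell_lip[OF st]]) auto
  assume d: "max t t' \<le> min s s' \<or> max s s' \<le> min t t'"
  have "\<bar>ell s t u - ell s' t u - ell s t' u' + ell s' t' u'\<bar> \<le> \<Lambda> * (\<bar>s - s'\<bar> * (\<bar>t - t'\<bar> + \<bar>u - u'\<bar>))"
    using ell_mixed[OF st d] by (simp add: mult.assoc)
  from up[OF this] show "\<bar>ell s t u - ell s' t u - ell s t' u' + ell s' t' u'\<bar> \<le> \<Lambda>' * \<bar>s - s'\<bar> * (\<bar>t - t'\<bar> + \<bar>u - u'\<bar>)"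
    by (simp add: mult.assoc)
next
  fix K s1 t1 u1 s2 t2 u2 s t u
  assume K: "K \<in> {lower_prism R, upper_prism R}" "(s1, t1, u1) \<in> K" "(s2, t2, u2) \<in> K" "(s, t, u) \<in> K"
  have "\<Lambda> * b \<le> \<Lambda>' * b" if "b \<ge> 0" for b using assms that by (intro mult_right_mono)
  then show "\<bar>\<kappa> s1 t1 u1 + \<kappa> s2 t2 u2 - 2 * \<kappa> s t u\<bar> \<le> \<Lambda>' * (\<bar>s1 + s2 - 2 * s\<bar> + \<bar>t1 + t2 - 2 * t\<bar> + \<bar>u1 + u2 - 2 * u\<bar>
          + (\<bar>s1 - s\<bar> + \<bar>t1 - t\<bar> + \<bar>u1 - u\<bar>)\<^sup>2 + (\<bar>s2 - s\<bar> + \<bar>t2 - t\<bar> + \<bar>u2 - u\<bar>)\<^sup>2)"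
    by (intro order_trans[OF kernel_second[OF K]]) auto
qed

end

lemma C2_01_diff_bounds:
  assumes "C2_01 f"
  shows "\<exists>M. (\<forall>t\<in>{0..1}. \<forall>t'\<in>{0..1}. \<bar>f t - f t'\<bar> \<le> M * \<bar>t - t'\<bar>) \<and>
     (\<forall>c y. 0 \<le> y \<and> 0 \<le> c - y \<and> c + y \<le> 1 \<longrightarrow> \<bar>f (c + y) + f (c - y) - 2 * f c\<bar> \<le> M * y\<^sup>2)"
proof -
  obtain f1 f2 where f1: "\<And>t. t \<in> {0..1} \<Longrightarrow> (f has_real_derivative f1 t) (at t within {0..1})"
    and f2: "\<And>t. t \<in> {0..1} \<Longrightarrow> (f1 has_real_derivative f2 t) (at t within {0..1})"
    and c2: "continuous_on {0..1} f2"
    using assms unfolding C2_01_def by blast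
  have c1: "continuous_on {0..1} f1" by (rule DERIV_continuous_on[OF f2])
  obtain M1 where M1: "M1 \<ge> 0" "\<And>t. t \<in> {0..1} \<Longrightarrow> \<bar>f1 t\<bar> \<le> M1"
    using Linf01_imp_bounded[OF Linf01_continuous[OF c1]] by blast
  obtain M2 where M2: "M2 \<ge> 0" "\<And>t. t \<in> {0..1} \<Longrightarrow> \<bar>f2 t\<bar> \<le> M2"
    using Linf01_imp_bounded[OF Linf01_continuous[OF c2]] by blast
  have lip: "\<bar>f t - f t'\<bar> \<le> M1 * \<bar>t - t'\<bar>" if "t \<in> {0..1}" "t' \<in> {0..1}" for t t'
    using field_differentiable_bound[of "{0..1}" f f1 M1 t t'] f1 M1(2) that by auto
  have lip1: "\<bar>f1 t - f1 t'\<bar> \<le> M2 * \<bar>t - t'\<bar>" if "t \<in> {0..1}" "t' \<in> {0..1}" for t t'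
    using field_differentiable_bound[of "{0..1}" f1 f2 M2 t t'] f2 M2(2) that by auto
  have sec: "\<bar>f (c + y) + f (c - y) - 2 * f c\<bar> \<le> 2 * M2 * y\<^sup>2" if y: "0 \<le> y" "0 \<le> c - y" "c + y \<le> 1" for c y
  proof -
    \<comment> \<open>Removing a linear function of slope \<open>f1 c\<close> leaves second
      differences unchanged and makes the derivative vanish at \<open>c\<close>.\<close>
    define F where "F x = f x - f1 c * x" for x
    have F: "\<bar>F x - F c\<bar> \<le> M2 * y * \<bar>x - c\<bar>" if x: "x \<in> {c-y..c+y}" for x
    proof -
      have "norm (F x - F c) \<le> (M2 * y) * norm (x - c)"
      proof (rule field_differentiable_bound[where S = "{c-y..c+y}" and f' = "\<lambda>x. f1 x - f1 c"])
        fix z assume z: "z \<in> {c-y..c+y}"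
        have z01: "z \<in> {0..1}" "c \<in> {0..1}" using z y by auto
        have "(f has_real_derivative f1 z) (at z within {c-y..c+y})"
          by (rule DERIV_subset[OF f1[OF z01(1)]]) (use y in auto)
        then show "(F has_real_derivative f1 z - f1 c) (at z within {c-y..c+y})"
          unfolding F_def by (auto intro!: derivative_eq_intros)
        have "\<bar>f1 z - f1 c\<bar> \<le> M2 * \<bar>z - c\<bar>" by (rule lip1[OF z01])
        also have "\<dots> \<le> M2 * y" using z M2 by (intro mult_left_mono) auto
        finally show "norm (f1 z - f1 c) \<le> M2 * y" by simp
      qed (use x y in auto)
      then show ?thesis by simp
    qed
    have "f (c + y) + f (c - y) - 2 * f c = (F (c + y) - F c) + (F (c - y) - F c)"
      by (simp add: F_def algebra_simps)
    then show ?thesis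
      using F[of "c + y"] F[of "c - y"] y by (simp add: power2_eq_square)
  qed
  have "M1 * \<bar>a\<bar> \<le> max M1 (2 * M2) * \<bar>a\<bar>" "2 * M2 * b\<^sup>2 \<le> max M1 (2 * M2) * b\<^sup>2" for a b
    by (intro mult_right_mono; simp)+
  then show ?thesis using lip sec by (intro exI[of _ "max M1 (2 * M2)"]) (meson order_trans)
qed

section \<open>The Frechet derivative as an integral operator\<close>

context nystrom
begin

text \<open>Uniqueness of directional derivatives: along \<open>\<tau> * v\<close> both
  \<open>L\<close> and \<open>lin_op\<close> match the increment of \<open>Kop \<kappa>\<close> up
  to \<open>e * (\<tau> * V)\<close>, and dividing by \<tau> leaves an arbitrarily small
  gap.\<close>

lemma frechet_derivative_eq_lin_op:
  assumes \<phi>0: "\<And>t. t \<in> {0..1} \<Longrightarrow> \<phi>0 t = \<phi> t"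
    and fr: "frechet01 (Kop \<kappa>) \<phi>0 L" and s: "s \<in> {0..1}"
  shows "L (apply_bcontfun v) s = lin_op v s"
proof -
  \<comment> \<open>The summand 1 keeps \<open>V\<close> positive when \<open>v = 0\<close>.\<close>
  define V where "V = norm v + 1"
  have V: "V > 0" by (simp add: V_def add_nonneg_pos)
  have vV: "\<bar>v t\<bar> \<le> V" for t using norm_bounded[of v t] by (simp add: V_def)
  have Lv: "Linf01 v" by (rule Linf01_continuous) simp
  have main: "\<bar>L v s - lin_op v s\<bar> \<le> 2 * e * V" if e: "e > 0" for e
  proof -
    obtain d where d: "d > 0" "\<And>h. Linf01 h \<Longrightarrow> sup01 h < d \<Longrightarrow>
        sup01 (\<lambda>s. Kop \<kappa> (\<lambda>t. \<phi>0 t + h t) s - Kop \<kappa> \<phi>0 s - L h s) \<le> e * sup01 h"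
      using fr e unfolding frechet01_def by meson
    \<comment> \<open>In this order: \<open>h\<close> has norm below \<open>d\<close>, \<phi> plus
      \<open>h\<close> stays below \<open>R\<close>, and the quadratic kernel remainder is at most
      \<open>e * (\<tau> * V)\<close>.\<close>
    obtain \<tau> where \<tau>: "\<tau> > 0" "\<tau> \<le> d / (2 * V)" "\<tau> \<le> 1 / V" "\<tau> \<le> e / (\<Lambda> * V)"
    proof
      show "min (d / (2 * V)) (min (1 / V) (e / (\<Lambda> * V))) > 0" using d V e Lam1 by simp
    qed auto
    have \<tau>': "\<tau> * V \<le> d / 2" "\<tau> * V \<le> 1" "\<Lambda> * (\<tau> * V) \<le> e"
      using \<tau> V Lam1 by (auto simp: field_simps)
    \<comment> \<open>The zero summand gives \<open>h\<close> literally the form of the linear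
      combinations in \<open>frechet01\<close>.\<close>
    define h where "h t = \<tau> * v t + 0 * v t" for t
    have hb: "\<bar>h t\<bar> \<le> \<tau> * V" for t
      using vV[of t] \<tau> by (simp add: h_def abs_mult)
    have hc: "continuous_on {0..1} h" unfolding h_def by (intro continuous_intros) auto
    have Lh: "Linf01 h" by (rule Linf01_continuous[OF hc])
    have suph: "sup01 h \<le> \<tau> * V" by (rule sup01_le) (rule hb)
    have hfun: "h = (\<lambda>t. \<tau> * v t + 0 * v t)" by (rule ext) (rule h_def)
    have "L (\<lambda>t. \<tau> * v t + 0 * v t) s = \<tau> * L v s + 0 * L v s"
      using fr Lv s unfolding frechet01_def by blast
    then have lin: "L h s = \<tau> * L v s" unfolding hfun[symmetric] by simp
    have c0: "continuous_on {0..1} \<phi>0"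
      by (rule continuous_on_eq[of _ \<phi>]) (auto simp: \<phi>0)
    have ch: "continuous_on {0..1} (\<lambda>t. \<phi>0 t + h t)" by (intro continuous_intros c0 hc)
    have R0: "\<bar>\<phi>0 t\<bar> \<le> R" if "t \<in> {0..1}" for t using \<phi>0[OF that] phi_R by simp
    have Rh: "\<bar>\<phi>0 t + h t\<bar> \<le> R" if "t \<in> {0..1}" for t
      using \<phi>0[OF that] phi_bound[of t] hb[of t] \<tau>'(2) by linarith
    note L0 = Linf01_continuous[OF c0] and L1 = Linf01_continuous[OF ch]
    have "Linf01 (L h)" using fr Lh unfolding frechet01_def by blast
    then obtain BL where BL: "BL \<ge> 0" "\<And>t. t \<in> {0..1} \<Longrightarrow> \<bar>L h t\<bar> \<le> BL"
      using Linf01_imp_bounded by blast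
    \<comment> \<open>\<open>sup01\<close> is an upper bound only for bounded functions, so all
      three parts of \<open>?D\<close> need a bound on the unit interval.\<close>
    have Kb: "\<bar>Kop \<kappa> x t\<bar> \<le> \<bar>Kop \<kappa> x 0\<bar> + \<Lambda>" if "Linf01 x" "\<And>t. t \<in> {0..1} \<Longrightarrow> \<bar>x t\<bar> \<le> R" "t \<in> {0..1}" for x t
    proof -
      have "\<bar>Kop \<kappa> x t - Kop \<kappa> x 0\<bar> \<le> \<Lambda> * \<bar>t - 0\<bar>" by (rule Kop_lip) (use that in auto)
      also have "\<dots> \<le> \<Lambda> * 1" using that(3) Lam by (intro mult_left_mono) auto
      finally show ?thesis by linarith
    qed
    let ?D = "\<lambda>s. Kop \<kappa> (\<lambda>t. \<phi>0 t + h t) s - Kop \<kappa> \<phi>0 s - L h s"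
    have "\<bar>?D s\<bar> \<le> sup01 ?D"
    proof (rule sup01_upper[OF _ s])
      fix t :: real assume t: "t \<in> {0..1}"
      show "\<bar>?D t\<bar> \<le> (\<bar>Kop \<kappa> (\<lambda>t. \<phi>0 t + h t) 0\<bar> + \<Lambda>) + (\<bar>Kop \<kappa> \<phi>0 0\<bar> + \<Lambda>) + BL"
        using Kb[OF L1 Rh t] Kb[OF L0 R0 t] BL(2)[OF t] by linarith
    qed
    also have "\<dots> \<le> e * sup01 h" by (rule d(2)[OF Lh]) (use suph \<tau>'(1) d(1) in linarith)
    also have "\<dots> \<le> e * (\<tau> * V)" using suph e by (intro mult_left_mono) auto
    finally have 1: "\<bar>?D s\<bar> \<le> e * (\<tau> * V)" .
    note k1 = Kop_eq_integral[OF s L1 Rh] and k0 = Kop_eq_integral[OF s L0 R0]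
    have kint: "(\<lambda>t. ell s t (\<phi> t) * v t) integrable_on {0..1}"
      by (intro integrable_continuous_interval lin_op_integrand_cont s) auto
    then have kint': "(\<lambda>t. \<tau> * (ell s t (\<phi> t) * v t)) integrable_on {0..1}"
      by (rule integrable_on_mult_right)
    have "Kop \<kappa> (\<lambda>t. \<phi>0 t + h t) s - Kop \<kappa> \<phi>0 s - \<tau> * lin_op v s
        = integral {0..1} (\<lambda>t. \<kappa> s t (\<phi>0 t + h t) - \<kappa> s t (\<phi>0 t) - \<tau> * (ell s t (\<phi> t) * v t))"
      using k1 k0 kint' by (simp add: lin_op_def integral_diff integrable_diff)
    also have "\<bar>\<dots>\<bar> \<le> \<Lambda> * (\<tau> * V) * (\<tau> * V)"
    proof (rule integral_norm_bound_unit)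
      show "(\<lambda>t. \<kappa> s t (\<phi>0 t + h t) - \<kappa> s t (\<phi>0 t) - \<tau> * (ell s t (\<phi> t) * v t)) integrable_on {0..1}"
        using k1 k0 kint' by (intro integrable_diff)
      fix t :: real assume t: "t \<in> {0..1}"
      have "\<bar>\<kappa> s t (\<phi> t + h t) - \<kappa> s t (\<phi> t) - ell s t (\<phi> t) * (\<phi> t + h t - \<phi> t)\<bar>
          \<le> \<Lambda> * (\<bar>\<phi> t + h t - \<phi> t\<bar> + \<bar>\<phi> t - \<phi> t\<bar>) * \<bar>\<phi> t + h t - \<phi> t\<bar>"
        by (rule kernel_linearization[OF s t]) (use Rh[OF t] \<phi>0[OF t] phi_R in auto)
      also have "\<dots> = \<Lambda> * \<bar>h t\<bar> * \<bar>h t\<bar>" by simp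
      also have "\<dots> \<le> \<Lambda> * (\<tau> * V) * (\<tau> * V)"
        using hb[of t] Lam \<tau> V by (intro mult_mono) auto
      finally show "\<bar>\<kappa> s t (\<phi>0 t + h t) - \<kappa> s t (\<phi>0 t) - \<tau> * (ell s t (\<phi> t) * v t)\<bar> \<le> \<Lambda> * (\<tau> * V) * (\<tau> * V)"
        using \<phi>0[OF t] by (simp add: h_def mult.left_commute)
    qed
    also have "\<dots> \<le> e * (\<tau> * V)" using \<tau>'(3) \<tau> V by (intro mult_right_mono) auto
    finally have "\<bar>\<tau> * L v s - \<tau> * lin_op v s\<bar> \<le> 2 * (e * (\<tau> * V))" using 1 unfolding lin by linarith
    moreover have "\<bar>\<tau> * L v s - \<tau> * lin_op v s\<bar> = \<tau> * \<bar>L v s - lin_op v s\<bar>"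
      using \<tau>(1) by (simp add: right_diff_distrib[symmetric] abs_mult)
    ultimately have "\<tau> * \<bar>L v s - lin_op v s\<bar> \<le> \<tau> * (2 * e * V)"
      by (simp add: mult_ac)
    then show ?thesis using \<tau>(1) by simp
  qed
  have "\<bar>L v s - lin_op v s\<bar> \<le> 0"
  proof (rule field_le_epsilon)
    fix e :: real assume "0 < e"
    then show "\<bar>L v s - lin_op v s\<bar> \<le> 0 + e" using main[of "e / (2 * V)"] V by simp
  qed
  then show ?thesis by simp
qed

text \<open>On the unit interval a fixed point of \<open>Lop\<close> is a continuous function fixed
  by \<open>L\<close>, hence zero there; since it factors through \<open>clamp01\<close>, it
  vanishes on the line.\<close>

lemma Lop_no_fixpoint:
  assumes \<phi>0: "\<And>t. t \<in> {0..1} \<Longrightarrow> \<phi>0 t = \<phi> t" and fr: "frechet01 (Kop \<kappa>) \<phi>0 L"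
    and not_eig: "\<forall>v. Linf01 v \<and> (\<forall>s\<in>{0..1}. L v s = v s) \<longrightarrow> (\<forall>s\<in>{0..1}. v s = 0)"
    and v: "Lop v = v"
  shows "v = 0"
proof (rule bcontfun_eqI)
  fix s
  have vs: "v s = lin_op v (clamp01 s)" for s using Lop_apply[of v s] v by simp
  have "L v s = v s" if "s \<in> {0..1}" for s
    using frechet_derivative_eq_lin_op[OF \<phi>0 fr that, of v] vs[of s] clamp01_id[OF that] by simp
  moreover have "Linf01 v" by (rule Linf01_continuous) simp
  ultimately have "v (clamp01 s) = 0" using not_eig clamp01_in(1) by blast
  then show "v s = (0 :: real \<Rightarrow>\<^sub>C real) s" using vs[of s] vs[of "clamp01 s"] by (simp add: clamp01_id)
qed

end

context nystrom_disc
begin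

lemma Linf01_Zop:
  assumes y: "near e y"
  shows "Linf01 (Zop y)"
proof -
  let ?w = "\<lambda>t. f t + Km \<kappa> (n * p) (Qn n p y) t"
  have wl: "\<bar>?w s - ?w t\<bar> \<le> (2 * \<Lambda>) * \<bar>s - t\<bar>" if "s \<in> {0..1}" "t \<in> {0..1}" for s t
  proof -
    have "\<bar>Km \<kappa> (n * p) (Qn n p y) s - Km \<kappa> (n * p) (Qn n p y) t\<bar> \<le> \<Lambda> * \<bar>s - t\<bar>"
      by (rule Km_lip[OF m that]) (rule Qn_near_R[OF y])
    then show ?thesis using f_lip[OF that] by linarith
  qed
  have w: "Linf01 ?w" by (rule Linf01_continuous, rule lipschitz_imp_continuous_on_unit, rule wl)
  have Q: "Qn n p v \<in> borel_measurable lebesgue" for v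
    unfolding Qn_eq_cell_avg[abs_def]
    using measurable_cell[of "\<lambda>j. cell_avg n p j v" n] by (intro measurable_completion) simp
  have A: "(\<lambda>t. indicat_real {0..1} t *\<^sub>R Qn n p v t) \<in> borel_measurable lebesgue" for v
    by (intro borel_measurable_scaleR borel_measurable_indicator Q) auto
  have W: "(\<lambda>t. indicat_real {0..1} t *\<^sub>R ?w t) \<in> borel_measurable lebesgue"
    using w unfolding Linf01_def set_borel_measurable_def by blast
  have "(\<lambda>t. indicat_real {0..1} t *\<^sub>R Qn n p y t + (indicat_real {0..1} t *\<^sub>R ?w t - indicat_real {0..1} t *\<^sub>R Qn n p ?w t)) \<in> borel_measurable lebesgue"
    by (rule borel_measurable_add[OF A borel_measurable_diff[OF W A]])
  then have "set_borel_measurable lebesgue {0..1} (Zop y)"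
    unfolding set_borel_measurable_def Zop_def[abs_def] by (simp add: algebra_simps)
  moreover have "bdd_above ((\<lambda>t. \<bar>Zop y t\<bar>) ` {0..1})"
    using Zop_near(2)[OF y] by (auto intro!: bdd_aboveI2[where M = R])
  ultimately show ?thesis by (simp add: Linf01_def)
qed

end

lemma eventually_divide_nat_le: "d > 0 \<Longrightarrow> \<forall>\<^sub>F n in sequentially. c / real n \<le> d" for c d :: real
proof -
  assume "d > 0"
  moreover have "(\<lambda>n. c / real n) \<longlonglongrightarrow> 0" by (rule lim_const_over_n)
  ultimately have "\<forall>\<^sub>F n in sequentially. c / real n < d" by (rule order_tendstoD(2)[rotated])
  then show ?thesis by (rule eventually_mono) simp
qed

context nystrom
begin

text \<open>Existence and the error bound come from the fixed point \<open>y\<close> of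
  \<open>Gext\<close> through \<open>z = Zop y\<close>. Uniqueness transfers back: the iterate of
  any competitor lies in the \<epsilon>-ball and solves the same fixed point equation.\<close>

theorem discrete_solutions:
  assumes inj: "\<And>v. Lop v = v \<Longrightarrow> v = 0"
  shows "\<exists>\<delta>0>0. \<exists>C N. \<forall>n\<ge>N. \<forall>p\<ge>1.
           \<exists>z. Linf01 z \<and> sup01 (\<lambda>t. z t - \<phi> t) < \<delta>0 \<and>
               (\<forall>s\<in>{0..1}. z s - KtilM \<kappa> n p z s = f s) \<and>
               (\<forall>z'. Linf01 z' \<and> sup01 (\<lambda>t. z' t - \<phi> t) < \<delta>0 \<and>
                     (\<forall>s\<in>{0..1}. z' s - KtilM \<kappa> n p z' s = f s)
                     \<longrightarrow> (\<forall>s\<in>{0..1}. z' s = z s)) \<and>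
               sup01 (\<lambda>s. (Km \<kappa> (n * p) z s + f s) - \<phi> s)
                 \<le> C * max ((1 / real (n * p)) ^ 2) ((1 / real n) ^ 4)"
    (is "\<exists>\<delta>0>0. \<exists>C N. \<forall>n\<ge>N. \<forall>p\<ge>1. ?Q \<delta>0 C n p")
proof -
  define A where "A = 20 * \<Lambda>\<^sup>2"
  have "\<Lambda> * 1 \<le> \<Lambda> * \<Lambda>" using Lam1 by (intro mult_left_mono) auto
  then have A: "\<Lambda> \<le> A" "A \<ge> 1" using Lam1 unfolding A_def power2_eq_square by linarith+
  obtain B where B: "B > 0" "\<And>x. norm x \<le> B * norm (x - Lop x)"
    using id_minus_compact_bounded_below[OF bounded_linear_Lop seq_compact_Lop inj] by blast
  have surj: "surj (\<lambda>x. x - Lop x)"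
    using bounded_linear_Lop seq_compact_Lop inj by (rule id_minus_compact_surj)
  have Av: "\<Lambda> * norm v \<le> A * norm v" for v :: "real \<Rightarrow>\<^sub>C real" using A by (intro mult_right_mono) auto
  have "lip_const \<Lambda> \<phi>" unfolding lip_const_def using phi_lip by blast
  then have phiA: "lip_const A \<phi>" using A(1) by (rule lip_const_mono)
  have "\<exists>\<epsilon>>0. \<epsilon> \<le> 1/2 \<and> (\<exists>\<eta>>0. \<exists>C'. \<forall>G h. 0 \<le> h \<and> h \<le> \<eta> \<and> norm (G \<phi> - \<phi>) \<le> \<eta> \<and>
           approximates lip_const Lop \<phi> (1/2) A h G \<longrightarrow>
           (\<exists>y. norm (y - \<phi>) \<le> \<epsilon> \<and> G y = y \<and> norm (y - \<phi>) \<le> C' * norm (G \<phi> - \<phi>) \<and>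
                (\<forall>y'. norm (y' - \<phi>) \<le> \<epsilon> \<and> G y' = y' \<longrightarrow> y' = y)))"
  proof (rule perturbed_fixed_point[where B = B])
    show "norm (Lop x) \<le> A * norm x" "lip_const (A * norm x) (Lop x)" for x
      using order_trans[OF norm_Lop Av] lip_const_mono[OF lip_const_Lop Av] by blast+
  qed (fact bounded_linear_Lop B surj lip_const_add lip_const_minus lip_const_mono closed_lip_const phiA A(2)
      | simp)+
  then obtain \<epsilon> \<eta> C' where eps: "\<epsilon> > 0" "\<epsilon> \<le> 1/2" and eta: "\<eta> > 0"
    and fp: "\<forall>G h. 0 \<le> h \<and> h \<le> \<eta> \<and> norm (G \<phi> - \<phi>) \<le> \<eta> \<and>
           approximates lip_const Lop \<phi> (1/2) A h G \<longrightarrow>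
           (\<exists>y. norm (y - \<phi>) \<le> \<epsilon> \<and> G y = y \<and> norm (y - \<phi>) \<le> C' * norm (G \<phi> - \<phi>) \<and>
                (\<forall>y'. norm (y' - \<phi>) \<le> \<epsilon> \<and> G y' = y' \<longrightarrow> y' = y))"
    by blast
  \<comment> \<open>At most 1/2, so that competitors stay below \<open>R\<close>; and
    \<open>\<Lambda> * \<delta> \<le> \<epsilon> / 2\<close> leaves the other half of \<epsilon> to
    the quadrature error of \<phi>.\<close>
  define \<delta> where "\<delta> = min (1/2) (\<epsilon> / (2 * \<Lambda>))"
  have \<delta>: "\<delta> > 0" "\<delta> \<le> 1/2" "\<Lambda> * \<delta> \<le> \<epsilon> / 2"
    using eps Lam1 by (auto simp: \<delta>_def min_def field_simps)
  have cc: "consist_const \<ge> 0" unfolding consist_const_def using quad_const_nonneg Lam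
    by (intro add_nonneg_nonneg mult_nonneg_nonneg) auto
  \<comment> \<open>The two quarters of \<delta> place \<open>Zop y\<close> strictly inside the
    \<delta>-ball, \<open>6 * \<Lambda> / real n \<le> 1\<close> is \<open>n_large\<close>, and the
    bounds by \<eta> feed the abstract fixed point theorem.\<close>
  have "\<forall>\<^sub>F n in sequentially. (1 / real n \<le> \<eta> \<and> consist_const / real n \<le> \<eta> \<and> quad_const / real n \<le> \<epsilon> / 2)
      \<and> \<bar>C'\<bar> * consist_const / real n \<le> \<delta> / 4 \<and> 3 * \<Lambda> / real n \<le> \<delta> / 4 \<and> 6 * \<Lambda> / real n \<le> 1 \<and> n > 0"
    using eta eps(1) \<delta>(1) by (intro eventually_conj eventually_divide_nat_le eventually_gt_at_top) auto
  then obtain N where N: "\<And>n. n \<ge> N \<Longrightarrow> 1 / real n \<le> \<eta> \<and> consist_const / real n \<le> \<eta> \<and> quad_const / real n \<le> \<epsilon> / 2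
      \<and> \<bar>C'\<bar> * consist_const / real n \<le> \<delta> / 4 \<and> 3 * \<Lambda> / real n \<le> \<delta> / 4 \<and> 6 * \<Lambda> / real n \<le> 1 \<and> n > 0"
    unfolding eventually_sequentially by blast
  have "?Q \<delta> (\<bar>C'\<bar> * consist_const) n p"
    if n: "n \<ge> N" and p: "p \<ge> 1" for n p
  proof -
    have Nn: "1 / real n \<le> \<eta>" "consist_const / real n \<le> \<eta>" "quad_const / real n \<le> \<epsilon> / 2"
      "\<bar>C'\<bar> * consist_const / real n \<le> \<delta> / 4" "3 * \<Lambda> / real n \<le> \<delta> / 4" "6 * \<Lambda> / real n \<le> 1" "n > 0"
      using N[OF n] by auto
    interpret nystrom_disc \<kappa> ell R \<Lambda> f \<phi> n p
      by unfold_locales (use p Nn(6,7) in \<open>auto simp: field_simps\<close>)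
    define \<mu> where "\<mu> = max ((1 / real (n * p)) ^ 2) ((1 / real n) ^ 4)"
    have "n * 1 \<le> n * p" using p by (intro mult_left_mono) auto
    then have "real n \<le> real (n * p)" by (simp del: of_nat_mult)
    then have hm: "0 \<le> 1 / real (n * p)" "1 / real (n * p) \<le> 1 / real n" "1 / real n \<le> 1"
      using Nn(7) p by (auto intro: divide_left_mono simp del: of_nat_mult)
    \<comment> \<open>Lowering all powers to \<open>1 / real n\<close> makes the threshold
      \<open>N\<close> independent of \<open>p\<close>.\<close>
    have hm2: "(1 / real (n * p))\<^sup>2 \<le> 1 / real n"
      using hm power_decreasing[of 1 2 "1 / real (n * p)"] by simp
    have "(1 / real n) ^ 4 \<le> (1 / real n) ^ 1"
      using hm by (intro power_decreasing) auto
    then have \<mu>: "\<mu> \<le> 1 / real n" "\<mu> \<ge> 0" using hm2 by (auto simp: \<mu>_def le_max_iff_disj)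
    have Gcons: "norm (Gext \<phi> - \<phi>) \<le> consist_const * \<mu>"
      using Gext_consistent by (simp add: \<mu>_def)
    also have "\<dots> \<le> consist_const * (1 / real n)" using \<mu> cc by (intro mult_left_mono)
    finally have "norm (Gext \<phi> - \<phi>) \<le> \<eta>" using Nn(2) by simp
    moreover have "0 \<le> 1 / real n" by simp
    ultimately have "\<exists>y. norm (y - \<phi>) \<le> \<epsilon> \<and> Gext y = y \<and> norm (y - \<phi>) \<le> C' * norm (Gext \<phi> - \<phi>) \<and>
        (\<forall>y'. norm (y' - \<phi>) \<le> \<epsilon> \<and> Gext y' = y' \<longrightarrow> y' = y)"
      using Nn(1) Gext_approximates[folded A_def] by (intro fp[rule_format] conjI)
    then obtain y where y: "norm (y - \<phi>) \<le> \<epsilon>" "Gext y = y" "norm (y - \<phi>) \<le> C' * norm (Gext \<phi> - \<phi>)"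
      and uniq: "\<And>y'. norm (y' - \<phi>) \<le> \<epsilon> \<Longrightarrow> Gext y' = y' \<Longrightarrow> y' = y"
      by blast
    define e where "e = \<bar>C'\<bar> * consist_const * \<mu>"
    have "C' * norm (Gext \<phi> - \<phi>) \<le> \<bar>C'\<bar> * (consist_const * \<mu>)"
      using Gcons by (intro mult_mono) auto
    then have ye: "norm (y - \<phi>) \<le> e" using y(3) by (simp add: e_def mult.assoc)
    have "e \<le> \<bar>C'\<bar> * consist_const * (1 / real n)" unfolding e_def using \<mu> cc by (intro mult_left_mono) auto
    then have "e \<le> \<bar>C'\<bar> * consist_const / real n" by simp
    then have e: "e \<le> \<delta> / 4" using Nn(4) by linarith
    have ny: "near e y" by (rule near_norm[OF ye]) (use e \<delta> in linarith)
    have yG: "y s = Gop y s" if "s \<in> {0..1}" for s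
      using Gext_apply[OF ny, of s] y(2) clamp01_id[OF that] by simp
    have z_near: "sup01 (\<lambda>t. Zop y t - \<phi> t) < \<delta>"
    proof -
      have "sup01 (\<lambda>t. Zop y t - \<phi> t) \<le> e + 3 * \<Lambda> / real n" by (rule sup01_le) (rule Zop_near(1)[OF ny])
      then show ?thesis using e Nn(5) \<delta>(1) by linarith
    qed
    have z_unique: "z' s = Zop y s"
      if z': "Linf01 z'" "sup01 (\<lambda>t. z' t - \<phi> t) < \<delta>" "\<forall>s\<in>{0..1}. z' s - KtilM \<kappa> n p z' s = f s"
        and s: "s \<in> {0..1}" for z' s
    proof -
      obtain b where b: "b \<ge> 0" "\<And>t. t \<in> {0..1} \<Longrightarrow> \<bar>z' t\<bar> \<le> b"
        using Linf01_imp_bounded[OF z'(1)] by blast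
      have zd: "\<bar>z' t - \<phi> t\<bar> \<le> \<delta>" if t: "t \<in> {0..1}" for t
      proof -
        have "\<bar>z' t - \<phi> t\<bar> \<le> sup01 (\<lambda>t. z' t - \<phi> t)"
        proof (rule sup01_upper[OF _ t])
          show "\<bar>z' t - \<phi> t\<bar> \<le> b + R" if "t \<in> {0..1}" for t using b(2)[OF that] phi_R[of t] by linarith
        qed
        then show ?thesis using z'(2) by linarith
      qed
      have zR: "\<bar>z' t\<bar> \<le> R" if "t \<in> {0..1}" for t
        using zd[OF that] \<delta>(2) phi_bound[of t] by linarith
      \<comment> \<open>The iterate of the competitor; its extension will be a fixed point of
        \<open>Gext\<close> in the \<epsilon>-ball.\<close>
      define x where "x s = f s + Km \<kappa> (n * p) z' s" for s
      have xl: "\<bar>x s - x t\<bar> \<le> (2 * \<Lambda>) * \<bar>s - t\<bar>" if "s \<in> {0..1}" "t \<in> {0..1}" for s t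
        using Km_lip[OF m that, of z'] zR f_lip[OF that] unfolding x_def by fastforce
      have xa: "ext01 x t = x (clamp01 t)" for t
        by (rule ext01_apply, rule lipschitz_imp_continuous_on_unit, rule xl)
      have xphi: "\<bar>x t - \<phi> t\<bar> \<le> \<epsilon>" if t: "t \<in> {0..1}" for t
      proof -
        have "\<bar>Km \<kappa> (n * p) z' t - Km \<kappa> (n * p) \<phi> t\<bar> \<le> \<Lambda> * \<delta>"
          by (rule Km_diff_bound[OF m t zR phi_R zd])
        moreover have "\<bar>(\<phi> t - f t) - Km \<kappa> (n * p) \<phi> t\<bar> \<le> quad_const / real n"
          using order_trans[OF quad_error_phi[OF m t] mult_left_mono[OF hm2 quad_const_nonneg]] by simp
        ultimately show ?thesis using \<delta>(3) Nn(3) unfolding x_def by linarith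
      qed
      have xn: "norm (ext01 x - \<phi>) \<le> \<epsilon>"
      proof (rule norm_bound)
        fix t show "norm ((ext01 x - \<phi>) t) \<le> \<epsilon>"
          using xphi[of "clamp01 t"] by (simp add: xa phi_clamp)
      qed
      have xZ: "Zop (ext01 x) t = z' t" if t: "t \<in> {0..1}" for t
      proof -
        have "Zop (ext01 x) t = Zop x t" by (rule Zop_cong[OF _ t]) (simp add: xa clamp01_id)
        also have "\<dots> = z' t" unfolding x_def[abs_def] by (rule solution_eq_Zop[OF _ t]) (use z'(3) in blast)
        finally show ?thesis .
      qed
      have "Gext (ext01 x) = ext01 x"
      proof (rule bcontfun_eqI)
        fix t
        have "Gext (ext01 x) t = Gop (ext01 x) (clamp01 t)"
          by (rule Gext_apply[OF near_norm[OF xn eps(2)]])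
        moreover have "Km \<kappa> (n * p) (Zop (ext01 x)) (clamp01 t) = Km \<kappa> (n * p) z' (clamp01 t)"
          by (rule Km_cong) (rule xZ)
        then have "Gop (ext01 x) (clamp01 t) = x (clamp01 t)" by (simp only: Gop_def x_def)
        ultimately show "Gext (ext01 x) t = ext01 x t" by (simp add: xa)
      qed
      with xn have "ext01 x = y" by (rule uniq)
      then show ?thesis using xZ[OF s] by simp
    qed
    have err: "sup01 (\<lambda>s. (Km \<kappa> (n * p) (Zop y) s + f s) - \<phi> s) \<le> e"
    proof (rule sup01_le)
      fix s :: real assume s: "s \<in> {0..1}"
      have "(Km \<kappa> (n * p) (Zop y) s + f s) - \<phi> s = (y - \<phi>) s" using yG[OF s] by (simp add: Gop_def)
      then show "\<bar>(Km \<kappa> (n * p) (Zop y) s + f s) - \<phi> s\<bar> \<le> e" using norm_bounded[of "y - \<phi>" s] ye by simp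
    qed
    show ?thesis
      using Linf01_Zop[OF ny] z_near Zop_solves[OF yG] z_unique err
      unfolding e_def \<mu>_def by (intro exI[of _ "Zop y"]) blast
  qed
  then show ?thesis using \<delta>(1) by blast
qed

end

theorem theorem4p3:
  fixes \<kappa> :: "real \<Rightarrow> real \<Rightarrow> real \<Rightarrow> real"
    and f \<phi> :: "real \<Rightarrow> real"
    and L :: "(real \<Rightarrow> real) \<Rightarrow> (real \<Rightarrow> real)"
  assumes kernel: "kernel_G2_2_0 \<kappa>"
    and f_C2: "C2_01 f"
    and phi_Linf: "Linf01 \<phi>"
    and phi_sol: "\<forall>s\<in>{0..1}. \<phi> s - Kop \<kappa> \<phi> s = f s"
    and phi_unique: "\<forall>\<psi>. Linf01 \<psi> \<and> (\<forall>s\<in>{0..1}. \<psi> s - Kop \<kappa> \<psi> s = f s)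
                        \<longrightarrow> (\<forall>s\<in>{0..1}. \<psi> s = \<phi> s)"
    and deriv: "frechet01 (Kop \<kappa>) \<phi> L"
    and not_eig: "\<forall>v. Linf01 v \<and> (\<forall>s\<in>{0..1}. L v s = v s) \<longrightarrow> (\<forall>s\<in>{0..1}. v s = 0)"
  shows "\<exists>\<delta>0>0. \<exists>C N. \<forall>n\<ge>N. \<forall>p\<ge>1.
           \<exists>z. Linf01 z \<and> sup01 (\<lambda>t. z t - \<phi> t) < \<delta>0 \<and>
               (\<forall>s\<in>{0..1}. z s - KtilM \<kappa> n p z s = f s) \<and>
               (\<forall>z'. Linf01 z' \<and> sup01 (\<lambda>t. z' t - \<phi> t) < \<delta>0 \<and>
                     (\<forall>s\<in>{0..1}. z' s - KtilM \<kappa> n p z' s = f s)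
                     \<longrightarrow> (\<forall>s\<in>{0..1}. z' s = z s)) \<and>
               sup01 (\<lambda>s. (Km \<kappa> (n * p) z s + f s) - \<phi> s)
                 \<le> C * max ((1 / real (n * p)) ^ 2) ((1 / real n) ^ 4)"
proof -
  obtain R0 where R0: "R0 \<ge> 0" "\<And>t. t \<in> {0..1} \<Longrightarrow> \<bar>\<phi> t\<bar> \<le> R0"
    using Linf01_imp_bounded[OF phi_Linf] by blast
  define R where "R = R0 + 1"
  have phiR: "\<bar>\<phi> t\<bar> \<le> R" if "t \<in> {0..1}" for t using R0(2)[OF that] by (simp add: R_def)
  obtain ell \<Lambda>0 where kb: "kernel_bounds \<kappa> ell R \<Lambda>0"
    using kernel_G2_2_0_imp_bounds[OF kernel] by blast
  obtain M where f_lip: "\<And>t t'. t \<in> {0..1} \<Longrightarrow> t' \<in> {0..1} \<Longrightarrow> \<bar>f t - f t'\<bar> \<le> M * \<bar>t - t'\<bar>"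
    and f_sec: "\<And>c y. 0 \<le> y \<Longrightarrow> 0 \<le> c - y \<Longrightarrow> c + y \<le> 1 \<Longrightarrow> \<bar>f (c + y) + f (c - y) - 2 * f c\<bar> \<le> M * y\<^sup>2"
    using C2_01_diff_bounds[OF f_C2] by blast
  have M0: "M \<ge> 0" using f_lip[of 0 1] by simp
  interpret k0: kernel_bounds \<kappa> ell R \<Lambda>0 by (rule kb)
  have phi: "\<phi> s = f s + Kop \<kappa> \<phi> s" if "s \<in> {0..1}" for s using phi_sol that by force
  \<comment> \<open>Initially \<phi> is just bounded and measurable. The integral equation upgrades
    it to Lipschitz, hence continuous, and then to bounded second differences.\<close>
  have phi_lip: "\<bar>\<phi> t - \<phi> t'\<bar> \<le> (M + \<Lambda>0) * \<bar>t - t'\<bar>" if "t \<in> {0..1}" "t' \<in> {0..1}" for t t'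
    using k0.Kop_lip[OF that phi_Linf phiR] f_lip[OF that] phi[OF that(1)] phi[OF that(2)]
    unfolding distrib_right by linarith
  have phi_cont: "continuous_on {0..1} \<phi>" by (rule lipschitz_imp_continuous_on_unit[OF phi_lip])
  have phi_sec: "\<bar>\<phi> (c + y) + \<phi> (c - y) - 2 * \<phi> c\<bar> \<le> (M + 6 * \<Lambda>0) * y\<^sup>2"
    if y: "0 \<le> y" "0 \<le> c - y" "c + y \<le> 1" for c y
  proof -
    have "c + y \<in> {0..1}" "c - y \<in> {0..1}" "c \<in> {0..1}" using y by auto
    then show ?thesis
      using k0.Kop_second[OF phi_cont phiR y] f_sec[OF y] phi[of "c + y"] phi[of "c - y"] phi[of c]
      unfolding distrib_right by linarith
  qed
  \<comment> \<open>A sum of nonnegative parts, so that it dominates every constant of the locale.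
    The last group bounds \<open>ell\<close>, with \<open>2 + R\<close> bounding
    \<open>\<bar>s\<bar> + \<bar>t\<bar> + \<bar>u\<bar>\<close>.\<close>
  define \<Lambda> where "\<Lambda> = 1 + M + 6 * \<Lambda>0 + (\<bar>ell 0 0 0\<bar> + \<Lambda>0 * (2 + R))"
  have rest: "\<bar>ell 0 0 0\<bar> + \<Lambda>0 * (2 + R) \<ge> 0" using k0.Lam R0(1) by (simp add: R_def)
  have Lam: "\<Lambda>0 \<le> \<Lambda>" "1 \<le> \<Lambda>" "M \<le> \<Lambda>" "M + \<Lambda>0 \<le> \<Lambda>" "M + 6 * \<Lambda>0 \<le> \<Lambda>" "\<bar>ell 0 0 0\<bar> + \<Lambda>0 * (2 + R) \<le> \<Lambda>"
    unfolding \<Lambda>_def using rest M0 k0.Lam by linarith+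
  define \<Phi> where "\<Phi> = ext01 \<phi>"
  have Phi: "\<Phi> t = \<phi> (clamp01 t)" for t unfolding \<Phi>_def by (rule ext01_apply[OF phi_cont])
  have Phi_eq: "\<Phi> t = \<phi> t" if "t \<in> {0..1}" for t using Phi[of t] clamp01_id[OF that] by simp
  have up: "a \<le> \<Lambda> * b" if "a \<le> c * b" "c \<le> \<Lambda>" "0 \<le> b" for a b c
    using that by (meson mult_right_mono order_trans)
  interpret k1: kernel_bounds \<kappa> ell R \<Lambda> by (rule k0.kernel_bounds_mono[OF Lam(1)])
  interpret nystrom \<kappa> ell R \<Lambda> f \<Phi>
  proof
    show "1 \<le> \<Lambda>" by (rule Lam)
    show "\<bar>ell s t u\<bar> \<le> \<Lambda>" if "s \<in> {0..1}" "t \<in> {0..1}" "\<bar>u\<bar> \<le> R" for s t u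
    proof -
      have "\<bar>ell s t u - ell 0 0 0\<bar> \<le> \<Lambda>0 * (\<bar>s - 0\<bar> + \<bar>t - 0\<bar> + \<bar>u - 0\<bar>)"
        by (rule k0.ell_lip) (use that R0(1) in \<open>auto simp: R_def\<close>)
      also have "\<dots> \<le> \<Lambda>0 * (2 + R)" using that k0.Lam by (intro mult_left_mono) auto
      finally show ?thesis using Lam(6) by linarith
    qed
    show "\<bar>\<Phi> t\<bar> \<le> R - 1" for t using R0(2)[of "clamp01 t"] by (simp add: Phi R_def)
    show "\<Phi> (clamp01 t) = \<Phi> t" for t by (simp add: Phi clamp01_id)
    show "\<bar>\<Phi> t - \<Phi> t'\<bar> \<le> \<Lambda> * \<bar>t - t'\<bar>" for t t'
    proof -
      have "\<bar>\<Phi> t - \<Phi> t'\<bar> \<le> (M + \<Lambda>0) * \<bar>clamp01 t - clamp01 t'\<bar>" unfolding Phi by (rule phi_lip) auto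
      also have "\<dots> \<le> (M + \<Lambda>0) * \<bar>t - t'\<bar>"
        using clamp01_dist M0 k0.Lam by (intro mult_left_mono) auto
      finally show ?thesis using Lam(4) by (rule up) simp
    qed
    show "\<bar>\<Phi> (c + y) + \<Phi> (c - y) - 2 * \<Phi> c\<bar> \<le> \<Lambda> * y\<^sup>2" if y: "0 \<le> y" "0 \<le> c - y" "c + y \<le> 1" for c y
    proof -
      have "c + y \<in> {0..1}" "c - y \<in> {0..1}" "c \<in> {0..1}" using y by auto
      then show ?thesis using up[OF phi_sec[OF y] Lam(5)] by (simp add: Phi_eq)
    qed
    show "\<bar>f t - f t'\<bar> \<le> \<Lambda> * \<bar>t - t'\<bar>" if "t \<in> {0..1}" "t' \<in> {0..1}" for t t'
      using f_lip[OF that] Lam(3) by (rule up) simp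
    show "\<Phi> s = f s + integral {0..1} (\<lambda>t. \<kappa> s t (\<Phi> t))" if "s \<in> {0..1}" for s
    proof -
      have "integral {0..1} (\<lambda>t. \<kappa> s t (\<Phi> t)) = integral {0..1} (\<lambda>t. \<kappa> s t (\<phi> t))"
        by (rule integral_cong) (simp add: Phi_eq)
      then show ?thesis using k0.Kop_eq_integral(1)[OF that phi_Linf phiR] phi[OF that] Phi_eq[OF that] by simp
    qed
  qed
  have "Lop v = v \<Longrightarrow> v = 0" for v
    by (rule Lop_no_fixpoint[OF _ deriv not_eig]) (auto simp: Phi_eq)
  note main = discrete_solutions[OF this]
  have c1: "sup01 (\<lambda>t. z t - \<Phi> t) = sup01 (\<lambda>t. z t - \<phi> t)" for z
    by (rule sup01_cong) (simp add: Phi_eq)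
  show ?thesis using main unfolding c1 .
qed

end
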